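(* Consider the non-autonomous system $\dot x=Ax+f_0(x)+f_1(x,t)$ on a compact neighborhood $U\subset\mathbb{R}^n$ of $x=0$, where $A\in\mathbb{R}^{n\times n}$ is semisimple and has no eigenvalue with zero real part, $f_0\in C^r(U)$, $f_0(x)=o(|x|)$, and $\|f_1\|_U=\sup_{(x,t)\in U\times\mathbb{R}}|f_1(x,t)|<\infty$. Assume that a unique, uniformly bounded trajectory $x^*(t)\subset U$ of this system exists, with $x^*(t)$ perturbing from the fixed point $x=0$ of $\dot x=Ax+f_0(x)$ under the forcing term $f_1(x,t)$. Assume further that $f_1$ has $r\ge1$ continuous derivatives with respect to $x$ at $x=0$ that are uniformly bounded in $t$ within $U$. Then, for any positive integer $N\le r$, a formal expansion for $x^*(t)$ exists in the form $$x^*(t)=\sum_{\nu=1}^N x_\nu(t)+o\left(\|f_1\|_U^N\right),$$ where $x_\nu(t)=(x_\nu^1(t),\ldots,x_\nu^n(t))=\mathcal{O}\left(\|f_1\|_U^\nu\right)$. The coefficients are given by $$x_1(t)=\int_{-\infty}^{\infty}G(t-\tau)f_1(0,\tau)\,d\tau$$ and, for $\nu\ge2$, recursively by $$\begin{aligned}x_\nu(t)=&\sum_{1\le|\boldsymbol\gamma|\le\nu}\ \sum_{s=1}^{\nu}\ \sum_{p_s(\nu,\boldsymbol\gamma)}\int_{-\infty}^{\infty}G(t-\tau)\left[\frac{\partial^{|\boldsymbol\gamma|}f_0(0)}{\partial x_1^{\gamma_1}\cdots\partial x_n^{\gamma_n}}\prod_{j=1}^{s}\frac{\prod_{i=1}^n\left[x_{\ell_j}^i(\tau)\right]^{k_{ji}}}{\prod_{i=1}^n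 k_{ji}!}\right]d\tau\\&+\sum_{1\le|\boldsymbol\gamma|\le\nu-1}\ \sum_{s=1}^{\nu-1}\ \sum_{p_s(\nu-1,\boldsymbol\gamma)}\int_{-\infty}^{\infty}G(t-\tau)\left[\frac{\partial^{|\boldsymbol\gamma|}f_1(0,\tau)}{\partial x_1^{\gamma_1}\cdots\partial x_n^{\gamma_n}}\prod_{j=1}^{s}\frac{\prod_{i=1}^n\left[x_{\ell_j}^i(\tau)\right]^{k_{ji}}}{\prod_{i=1}^n k_{ji}!}\right]d\tau .\end{aligned}$$
   Context: $\mathbb{N}$ includes $0$, and $\boldsymbol\gamma=(\gamma_1,\ldots,\gamma_n)\in\mathbb{N}^n$ is a multi-index with $|\boldsymbol\gamma|=\sum_i\gamma_i$. The index set is $$p_s(\nu,\boldsymbol\gamma)=\Big\{(\mathbf{k}_1,\ldots,\mathbf{k}_s,\ell_1,\ldots,\ell_s):\ \mathbf{k}_i\in\mathbb{N}^n-\{\mathbf{0}\},\ \ell_i\in\mathbb{N},\ 0<\ell_1<\cdots<\ell_s,\ \sum_{i=1}^s\mathbf{k}_i=\boldsymbol\gamma,\ \sum_{i=1}^s|\mathbf{k}_i|\ell_i=\nu\Big\},$$ and $k_{ji}$ is the $i$-th component of $\mathbf{k}_j$. (Terms with $|\boldsymbol\gamma|=1$ in the first sum vanish because $\partial_xf_0(0)=0$, so the right-hand side involves only $x_1,\dots,x_{\nu-1}$.) The matrix $T\in\mathbb{R}^{n\times n}$ has as columns the real and imaginary parts of the eigenvectors of $A$, ordered so that $T^{-1}AT=\begin{pmatrix}A^s&0\\0&A^u\end{pmatrix}$,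 where $A^s$ carries the eigenvalues of $A$ with negative real part and $A^u$ those with positive real part. The Green's function is $$G(t)=T\begin{pmatrix}e^{A^st}&0\\0&0\end{pmatrix}T^{-1}\ (t\ge0),\qquad G(t)=T\begin{pmatrix}0&0\\0&-e^{A^ut}\end{pmatrix}T^{-1}\ (t<0).$$ "Formal expansion" means: upon writing $f_1=\epsilon\tilde f_1$ with a bookkeeping parameter $\epsilon\ge0$, the uniformly bounded solution is expanded as $x^*(t)=\sum_{\nu\ge1}\epsilon^\nu\xi_\nu(t)$ with coefficients $\xi_\nu(t)$ uniformly bounded in $t$ that solve the equations obtained by equating equal powers of $\epsilon$ in the differential equation, and $x_\nu=\epsilon^\nu\xi_\nu$. No continuity of $f_1$ in $t$ is required. *)

theory Defs
  imports "HOL-Analysis.Analysis" "HOL-Library.Landau_Symbols"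
begin

section \<open>Linear part and Green's function\<close>

definition eigenpair :: "real^'n^'n \<Rightarrow> complex \<Rightarrow> complex^'n \<Rightarrow> bool" where
  "eigenpair A \<mu> v \<longleftrightarrow> v \<noteq> 0 \<and> map_matrix complex_of_real A *v v = \<mu> *s v"

definition semisimple :: "real^'n^'n \<Rightarrow> bool" where
  "semisimple A \<longleftrightarrow> (\<exists>P D :: complex^'n^'n. invertible P \<and> (\<forall>i j. i \<noteq> j \<longrightarrow> D $ i $ j = 0) \<and>
     map_matrix complex_of_real A = P ** D ** matrix_inv P)"

definition hyperbolic :: "real^'n^'n \<Rightarrow> bool" where
  "hyperbolic A \<longleftrightarrow> (\<forall>\<mu> v. eigenpair A \<mu> v \<longrightarrow> Re \<mu> \<noteq> 0)"

definition mexp :: "real^'n^'n \<Rightarrow> real^'n^'n" where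
  "mexp M = (\<Sum>k. (1 / fact k) *\<^sub>R (((**) M ^^ k) (mat 1)))"

text \<open>
  Coordinates are indexed by a finite type without a preferred order. A splitting of the
  coordinates into two consecutive blocks is therefore given by a set \<open>S\<close> of indices and its
  complement, and a diagonal block is stored in a full-size matrix, padded with zeros.
\<close>

definition block :: "'n set \<Rightarrow> real^'n^'n \<Rightarrow> real^'n^'n" where
  "block S M = (\<chi> i j. if i \<in> S \<and> j \<in> S then M $ i $ j else 0)"

text \<open>An eigenvalue of the unpadded block has an eigenvector that is supported on \<open>S\<close>.\<close>

definition block_eigenvalue :: "'n set \<Rightarrow> real^'n^'n \<Rightarrow> complex \<Rightarrow> bool" where
  "block_eigenvalue S M \<mu> \<longleftrightarrow> (\<exists>v. (\<forall>i. i \<notin> S \<longrightarrow> v $ i = 0) \<and> eigenpair (block S M) \<mu> v)"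

definition conj_by :: "real^'n^'n \<Rightarrow> real^'n^'n \<Rightarrow> real^'n^'n" where
  "conj_by T A = matrix_inv T ** A ** T"

definition splitting_basis :: "real^'n^'n \<Rightarrow> real^'n^'n \<Rightarrow> 'n set \<Rightarrow> bool" where
  "splitting_basis A T S \<longleftrightarrow>
     invertible T \<and>
     (\<forall>j. \<exists>\<mu> v. eigenpair A \<mu> v \<and>
        (column j T = (\<chi> i. Re (v $ i)) \<or> column j T = (\<chi> i. Im (v $ i)))) \<and>
     (\<forall>i j. (i \<in> S) \<noteq> (j \<in> S) \<longrightarrow> conj_by T A $ i $ j = 0) \<and>
     (\<forall>\<mu>. block_eigenvalue S (conj_by T A) \<mu> \<longrightarrow> Re \<mu> < 0) \<and>
     (\<forall>\<mu>. block_eigenvalue (- S) (conj_by T A) \<mu> \<longrightarrow> Re \<mu> > 0)"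

text \<open>
  The exponential of a padded block is the identity outside the block, hence the outer
  application of \<^const>\<open>block\<close>.
\<close>

definition green :: "real^'n^'n \<Rightarrow> real^'n^'n \<Rightarrow> 'n set \<Rightarrow> real \<Rightarrow> real^'n^'n" where
  "green A T S t =
     (if t \<ge> 0 then T ** block S (mexp (t *\<^sub>R block S (conj_by T A))) ** matrix_inv T
      else T ** (- block (- S) (mexp (t *\<^sub>R block (- S) (conj_by T A)))) ** matrix_inv T)"

section \<open>Partial derivatives\<close>

definition pd :: "'n::finite \<Rightarrow> (real^'n \<Rightarrow> real^'n) \<Rightarrow> real^'n \<Rightarrow> real^'n" where
  "pd i f x = vector_derivative (\<lambda>h. f (x + h *\<^sub>R axis i 1)) (at 0)"

abbreviation pds :: "'n::finite list \<Rightarrow> (real^'n \<Rightarrow> real^'n) \<Rightarrow> real^'n \<Rightarrow> real^'n" where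
  "pds is f \<equiv> foldr pd is f"

definition Ck_open :: "nat \<Rightarrow> (real^'n) set \<Rightarrow> (real^'n \<Rightarrow> real^'n) \<Rightarrow> bool" where
  "Ck_open r V f \<longleftrightarrow>
     (\<forall>is i. length is < r \<longrightarrow>
        (\<forall>x\<in>V. (\<lambda>h. pds is f (x + h *\<^sub>R axis i 1)) differentiable (at 0))) \<and>
     (\<forall>is. length is \<le> r \<longrightarrow> continuous_on V (pds is f))"

text \<open>On a compact set, the derivatives in the interior extend continuously to the set.\<close>

definition Ck_compact :: "nat \<Rightarrow> (real^'n) set \<Rightarrow> (real^'n \<Rightarrow> real^'n) \<Rightarrow> bool" where
  "Ck_compact r U f \<longleftrightarrow> continuous_on U f \<and> Ck_open r (interior U) f \<and>
     (\<forall>is. length is \<le> r \<longrightarrow>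
        (\<exists>F. continuous_on U F \<and> (\<forall>x\<in>interior U. F x = pds is f x)))"

definition mi_abs :: "nat^'n \<Rightarrow> nat" where
  "mi_abs \<gamma> = (\<Sum>i\<in>UNIV. \<gamma> $ i)"

text \<open>
  An arbitrary fixed enumeration \<open>x\<^sub>1, \<dots>, x\<^sub>n\<close> of the coordinates. For functions of
  class \<open>C\<^sup>r\<close> the derivatives of order at most \<open>r\<close> do not depend on it.
\<close>

definition coords :: "'n::finite list" where
  "coords = (SOME xs. distinct xs \<and> set xs = UNIV)"

lemma coords:
  "distinct (coords :: 'n::finite list)" "set (coords :: 'n list) = UNIV"
proof -
  have "\<exists>xs :: 'n::finite list. distinct xs \<and> set xs = UNIV"
    using finite_distinct_list[OF finite[of "UNIV :: 'n set"]] by blast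
  from someI_ex[OF this] show "distinct (coords :: 'n list)" "set (coords :: 'n list) = UNIV"
    unfolding coords_def by auto
qed

definition mpartial :: "nat^'n \<Rightarrow> (real^'n \<Rightarrow> real^'n) \<Rightarrow> real^'n \<Rightarrow> real^'n" where
  "mpartial \<gamma> f = foldr (\<lambda>i. pd i ^^ (\<gamma> $ i)) coords f"

section \<open>Index sets of the multivariate chain rule\<close>

definition p_set :: "nat \<Rightarrow> nat \<Rightarrow> nat^'n \<Rightarrow> ((nat^'n) list \<times> nat list) set" where
  "p_set s \<nu> \<gamma> = {(ks, ls).
     length ks = s \<and> length ls = s \<and>
     (\<forall>j<s. ks ! j \<noteq> 0) \<and> (\<forall>j<s. 0 < ls ! j) \<and> sorted_wrt (<) ls \<and>
     (\<Sum>j<s. ks ! j) = \<gamma> \<and> (\<Sum>j<s. mi_abs (ks ! j) * ls ! j) = \<nu>}"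

definition chain_factor :: "nat \<Rightarrow> (nat^'n) list \<Rightarrow> nat list \<Rightarrow> (nat \<Rightarrow> real^'n) \<Rightarrow> real" where
  "chain_factor s ks ls y =
     (\<Prod>j<s. (\<Prod>i\<in>UNIV. (y (ls ! j) $ i) ^ (ks ! j $ i)) / (\<Prod>i\<in>UNIV. fact (ks ! j $ i)))"

lemma finite_mi_abs_le: "finite {\<gamma> :: nat^'n. mi_abs \<gamma> \<le> m}"
proof -
  have "{\<gamma> :: nat^'n. mi_abs \<gamma> \<le> m} \<subseteq> (\<lambda>f. \<chi> i. f i) ` (UNIV \<rightarrow>\<^sub>E {..m})"
  proof
    fix \<gamma> :: "nat^'n" assume "\<gamma> \<in> {\<gamma>. mi_abs \<gamma> \<le> m}"
    moreover have "\<gamma> $ i \<le> mi_abs \<gamma>" for i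
      unfolding mi_abs_def by (rule member_le_sum) auto
    ultimately have "vec_nth \<gamma> \<in> UNIV \<rightarrow>\<^sub>E {..m}" by (auto intro: order_trans)
    moreover have "\<gamma> = (\<chi> i. vec_nth \<gamma> i)" by simp
    ultimately show "\<gamma> \<in> (\<lambda>f. \<chi> i. f i) ` (UNIV \<rightarrow>\<^sub>E {..m})" by blast
  qed
  then show ?thesis by (rule finite_subset) (intro finite_imageI finite_PiE, auto)
qed

lemma finite_p_set: "finite (p_set s \<nu> \<gamma> :: ((nat^'n) list \<times> nat list) set)"
proof -
  let ?K = "{ks :: (nat^'n) list. set ks \<subseteq> {k. mi_abs k \<le> \<nu>} \<and> length ks = s}"
  let ?L = "{ls. set ls \<subseteq> {..\<nu>} \<and> length ls = s}"
  have "p_set s \<nu> \<gamma> \<subseteq> ?K \<times> ?L"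
  proof (clarify)
    fix ks :: "(nat^'n) list" and ls assume a: "(ks, ls) \<in> p_set s \<nu> \<gamma>"
    have "mi_abs (ks ! j) \<le> \<nu> \<and> ls ! j \<le> \<nu>" if j: "j < s" for j
    proof -
      have "mi_abs (ks ! j) * ls ! j \<le> (\<Sum>j<s. mi_abs (ks ! j) * ls ! j)"
        using j by (intro member_le_sum) auto
      then have le: "mi_abs (ks ! j) * ls ! j \<le> \<nu>" using a by (simp add: p_set_def)
      have "ks ! j \<noteq> 0" "0 < ls ! j" using a j by (auto simp: p_set_def)
      then have "mi_abs (ks ! j) \<noteq> 0" by (auto simp: mi_abs_def vec_eq_iff sum_eq_0_iff)
      then have "0 < mi_abs (ks ! j)" by simp
      with \<open>0 < ls ! j\<close> have "mi_abs (ks ! j) \<le> mi_abs (ks ! j) * ls ! j"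
        "ls ! j \<le> mi_abs (ks ! j) * ls ! j" by auto
      with le show ?thesis by linarith
    qed
    then show "(ks \<in> ?K) \<and> (ls \<in> ?L)"
      using a by (auto simp: p_set_def in_set_conv_nth)
  qed
  moreover have "finite (?K \<times> ?L)"
    by (intro finite_cartesian_product finite_lists_length_eq finite_mi_abs_le) auto
  ultimately show ?thesis by (rule finite_subset)
qed

section \<open>Trajectories and formal expansions\<close>

text \<open>
  The forcing need not be continuous in time, so solutions are understood in the
  Caratheodory sense, i.e. through the integrated equation.
\<close>

definition solves :: "(real \<Rightarrow> real^'n \<Rightarrow> real^'n) \<Rightarrow> (real \<Rightarrow> real^'n) \<Rightarrow> bool" where
  "solves F x \<longleftrightarrow> (\<forall>a b. a \<le> b \<longrightarrow> ((\<lambda>s. F s (x s)) has_integral (x b - x a)) {a..b})"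

definition vfield ::
  "real^'n^'n \<Rightarrow> (real^'n \<Rightarrow> real^'n) \<Rightarrow> (real^'n \<Rightarrow> real \<Rightarrow> real^'n) \<Rightarrow> real \<Rightarrow> real^'n \<Rightarrow> real^'n" where
  "vfield A f0 f1 t x = A *v x + f0 x + f1 x t"

definition bounded_trajectory ::
  "real^'n^'n \<Rightarrow> (real^'n \<Rightarrow> real^'n) \<Rightarrow> (real^'n \<Rightarrow> real \<Rightarrow> real^'n) \<Rightarrow> (real^'n) set \<Rightarrow>
   (real \<Rightarrow> real^'n) \<Rightarrow> bool" where
  "bounded_trajectory A f0 f1 U x \<longleftrightarrow> solves (vfield A f0 f1) x \<and> range x \<subseteq> U \<and> bounded (range x)"

definition supnorm :: "(real^'n) set \<Rightarrow> (real^'n \<Rightarrow> real \<Rightarrow> real^'n) \<Rightarrow> real" where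
  "supnorm U f = (SUP (x, t)\<in>U \<times> UNIV. norm (f x t))"

abbreviation scaled :: "real \<Rightarrow> (real^'n \<Rightarrow> real \<Rightarrow> real^'n) \<Rightarrow> real^'n \<Rightarrow> real \<Rightarrow> real^'n" where
  "scaled \<epsilon> f \<equiv> (\<lambda>x t. \<epsilon> *\<^sub>R f x t)"

text \<open>The coefficient of the \<open>\<nu>\<close>-th power of \<open>\<epsilon>\<close> in the Taylor expansion of \<open>h\<close> at \<open>0\<close>.\<close>

definition power_coeff :: "nat \<Rightarrow> (real \<Rightarrow> real^'n) \<Rightarrow> real^'n" where
  "power_coeff \<nu> h = (1 / fact \<nu>) *\<^sub>R (((\<lambda>u \<epsilon>. vector_derivative u (at \<epsilon>)) ^^ \<nu>) h 0)"

text \<open>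
  Inserting \<open>\<Sum>\<mu>=1..N. \<epsilon>\<^sup>\<mu> \<xi>\<^sub>\<mu>\<close> for the solution, the coefficient of the
  \<open>\<nu>\<close>-th power of \<open>\<epsilon>\<close> is the derivative of \<open>\<xi>\<^sub>\<nu>\<close> on the left-hand side of the
  differential equation, and a \<^const>\<open>power_coeff\<close> on its right-hand side.
\<close>

definition formal_expansion ::
  "real^'n^'n \<Rightarrow> (real^'n \<Rightarrow> real^'n) \<Rightarrow> (real^'n \<Rightarrow> real \<Rightarrow> real^'n) \<Rightarrow> nat \<Rightarrow>
   (nat \<Rightarrow> real \<Rightarrow> real^'n) \<Rightarrow> bool" where
  "formal_expansion A f0 f N \<xi> \<longleftrightarrow>
     (\<forall>\<nu>\<in>{1..N}. bounded (range (\<xi> \<nu>)) \<and>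
        (\<forall>a b. a \<le> b \<longrightarrow>
          ((\<lambda>s. power_coeff \<nu> (\<lambda>\<epsilon>. vfield A f0 (scaled \<epsilon> f) s (\<Sum>\<mu>=1..N. \<epsilon> ^ \<mu> *\<^sub>R \<xi> \<mu> s)))
             has_integral (\<xi> \<nu> b - \<xi> \<nu> a)) {a..b}))"

definition coefficient_formulas ::
  "(real \<Rightarrow> real^'n^'n) \<Rightarrow> (real^'n \<Rightarrow> real^'n) \<Rightarrow> (real^'n \<Rightarrow> real \<Rightarrow> real^'n) \<Rightarrow> nat \<Rightarrow>
   (nat \<Rightarrow> real \<Rightarrow> real^'n) \<Rightarrow> bool" where
  "coefficient_formulas G f0 f1 N x \<longleftrightarrow>
     (\<forall>t. x 1 t = (LINT \<tau>|lebesgue. G (t - \<tau>) *v f1 0 \<tau>)) \<and>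
     (\<forall>\<nu>\<in>{2..N}. \<forall>t. x \<nu> t =
        (\<Sum>\<gamma> | 1 \<le> mi_abs \<gamma> \<and> mi_abs \<gamma> \<le> \<nu>. \<Sum>s=1..\<nu>. \<Sum>(ks, ls)\<in>p_set s \<nu> \<gamma>.
           LINT \<tau>|lebesgue. G (t - \<tau>) *v
             (chain_factor s ks ls (\<lambda>l. x l \<tau>) *\<^sub>R mpartial \<gamma> f0 0)) +
        (\<Sum>\<gamma> | 1 \<le> mi_abs \<gamma> \<and> mi_abs \<gamma> \<le> \<nu> - 1. \<Sum>s=1..\<nu> - 1. \<Sum>(ks, ls)\<in>p_set s (\<nu> - 1) \<gamma>.
           LINT \<tau>|lebesgue. G (t - \<tau>) *v
             (chain_factor s ks ls (\<lambda>l. x l \<tau>) *\<^sub>R mpartial \<gamma> (\<lambda>y. f1 y \<tau>) 0)))"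

text \<open>The integrals above converge (a divergent Bochner integral would have the value \<open>0\<close>).\<close>

definition coefficient_integrals_converge ::
  "(real \<Rightarrow> real^'n^'n) \<Rightarrow> (real^'n \<Rightarrow> real^'n) \<Rightarrow> (real^'n \<Rightarrow> real \<Rightarrow> real^'n) \<Rightarrow> nat \<Rightarrow>
   (nat \<Rightarrow> real \<Rightarrow> real^'n) \<Rightarrow> bool" where
  "coefficient_integrals_converge G f0 f1 N x \<longleftrightarrow>
     (\<forall>t. integrable lebesgue (\<lambda>\<tau>. G (t - \<tau>) *v f1 0 \<tau>)) \<and>
     (\<forall>\<nu>\<in>{2..N}. \<forall>t \<gamma> s ks ls.
        (1 \<le> mi_abs \<gamma> \<and> mi_abs \<gamma> \<le> \<nu> \<and> s \<in> {1..\<nu>} \<and> (ks, ls) \<in> p_set s \<nu> \<gamma> \<longrightarrow>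
           integrable lebesgue (\<lambda>\<tau>. G (t - \<tau>) *v
             (chain_factor s ks ls (\<lambda>l. x l \<tau>) *\<^sub>R mpartial \<gamma> f0 0))) \<and>
        (1 \<le> mi_abs \<gamma> \<and> mi_abs \<gamma> \<le> \<nu> - 1 \<and> s \<in> {1..\<nu> - 1} \<and> (ks, ls) \<in> p_set s (\<nu> - 1) \<gamma> \<longrightarrow>
           integrable lebesgue (\<lambda>\<tau>. G (t - \<tau>) *v
             (chain_factor s ks ls (\<lambda>l. x l \<tau>) *\<^sub>R mpartial \<gamma> (\<lambda>y. f1 y \<tau>) 0))))"

end

theory Submission
  imports Defs
begin

text \<open>
  A semisimple hyperbolic \<open>A\<close> is diagonalized over the complex numbers. In these coordinates the Green's
  function is a diagonal matrix of scalar kernels, and a bounded solution of \<open>x' = A x + g\<close> with bounded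
  \<open>g\<close> is unique and equals the convolution of \<open>g\<close> with the Green's function, which is bounded by
  a constant times the supremum of \<open>g\<close>. Taylor's formula and the multinomial formula show that inserting
  \<open>\<Sum>\<^sub>\<nu> \<epsilon>\<^sup>\<nu> \<xi>\<^sub>\<nu>\<close> into the nonlinearity yields the stated sums as coefficients, with an error
  \<open>o(\<epsilon>\<^sup>N)\<close> that is uniform in time; since \<open>f\<^sub>1\<close> already carries one factor \<open>\<epsilon>\<close>, boundedness of its
  derivatives is enough for this. The coefficient equations are solved successively by the
  convolution. The difference \<open>y\<close> between the trajectory and its expansion is
  again a bounded solution of such a linear equation; its inhomogeneity is the residual plus a term that is Lipschitz
  in \<open>y\<close> with a small constant, so it can be absorbed.
\<close>

section \<open>The linear inhomogeneous equation\<close>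

text \<open>Since the forcing is only measurable in time, velocities need not exist at every
  instant. Arguments about trajectories therefore run on the integrated equation, with gauge
  integrals, and variation of constants rests on a product rule that never differentiates the
  solution. Measurability of the forcing along a trajectory is read off from the integrated equation
  that the trajectory solves. The coefficients are defined through iterated \<epsilon>-derivatives
  at zero, whereas the recursion gives sums over \<open>p_set\<close>. The two are matched by
  uniqueness of Taylor polynomials with remainder \<open>o(\<epsilon>^N)\<close>, so no closed
  formula for higher derivatives of a composition is proved. The estimates are relative to the sup
  norm of the scaled forcing, which is at least \<epsilon> times that of \<open>f\<close>. If the
  latter is zero, the \<open>o\<close> statement requires an error that vanishes identically for
  small \<epsilon>; there, uniqueness of the trajectory identifies it with zero.\<close>

lemma quadratic_modulus_constant:
  fixes \<Phi> :: "real \<Rightarrow> 'a::real_normed_vector"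
  assumes "\<And>s t. a \<le> s \<Longrightarrow> s \<le> t \<Longrightarrow> t \<le> b \<Longrightarrow> norm (\<Phi> t - \<Phi> s) \<le> C * (t - s)\<^sup>2" and ab: "a \<le> b"
  shows "\<Phi> b = \<Phi> a"
proof -
  have est: "norm (\<Phi> t - \<Phi> s) \<le> C * (t - s)\<^sup>2" if "s \<in> {a..b}" "t \<in> {a..b}" for s t
    using assms(1)[of s t] assms(1)[of t s] that
    by (cases "s \<le> t") (auto simp: norm_minus_commute power2_commute)
  \<comment> \<open>A second-order increment leaves zero as the derivative at every point of the
    interval, endpoints included.\<close>
  have "(\<Phi> has_derivative (\<lambda>h. 0)) (at s within {a..b})" if s: "s \<in> {a..b}" for s
    unfolding has_derivative_within_alt
  proof (intro conjI allI impI)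
    fix e :: real assume e: "e > 0"
    show "\<exists>d>0. \<forall>y\<in>{a..b}. norm (y - s) < d \<longrightarrow> norm (\<Phi> y - \<Phi> s - 0) \<le> e * norm (y - s)"
    \<comment> \<open>The sign of \<open>C\<close> is not prescribed, hence the absolute value;
      adding one keeps the denominator nonzero.\<close>
    proof (intro exI[of _ "e / (\<bar>C\<bar> + 1)"] conjI ballI impI)
      show "0 < e / (\<bar>C\<bar> + 1)" using e by simp
      fix y assume y: "y \<in> {a..b}" and d: "norm (y - s) < e / (\<bar>C\<bar> + 1)"
      have "norm (\<Phi> y - \<Phi> s) \<le> C * (y - s)\<^sup>2" by (rule est[OF s y])
      also have "\<dots> = (C * \<bar>y - s\<bar>) * \<bar>y - s\<bar>" by (simp add: power2_eq_square)
      also have "\<dots> \<le> e * \<bar>y - s\<bar>"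
      proof (rule mult_right_mono)
        have "C * \<bar>y - s\<bar> \<le> (\<bar>C\<bar> + 1) * \<bar>y - s\<bar>" by (intro mult_right_mono) auto
        also have "\<dots> \<le> e" using d by (simp add: field_simps)
        finally show "C * \<bar>y - s\<bar> \<le> e" .
      qed auto
      finally show "norm (\<Phi> y - \<Phi> s - 0) \<le> e * norm (y - s)" by simp
    qed
  qed auto
  then have "\<exists>c. \<forall>x\<in>{a..b}. \<Phi> x = c"
    by (intro has_derivative_zero_constant) auto
  then show ?thesis using ab by auto
qed

text \<open>Gauge integrability alone is not stable under multiplication. Boundedness of
  \<open>k\<close> upgrades it to absolute integrability, which survives a bounded measurable
  factor.\<close>

lemma has_integral_bounded_mult:
  fixes k E :: "real \<Rightarrow> complex"
  assumes "k integrable_on {a..b}" "\<And>t. t \<in> {a..b} \<Longrightarrow> norm (k t) \<le> B" "continuous_on {a..b} E"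
  shows "(\<lambda>t. E t * k t) integrable_on {a..b}"
proof -
  have b: "bilinear ((*) :: complex \<Rightarrow> complex \<Rightarrow> complex)"
    unfolding bilinear_conv_bounded_bilinear by (rule bounded_bilinear_mult)
  have "(\<lambda>t. E t * k t) absolutely_integrable_on {a..b}"
  proof (rule absolutely_integrable_bounded_measurable_product[OF b])
    show "E \<in> borel_measurable (lebesgue_on {a..b})"
      by (rule continuous_imp_measurable_on_sets_lebesgue[OF assms(3)]) auto
    show "bounded (E ` {a..b})"
      by (intro compact_imp_bounded compact_continuous_image assms(3)) auto
    show "k absolutely_integrable_on {a..b}"
      by (rule absolutely_integrable_integrable_bound[OF assms(2) assms(1)]) auto
  qed auto
  then show ?thesis by (rule set_lebesgue_integral_eq_integral(1))
qed

text \<open>Obtained without Fubini's theorem from a quadratic estimate of the defect on short intervals.\<close>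

lemma has_integral_product_rule:
  fixes k E E' u :: "real \<Rightarrow> complex"
  assumes u: "\<And>a b. a \<le> b \<Longrightarrow> (k has_integral (u b - u a)) {a..b}"
    and k: "\<And>t. t \<in> {a..b} \<Longrightarrow> norm (k t) \<le> B"
    and E: "\<And>t. (E has_vector_derivative E' t) (at t)" "continuous_on UNIV E'"
    and ab: "a \<le> b"
  shows "((\<lambda>t. E' t * u t + E t * k t) has_integral (E b * u b - E a * u a)) {a..b}"
proof -
  have B0: "B \<ge> 0" using order_trans[OF norm_ge_zero k[of a]] ab by simp
  have "bounded (E' ` {a..b})"
    by (intro compact_imp_bounded compact_continuous_image continuous_on_subset[OF E(2)]) auto
  then obtain M where M0: "M > 0" and "\<forall>x \<in> E' ` {a..b}. norm x \<le> M"
    unfolding bounded_pos by blast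
  then have M: "norm (E' t) \<le> M" if "t \<in> {a..b}" for t using that by blast
  have ulip: "norm (u t - u s) \<le> B * (t - s)" if "a \<le> s" "s \<le> t" "t \<le> b" for s t
    using has_integral_bound_real[OF B0 finite.emptyI u[OF that(2)]] k that by simp
  have ucont: "continuous_on {a..b} u"
  proof (rule lipschitz_on_continuous_on[of B])
    show "B-lipschitz_on {a..b} u"
    proof (rule lipschitz_onI)
      fix x y assume "x \<in> {a..b}" "y \<in> {a..b}"
      then show "dist (u x) (u y) \<le> B * dist x y"
        using ulip[of x y] ulip[of y x] by (cases "x \<le> y") (auto simp: dist_norm norm_minus_commute)
    qed (rule B0)
  qed
  have Econt: "continuous_on S E" for S
    by (intro continuous_at_imp_continuous_on ballI has_vector_derivative_continuous[OF E(1)])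
  have EI: "(E' has_integral (E t - E s)) {s..t}" if "s \<le> t" for s t
    by (rule fundamental_theorem_of_calculus[OF that has_vector_derivative_at_within[OF E(1)]])
  have Elip: "norm (E t - E s) \<le> M * (t - s)" if "a \<le> s" "s \<le> t" "t \<le> b" for s t
    using has_integral_bound_real[OF less_imp_le[OF M0] finite.emptyI EI[OF that(2)]] M that by simp
  let ?f = "\<lambda>t. E' t * u t + E t * k t"
  have int: "?f integrable_on {a..b}"
  proof (rule integrable_add)
    show "(\<lambda>t. E' t * u t) integrable_on {a..b}"
      by (intro integrable_continuous_interval continuous_intros ucont continuous_on_subset[OF E(2)]) auto
    show "(\<lambda>t. E t * k t) integrable_on {a..b}"
      by (rule has_integral_bounded_mult[OF has_integral_integrable[OF u[OF ab]] k Econt])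
  qed
  \<comment> \<open>The defect of integration by parts up to time \<open>t\<close>; the product rule
    says that it is constant.\<close>
  let ?\<Phi> = "\<lambda>t. E t * u t - integral {a..t} ?f"
  have "?\<Phi> b = ?\<Phi> a"
  proof (rule quadratic_modulus_constant[where C = "M * B + M * B", OF _ ab])
    fix s t assume st: "a \<le> s" "s \<le> t" "t \<le> b"
    have i: "?f integrable_on {s..t}" by (rule integrable_on_subinterval[OF int]) (use st in auto)
    have "integral {a..s} ?f + integral {s..t} ?f = integral {a..t} ?f"
      by (rule Henstock_Kurzweil_Integration.integral_combine) (use st in \<open>auto intro: integrable_on_subinterval[OF int]\<close>)
    then have eq: "?\<Phi> t - ?\<Phi> s = (E t - E s) * u t + E s * (u t - u s) - integral {s..t} ?f"
      by (simp add: algebra_simps)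
    \<comment> \<open>Freezing \<open>u\<close> at the right end and \<open>E\<close> at the left
      end makes the increment of the product exact. What remains under the integral is a bounded
      factor times an increment of a Lipschitz function, hence of order \<open>t - s\<close>, and
      integration adds another factor \<open>t - s\<close>.\<close>
    have "((\<lambda>\<tau>. E' \<tau> * u t + E s * k \<tau> - ?f \<tau>) has_integral ?\<Phi> t - ?\<Phi> s) {s..t}"
      unfolding eq
      by (intro has_integral_diff has_integral_add has_integral_mult_left has_integral_mult_right
          EI u st integrable_integral i)
    moreover have "norm (E' \<tau> * u t + E s * k \<tau> - ?f \<tau>) \<le> (M * B + M * B) * (t - s)"
      if \<tau>: "\<tau> \<in> {s..t}" for \<tau>
    proof -
      have "E' \<tau> * u t + E s * k \<tau> - ?f \<tau> = E' \<tau> * (u t - u \<tau>) - (E \<tau> - E s) * k \<tau>"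
        by (simp add: algebra_simps)
      also have "norm \<dots> \<le> norm (E' \<tau>) * norm (u t - u \<tau>) + norm (E \<tau> - E s) * norm (k \<tau>)"
        by (metis norm_mult norm_triangle_ineq4)
      also have "\<dots> \<le> M * (B * (t - \<tau>)) + (M * (\<tau> - s)) * B"
        by (intro add_mono mult_mono M ulip Elip k mult_nonneg_nonneg less_imp_le[OF M0] B0) (use \<tau> st in auto)
      also have "\<dots> = (M * B) * (t - s)" by (simp add: algebra_simps)
      also have "\<dots> \<le> (M * B + M * B) * (t - s)"
        using M0 B0 st by (intro mult_right_mono) auto
      finally show ?thesis .
    qed
    moreover have "0 \<le> (M * B + M * B) * (t - s)" using M0 B0 st by simp
    ultimately have "norm (?\<Phi> t - ?\<Phi> s) \<le> (M * B + M * B) * (t - s) * measure lborel {s..t}"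
      by (intro has_integral_bound_real[OF _ finite.emptyI]) blast+
    then have "norm (?\<Phi> t - ?\<Phi> s) \<le> (M * B + M * B) * (t - s) * (t - s)" using st by simp
    then show "norm (?\<Phi> t - ?\<Phi> s) \<le> (M * B + M * B) * (t - s)\<^sup>2"
      by (simp add: power2_eq_square mult.assoc)
  qed
  then have "integral {a..b} ?f = E b * u b - E a * u a" by (simp add: algebra_simps)
  with integrable_integral[OF int] show ?thesis by simp
qed

section \<open>Scalar exponential kernels on the whole line\<close>

text \<open>For \<open>Re d \<noteq> 0\<close> this is the fundamental solution of
  \<open>u' = d u\<close> that decays in both time directions. In both cases it jumps by one at time
  zero, and its value there follows the convention of \<open>green\<close>.\<close>

definition scalar_kernel :: "complex \<Rightarrow> real \<Rightarrow> complex" where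
  "scalar_kernel d t =
     (if Re d < 0 then if t \<ge> 0 then exp (of_real t * d) else 0
      else if t < 0 then - exp (of_real t * d) else 0)"

lemma scalar_kernel_measurable: "scalar_kernel d \<in> borel_measurable borel"
  unfolding scalar_kernel_def by measurable

lemma norm_scalar_kernel_le:
  assumes "Re d \<noteq> 0" shows "norm (scalar_kernel d t) \<le> exp (- \<bar>Re d\<bar> * \<bar>t\<bar>)"
  using assms by (auto simp: scalar_kernel_def norm_exp_eq_Re abs_if mult.commute)

lemma integrable_exp_minus_abs:
  fixes \<alpha> :: real assumes "\<alpha> > 0"
  shows "integrable lebesgue (\<lambda>t. exp (- \<alpha> * \<bar>t\<bar>))"
proof -
  let ?f = "\<lambda>t::real. indicator {0..} t *\<^sub>R exp (- \<alpha> * t)"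
  have "(\<lambda>t::real. exp (- \<alpha> * t)) absolutely_integrable_on {0..}"
    by (intro nonnegative_absolutely_integrable_1 integrable_on_exp_minus_to_infinity assms) auto
  then have f: "integrable lborel ?f"
    unfolding set_integrable_def by (subst (asm) integrable_completion) auto
  \<comment> \<open>The half-line exponential plus its mirror image. At zero the sum equals two, so
    it dominates the two-sided exponential rather than being equal to it.\<close>
  then have "integrable lborel (\<lambda>t. ?f t + ?f (0 + (-1) * t))"
    by (intro Bochner_Integration.integrable_add lborel_integrable_real_affine) auto
  then have "integrable lborel (\<lambda>t. exp (- \<alpha> * \<bar>t\<bar>))"
    by (rule Bochner_Integration.integrable_bound) (auto simp: indicator_def)
  then show ?thesis by (subst integrable_completion) auto
qed

lemma
  fixes \<alpha> :: real assumes "\<alpha> > 0"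
  shows integrable_exp_minus_abs_diff: "integrable lebesgue (\<lambda>\<tau>. exp (- \<alpha> * \<bar>t - \<tau>\<bar>))"
    and integral_exp_minus_abs_diff:
      "(LINT \<tau>|lebesgue. exp (- \<alpha> * \<bar>t - \<tau>\<bar>)) = (LINT \<tau>|lebesgue. exp (- \<alpha> * \<bar>\<tau>\<bar>))"
proof -
  have "integrable lborel (\<lambda>t. exp (- \<alpha> * \<bar>t\<bar>))"
    using integrable_exp_minus_abs[OF assms] by (subst (asm) integrable_completion) auto
  from lborel_integrable_real_affine[OF this, of "-1" t]
  show "integrable lebesgue (\<lambda>\<tau>. exp (- \<alpha> * \<bar>t - \<tau>\<bar>))"
    by (subst integrable_completion) auto
  show "(LINT \<tau>|lebesgue. exp (- \<alpha> * \<bar>t - \<tau>\<bar>)) = (LINT \<tau>|lebesgue. exp (- \<alpha> * \<bar>\<tau>\<bar>))"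
    using lborel_integral_real_affine[of "-1" "\<lambda>s. exp (- \<alpha> * \<bar>s\<bar>)" t]
    by (subst (1 2) integral_completion) auto
qed

definition scalar_response :: "complex \<Rightarrow> (real \<Rightarrow> complex) \<Rightarrow> real \<Rightarrow> complex" where
  "scalar_response d h t = (LINT \<tau>|lebesgue. scalar_kernel d (t - \<tau>) * h \<tau>)"

text \<open>After multiplication by \<open>exp (- t d)\<close> the kernel depends on
  \<open>t\<close> only through the side of \<tau> on which it lies, and crossing \<tau> adds
  \<open>exp (- \<tau> d)\<close>. The increment of a response thus becomes an integral over the
  interval between the two times, with no exchange of integrals.\<close>

lemma scalar_kernel_diff:
  assumes "a \<le> b"
  shows "exp (- of_real b * d) * scalar_kernel d (b - \<tau>) - exp (- of_real a * d) * scalar_kernel d (a - \<tau>)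
    = indicator {a<..b} \<tau> * exp (- of_real \<tau> * d)"
proof -
  have e: "exp (- of_real t * d) * exp (of_real (t - \<tau>) * d) = exp (- of_real \<tau> * d)" for t :: real
    by (simp add: exp_add[symmetric] algebra_simps)
  show ?thesis using assms unfolding scalar_kernel_def indicator_def
    by (auto simp only: e mult_minus_right mult_zero_right mult_1 mult_zero_left split: if_splits) auto
qed

lemma
  assumes d: "Re d \<noteq> 0" and h: "h \<in> borel_measurable lebesgue" "\<And>t. norm (h t) \<le> B"
  shows integrable_scalar_kernel: "integrable lebesgue (\<lambda>\<tau>. scalar_kernel d (t - \<tau>) * h \<tau>)"
    and norm_scalar_response_le:
      "norm (scalar_response d h t) \<le> B * (LINT s|lebesgue. exp (- \<bar>Re d\<bar> * \<bar>s\<bar>))"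
proof -
  have int: "integrable lebesgue (\<lambda>\<tau>. B * exp (- \<bar>Re d\<bar> * \<bar>t - \<tau>\<bar>))"
    using d by (intro integrable_mult_right integrable_exp_minus_abs_diff) auto
  have bd: "norm (scalar_kernel d (t - \<tau>) * h \<tau>) \<le> B * exp (- \<bar>Re d\<bar> * \<bar>t - \<tau>\<bar>)" for \<tau>
    using mult_mono[OF norm_scalar_kernel_le[OF d, of "t - \<tau>"] h(2)[of \<tau>]]
    by (simp add: norm_mult mult.commute)
  have "(\<lambda>\<tau>. scalar_kernel d (t - \<tau>)) \<in> borel_measurable lebesgue"
    by (intro measurable_completion) (use scalar_kernel_measurable in measurable)
  then show i: "integrable lebesgue (\<lambda>\<tau>. scalar_kernel d (t - \<tau>) * h \<tau>)"
    by (intro Bochner_Integration.integrable_bound[OF int] borel_measurable_times h AE_I2)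
       (use bd order_trans[OF bd abs_ge_self] in auto)
  have "norm (scalar_response d h t) \<le> (LINT \<tau>|lebesgue. B * exp (- \<bar>Re d\<bar> * \<bar>t - \<tau>\<bar>))"
    unfolding scalar_response_def by (rule Bochner_Integration.integral_norm_bound_integral[OF i int bd])
  also have "\<dots> = B * (LINT s|lebesgue. exp (- \<bar>Re d\<bar> * \<bar>s\<bar>))"
    using integral_exp_minus_abs_diff[of "\<bar>Re d\<bar>" t] d by simp
  finally show "norm (scalar_response d h t) \<le> B * (LINT s|lebesgue. exp (- \<bar>Re d\<bar> * \<bar>s\<bar>))" .
qed

lemma has_vector_derivative_exp_line:
  "((\<lambda>t. exp (of_real t * d)) has_vector_derivative d * exp (of_real t * d)) (at t)" for d :: complex
proof -
  have "((\<lambda>t. exp (d * of_real t)) has_vector_derivative exp (d * of_real t) * d) (at t)"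
    by (intro has_vector_derivative_real_field derivative_eq_intros refl) auto
  then show ?thesis by (simp add: mult.commute)
qed

text \<open>In the frame moving with the flow, the response is a plain primitive \<open>u\<close> of
  the transformed forcing \<open>k\<close>; the product rule with \<open>exp (t d)\<close> returns
  to the original frame.\<close>

lemma scalar_response_solves:
  assumes d: "Re d \<noteq> 0" and h: "h \<in> borel_measurable lebesgue" "\<And>t. norm (h t) \<le> B"
    and ab: "a \<le> b"
  shows "((\<lambda>s. d * scalar_response d h s + h s) has_integral
    (scalar_response d h b - scalar_response d h a)) {a..b}"
proof -
  define u where "u t = exp (- of_real t * d) * scalar_response d h t" for t
  define k where "k t = exp (- of_real t * d) * h t" for t
  have u: "(k has_integral (u b - u a)) {a..b}" if ab: "a \<le> b" for a b
  proof -
    let ?g = "\<lambda>t \<tau>. exp (- of_real t * d) * (scalar_kernel d (t - \<tau>) * h \<tau>)"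
    have i: "integrable lebesgue (?g t)" for t
      by (intro integrable_mult_right integrable_scalar_kernel[OF d h])
    have eq: "?g b \<tau> - ?g a \<tau> = indicator {a<..b} \<tau> *\<^sub>R k \<tau>" for \<tau>
      using arg_cong[OF scalar_kernel_diff[OF ab, of d \<tau>], of "\<lambda>x. x * h \<tau>"]
      by (simp add: k_def algebra_simps indicator_def split: if_splits)
    have "u b - u a = (LINT \<tau>|lebesgue. ?g b \<tau> - ?g a \<tau>)"
      unfolding u_def scalar_response_def by (subst Bochner_Integration.integral_diff[OF i i]) simp
    then have val: "u b - u a = (LINT \<tau>:{a<..b}|lebesgue. k \<tau>)"
      unfolding eq by (simp add: set_lebesgue_integral_def)
    have "integrable lebesgue (\<lambda>\<tau>. ?g b \<tau> - ?g a \<tau>)"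
      by (intro Bochner_Integration.integrable_diff i)
    then have "set_integrable lebesgue {a<..b} k"
      unfolding eq by (simp add: set_integrable_def)
    from has_integral_set_lebesgue[OF this] have "(k has_integral (u b - u a)) {a<..b}"
      by (simp add: val)
    then show ?thesis
      by (subst has_integral_spike_set_eq[where T = "{a<..b}"]) (auto intro: negligible_subset[of "{a}"])
  qed
  have "bounded ((\<lambda>t. exp (- of_real t * d)) ` {a..b})"
    by (intro compact_imp_bounded compact_continuous_image continuous_intros) auto
  then obtain C where "\<forall>x \<in> (\<lambda>t. exp (- of_real t * d)) ` {a..b}. norm x \<le> C"
    unfolding bounded_iff by blast
  then have C: "norm (exp (- of_real t * d)) \<le> C" if "t \<in> {a..b}" for t using that by blast
  have "((\<lambda>t. (d * exp (of_real t * d)) * u t + exp (of_real t * d) * k t) has_integral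
      (exp (of_real b * d) * u b - exp (of_real a * d) * u a)) {a..b}"
  proof (rule has_integral_product_rule[OF u _ has_vector_derivative_exp_line _ ab])
    show "norm (k t) \<le> C * B" if "t \<in> {a..b}" for t
      unfolding k_def norm_mult using order_trans[OF norm_ge_zero C[OF that]] by (intro mult_mono C[OF that] h(2) norm_ge_zero)
  qed (auto intro!: continuous_intros)
  moreover have "exp (of_real t * d) * u t = scalar_response d h t"
    "exp (of_real t * d) * k t = h t" for t
    unfolding u_def k_def mult.assoc[symmetric] exp_add[symmetric] by simp_all
  ultimately show ?thesis by (simp add: mult.assoc)
qed

text \<open>Every solution is a multiple of \<open>exp (t d)\<close>, which is unbounded in one of
  the two time directions.\<close>

lemma bounded_scalar_homogeneous_zero:
  fixes w :: "real \<Rightarrow> complex"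
  assumes d: "Re d \<noteq> 0" and w: "\<And>a b. a \<le> b \<Longrightarrow> ((\<lambda>s. d * w s) has_integral (w b - w a)) {a..b}"
    and C: "\<And>t. norm (w t) \<le> C"
  shows "w t = 0"
proof -
  have w_eq: "w b = exp (of_real (b - a) * d) * w a" if ab: "a \<le> b" for a b :: real
  proof -
    have "((\<lambda>t. (- d * exp (of_real t * - d)) * w t + exp (of_real t * - d) * (d * w t)) has_integral
        (exp (of_real b * - d) * w b - exp (of_real a * - d) * w a)) {a..b}"
      by (rule has_integral_product_rule[where B = "norm d * C", OF w _ has_vector_derivative_exp_line _ ab])
         (auto intro!: continuous_intros mult_left_mono C simp: norm_mult)
    then have "((\<lambda>t. 0) has_integral (exp (of_real b * - d) * w b - exp (of_real a * - d) * w a)) {a..b}"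
      by (rule has_integral_eq[rotated]) simp
    then have "exp (of_real b * - d) * w b = exp (of_real a * - d) * w a"
      using has_integral_0_eq eq_iff_diff_eq_0 by blast
    then have "exp (of_real b * d) * (exp (of_real b * - d) * w b) =
        exp (of_real b * d) * (exp (of_real a * - d) * w a)" by simp
    moreover have "exp (of_real b * d) * exp (of_real b * - d) = 1"
      "exp (of_real b * d) * exp (of_real a * - d) = exp (of_real (b - a) * d)"
      by (simp_all add: exp_add[symmetric] left_diff_distrib)
    ultimately show ?thesis unfolding mult.assoc[symmetric] by (simp only: mult_1)
  qed
  then have nw: "norm (w b) = exp ((b - a) * Re d) * norm (w a)" if "a \<le> b" for a b
    unfolding w_eq[OF that] by (simp add: norm_mult del: of_real_diff)
  \<comment> \<open>Compare with the time \<open>r\<close> units away in the direction in which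
    solutions grow: backwards for a stable \<open>d\<close>, forwards otherwise. The bound
    \<open>C\<close> there decays on transport back to \<open>t\<close>.\<close>
  have "norm (w t) \<le> C * exp (- \<bar>Re d\<bar> * r)" if r: "r \<ge> 0" for r
  proof (cases "Re d < 0")
    case True
    then show ?thesis using nw[of "t - r" t] r mult_left_mono[OF C[of "t - r"], of "exp (r * Re d)"]
      by (simp add: mult.commute)
  next
    case False
    have "norm (w t) = exp (- \<bar>Re d\<bar> * r) * norm (w (t + r))"
      using nw[of t "t + r"] r False by (simp add: exp_minus field_simps)
    then show ?thesis using mult_left_mono[OF C[of "t + r"], of "exp (- \<bar>Re d\<bar> * r)"]
      by (simp add: mult.commute)
  qed
  then have "\<forall>\<^sub>F r in at_top. norm (w t) \<le> C * exp (- \<bar>Re d\<bar> * r)"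
    using eventually_ge_at_top[of "0::real"] by (rule eventually_mono[rotated]) auto
  moreover have "((\<lambda>r. C * exp (- \<bar>Re d\<bar> * r)) \<longlongrightarrow> C * 0) at_top"
    using d by (intro tendsto_mult tendsto_const filterlim_compose[OF exp_at_bot]
        filterlim_tendsto_neg_mult_at_bot[OF tendsto_const _ filterlim_ident]) auto
  ultimately have "norm (w t) \<le> C * 0"
    by (intro tendsto_lowerbound[of _ _ at_top]) auto
  then show ?thesis by simp
qed

section \<open>Diagonalization of the Green's function\<close>

definition diagm :: "('n \<Rightarrow> 'a::zero) \<Rightarrow> 'a^'n^'n" where
  "diagm c = (\<chi> i j. if i = j then c i else 0)"

lemma matrix_mult_diagm: "(P ** diagm c) $ i $ l = P $ i $ l * c l" for P :: "'a::semiring_1^'n^'m"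
  by (simp add: matrix_matrix_mult_def diagm_def if_distrib[of "\<lambda>x. _ * x"] cong: if_cong)

lemma diagm_mult_matrix: "(diagm c ** P) $ i $ l = c i * P $ i $ l" for P :: "'a::semiring_1^'n^'m"
  by (simp add: matrix_matrix_mult_def diagm_def if_distrib[of "\<lambda>x. x * _"] cong: if_cong)

abbreviation cmat :: "real^'n^'m \<Rightarrow> complex^'n^'m" where
  "cmat \<equiv> map_matrix complex_of_real"

lemma cmat_nth: "cmat M $ i $ j = complex_of_real (M $ i $ j)"
  by (simp add: map_matrix_def)

lemma cmat_mult: "cmat (M ** N) = cmat M ** cmat N"
  by (simp add: vec_eq_iff cmat_nth matrix_matrix_mult_def)

lemma cmat_one: "cmat (mat 1) = mat 1"
  by (simp add: vec_eq_iff cmat_nth mat_def)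

lemma matrix_inv_mult:
  assumes "invertible M"
  shows "M ** matrix_inv M = mat 1" "matrix_inv M ** M = mat 1"
  using someI_ex[OF assms[unfolded invertible_def]] unfolding matrix_inv_def by auto

text \<open>Column \<open>l\<close> of \<open>Q\<close> is an eigenvector of \<open>B\<close>. Rows
  in \<open>S\<close> do not couple to the outside, so cutting the column down to \<open>S\<close>
  leaves an eigenvector of the block, and the entry at \<open>i\<close> keeps it nonzero.\<close>

lemma block_eigenvalueI:
  fixes B :: "real^'n^'n" and Q :: "complex^'n^'n"
  assumes B: "\<And>i j. i \<in> S \<Longrightarrow> j \<notin> S \<Longrightarrow> B $ i $ j = 0"
    and Q: "cmat B ** Q = Q ** diagm d" and i: "i \<in> S" "Q $ i $ l \<noteq> 0"
  shows "block_eigenvalue S B (d l)"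
proof -
  define v :: "complex^'n" where "v = (\<chi> i. if i \<in> S then Q $ i $ l else 0)"
  have row: "(\<Sum>j\<in>UNIV. complex_of_real (B $ i $ j) * Q $ j $ l) = d l * Q $ i $ l" for i
    using arg_cong[OF Q, of "\<lambda>M. M $ i $ l"]
    by (simp add: matrix_mult_diagm cmat_nth mult.commute) (simp add: matrix_matrix_mult_def cmat_nth mult.commute)
  have "(cmat (block S B) *v v) $ i = (d l *s v) $ i" for i
  proof (cases "i \<in> S")
    case True
    have "(cmat (block S B) *v v) $ i = (\<Sum>j\<in>UNIV. complex_of_real (B $ i $ j) * Q $ j $ l)"
      unfolding matrix_vector_mult_def
      by (auto simp: cmat_nth block_def v_def True B intro!: sum.cong)
    then show ?thesis using True by (simp add: row v_def)
  next
    case False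
    then show ?thesis
      by (simp add: matrix_vector_mult_def cmat_nth block_def v_def)
  qed
  moreover have "v \<noteq> 0" using i by (auto simp: v_def vec_eq_iff)
  ultimately have "eigenpair (block S B) (d l) v"
    by (simp add: eigenpair_def vec_eq_iff)
  then show ?thesis unfolding block_eigenvalue_def by (intro exI[of _ v]) (simp add: v_def)
qed

text \<open>On \<open>S\<close> the powers of the padded block agree with those of \<open>B\<close>,
  because rows in \<open>S\<close> see only columns in \<open>S\<close>; and the powers of
  \<open>B\<close> are diagonal between \<open>Q\<close> and \<open>R\<close>. The exponential
  series is then summed entry by entry.\<close>

lemma block_exp_entry:
  fixes B :: "real^'n^'n" and Q R :: "complex^'n^'n"
  assumes B: "\<And>i j. i \<in> S \<Longrightarrow> j \<notin> S \<Longrightarrow> B $ i $ j = 0"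
    and Q: "cmat B ** Q = Q ** diagm d" and QR: "Q ** R = mat 1"
  shows "complex_of_real (block S (mexp (t *\<^sub>R block S B)) $ i $ j) =
    (if i \<in> S \<and> j \<in> S then \<Sum>l\<in>UNIV. Q $ i $ l * exp (of_real t * d l) * R $ l $ j else 0)"
proof -
  let ?M = "t *\<^sub>R block S B"
  define X where "X k = ((**) ?M ^^ k) (mat 1)" for k
  have X_Suc: "X (Suc k) = ?M ** X k" for k by (simp add: X_def)
  have row: "(\<Sum>m\<in>UNIV. complex_of_real (B $ i $ m) * Q $ m $ l) = d l * Q $ i $ l" for i l
    using arg_cong[OF Q, of "\<lambda>M. M $ i $ l"]
    by (simp add: matrix_mult_diagm cmat_nth mult.commute) (simp add: matrix_matrix_mult_def cmat_nth mult.commute)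
  have X: "complex_of_real (X k $ i $ j) = (\<Sum>l\<in>UNIV. Q $ i $ l * (of_real t * d l) ^ k * R $ l $ j)"
    if "i \<in> S" "j \<in> S" for k i j
    using that
  proof (induction k arbitrary: i)
    case 0
    have "complex_of_real (X 0 $ i $ j) = (Q ** R) $ i $ j"
      unfolding QR X_def by (simp add: mat_def)
    then show ?case by (simp add: matrix_matrix_mult_def)
  next
    case (Suc k)
    have "complex_of_real (X (Suc k) $ i $ j) =
        (\<Sum>m\<in>UNIV. of_real t * complex_of_real (B $ i $ m) *
          (\<Sum>l\<in>UNIV. Q $ m $ l * (of_real t * d l) ^ k * R $ l $ j))"
      unfolding X_Suc matrix_matrix_mult_def
      by (auto simp: block_def Suc B intro!: sum.cong)
    also have "\<dots> = (\<Sum>l\<in>UNIV. of_real t * (\<Sum>m\<in>UNIV. complex_of_real (B $ i $ m) * Q $ m $ l)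
        * (of_real t * d l) ^ k * R $ l $ j)"
      unfolding sum_distrib_left sum_distrib_right
      by (subst sum.swap) (simp add: mult_ac)
    finally show ?case unfolding row by (simp add: mult_ac)
  qed
  \<comment> \<open>Off the block only the zeroth power, the identity matrix, contributes to the
    series.\<close>
  have X0: "X (Suc k) $ i $ j = 0" if "\<not> (i \<in> S \<and> j \<in> S)" for k i j
    using that
  proof (induction k arbitrary: i)
    case 0
    then show ?case by (auto simp: X_Suc matrix_matrix_mult_def X_def block_def mat_def intro!: sum.neutral)
  next
    case (Suc k)
    then show ?case
      unfolding X_Suc[of "Suc k"] by (auto simp: matrix_matrix_mult_def block_def intro!: sum.neutral)
  qed
  have csums: "(\<lambda>k. complex_of_real ((1 / fact k) * X k $ i $ j)) sums
      (\<Sum>l\<in>UNIV. Q $ i $ l * exp (of_real t * d l) * R $ l $ j)"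
    if "i \<in> S" "j \<in> S" for i j
  proof -
    have "(\<lambda>k. \<Sum>l\<in>UNIV. Q $ i $ l * ((of_real t * d l) ^ k /\<^sub>R fact k) * R $ l $ j) sums
        (\<Sum>l\<in>UNIV. Q $ i $ l * exp (of_real t * d l) * R $ l $ j)"
      by (intro sums_sum sums_mult sums_mult2 exp_converges)
    moreover have "(\<Sum>l\<in>UNIV. Q $ i $ l * ((of_real t * d l) ^ k /\<^sub>R fact k) * R $ l $ j) =
        complex_of_real ((1 / fact k) * X k $ i $ j)" for k
      unfolding of_real_mult X[OF that] sum_distrib_left by (simp add: divide_inverse scaleR_conv_of_real mult_ac)
    ultimately show ?thesis by simp
  qed
  have sums: "(\<lambda>k. (1 / fact k) * X k $ i $ j) sums Re (\<Sum>l\<in>UNIV. Q $ i $ l * exp (of_real t * d l) * R $ l $ j)"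
    if "i \<in> S" "j \<in> S" for i j
    using sums_Re[OF csums[OF that]] by (simp only: Re_complex_of_real)
  \<comment> \<open>The right-hand side is built from complex eigenvectors but is the limit of a
    real series, hence real.\<close>
  have real: "complex_of_real (Re (\<Sum>l\<in>UNIV. Q $ i $ l * exp (of_real t * d l) * R $ l $ j)) =
      (\<Sum>l\<in>UNIV. Q $ i $ l * exp (of_real t * d l) * R $ l $ j)" if "i \<in> S" "j \<in> S" for i j
    using sums_unique2[OF sums_of_real[OF sums[OF that]] csums[OF that]] .
  define Y :: "real^'n^'n" where "Y = (\<chi> i j. if i \<in> S \<and> j \<in> S then
      Re (\<Sum>l\<in>UNIV. Q $ i $ l * exp (of_real t * d l) * R $ l $ j) else mat 1 $ i $ j)"
  have "(\<lambda>k. (1 / fact k) * X k $ i $ j) sums Y $ i $ j" for i j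
  proof (cases "i \<in> S \<and> j \<in> S")
    case True
    then show ?thesis using sums[of i j] by (simp add: Y_def)
  next
    case False
    then have "(1 / fact k) * X k $ i $ j = 0" if "k \<notin> {0}" for k
      using X0[OF False, of "k - 1"] that by (cases k) auto
    then have "(\<lambda>k. (1 / fact k) * X k $ i $ j) sums (\<Sum>k\<in>{0}. (1 / fact k) * X k $ i $ j)"
      by (intro sums_finite) auto
    moreover have "(\<Sum>k\<in>{0}. (1 / fact k) * X k $ i $ j) = Y $ i $ j"
      unfolding Y_def using False by (auto simp: X_def)
    ultimately show ?thesis by (simp only:)
  qed
  then have "(\<lambda>k. (1 / fact k) *\<^sub>R X k) sums Y"
    unfolding sums_def by (intro vec_tendstoI) simp
  then have "mexp ?M = Y"
    unfolding mexp_def X_def by (rule sums_unique[symmetric])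
  then show ?thesis
    by (auto simp: block_def Y_def real simp del: Re_sum)
qed

text \<open>\<open>T\<close> and the eigenbasis \<open>P\<close> are obtained independently of each
  other. They are linked by the fact that each column of \<open>matrix_inv T ** P\<close> lies in
  one block, decided by the sign of the real part of its eigenvalue; cutting out a block therefore
  amounts to selecting eigenvalues.\<close>

lemma green_diagonalization:
  fixes A T :: "real^'n^'n"
  assumes A: "semisimple A" "hyperbolic A" and T: "splitting_basis A T S"
  obtains P R :: "complex^'n^'n" and d :: "'n \<Rightarrow> complex" where
    "P ** R = mat 1" "R ** P = mat 1" "cmat A ** P = P ** diagm d" "R ** cmat A = diagm d ** R"
    "\<And>l. Re (d l) \<noteq> 0"
    "\<And>t. cmat (green A T S t) = P ** diagm (\<lambda>l. scalar_kernel (d l) t) ** R"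
proof -
  obtain P D :: "complex^'n^'n" where P: "invertible P" and D: "\<And>i j. i \<noteq> j \<Longrightarrow> D $ i $ j = 0"
    and AP: "cmat A = P ** D ** matrix_inv P"
    using A(1) unfolding semisimple_def by blast
  define R where "R = matrix_inv P"
  define d where "d l = D $ l $ l" for l
  have Dd: "D = diagm d" using D by (simp add: vec_eq_iff diagm_def d_def)
  have PR: "P ** R = mat 1" "R ** P = mat 1"
    using P by (simp_all add: R_def matrix_inv_mult)
  have AP1: "cmat A ** P = P ** diagm d"
    unfolding AP Dd R_def[symmetric] by (simp add: matrix_mul_assoc[symmetric] PR)
  have RA: "R ** cmat A = diagm d ** R"
    unfolding AP Dd R_def[symmetric] by (simp add: matrix_mul_assoc PR)
  have d: "Re (d l) \<noteq> 0" for l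
  proof -
    define v :: "complex^'n" where "v = (\<chi> i. P $ i $ l)"
    have "v \<noteq> 0"
    proof
      assume "v = 0"
      then have "P $ i $ l = 0" for i by (simp add: v_def vec_eq_iff)
      then have "(R ** P) $ l $ l = 0" by (simp add: matrix_matrix_mult_def)
      then show False by (simp add: PR mat_def)
    qed
    moreover have "cmat A *v v = d l *s v"
      using arg_cong[OF AP1, of "\<lambda>M. M $ i $ l" for i]
      by (simp add: vec_eq_iff matrix_mult_diagm v_def mult.commute)
         (simp add: matrix_matrix_mult_def matrix_vector_mult_def mult.commute)
    ultimately show ?thesis using A(2) unfolding hyperbolic_def eigenpair_def by blast
  qed
  have Tinv: "invertible T" and blocks: "\<And>i j. (i \<in> S) \<noteq> (j \<in> S) \<Longrightarrow> conj_by T A $ i $ j = 0"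
    and neg: "\<And>\<mu>. block_eigenvalue S (conj_by T A) \<mu> \<Longrightarrow> Re \<mu> < 0"
    and pos: "\<And>\<mu>. block_eigenvalue (- S) (conj_by T A) \<mu> \<Longrightarrow> Re \<mu> > 0"
    using T unfolding splitting_basis_def by auto
  define B where "B = conj_by T A"
  define Tc where "Tc = cmat T"
  define Ti where "Ti = cmat (matrix_inv T)"
  have TT: "Tc ** Ti = mat 1" "Ti ** Tc = mat 1"
    using Tinv by (simp_all add: Tc_def Ti_def cmat_mult[symmetric] cmat_one matrix_inv_mult)
  define Q where "Q = Ti ** P"
  define W where "W = R ** Tc"
  have QW: "Q ** W = mat 1" "W ** Q = mat 1"
    unfolding Q_def W_def
    by (metis PR TT matrix_mul_assoc matrix_mul_rid)+
  have TQ: "Tc ** Q = P" and WT: "W ** Ti = R"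
    unfolding Q_def W_def by (metis TT matrix_mul_assoc matrix_mul_rid matrix_mul_lid)+
  have "cmat B = Ti ** cmat A ** Tc"
    by (simp add: B_def conj_by_def cmat_mult Ti_def Tc_def)
  then have BQ: "cmat B ** Q = Q ** diagm d"
    unfolding Q_def by (metis AP1 TT(1) matrix_mul_assoc matrix_mul_lid)
  have B0: "B $ i $ j = 0" if "S' \<in> {S, - S}" "i \<in> S'" "j \<notin> S'" for S' and i j :: 'n
    using that blocks by (auto simp: B_def)
  have B0S: "B $ i $ j = 0" if "i \<in> S" "j \<notin> S" for i j using B0 that by blast
  have B0C: "B $ i $ j = 0" if "i \<in> - S" "j \<notin> - S" for i j using B0[of "- S"] that by blast
  \<comment> \<open>Selects the eigenvalues that belong to the block \<open>S'\<close>: stable ones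
    for \<open>S\<close>, unstable ones for its complement.\<close>
  define E where "E S' l = (if S' = S then if Re (d l) < 0 then 1 else 0
    else if Re (d l) > 0 then 1 else (0::complex))" for S' :: "'n set" and l
  \<comment> \<open>A nonzero entry of column \<open>l\<close> inside \<open>S\<close> makes
    \<open>d l\<close> an eigenvalue of the stable block, and one outside \<open>S\<close> makes it
    an eigenvalue of the unstable block. No column can have both, so projecting rows is the same as
    selecting columns.\<close>
  have QE: "diagm (indicator S') ** Q = Q ** diagm (E S')" if S': "S' \<in> {S, - S}" for S'
  proof -
    have S0: "S \<noteq> - S" by auto
    have 1: "Q $ i $ l \<noteq> 0 \<Longrightarrow> i \<in> S \<Longrightarrow> Re (d l) < 0" for i l
      using neg block_eigenvalueI[of S B, OF B0S BQ] by (auto simp: B_def)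
    have 2: "Q $ i $ l \<noteq> 0 \<Longrightarrow> i \<notin> S \<Longrightarrow> Re (d l) > 0" for i l
      using pos block_eigenvalueI[of "- S" B, OF B0C BQ] by (auto simp: B_def)
    have "indicator S' i * Q $ i $ l = Q $ i $ l * E S' l" for i l
    proof (cases "Q $ i $ l = 0")
      case False
      have "S' = S \<or> S' = - S" using S' by blast
      then show ?thesis
        using 1[OF False] 2[OF False] S0 by (cases "i \<in> S") (auto simp: E_def)
    qed simp
    then show ?thesis by (simp add: vec_eq_iff matrix_mult_diagm diagm_mult_matrix)
  qed
  have WE: "W ** diagm (indicator S') = diagm (E S') ** W" if S': "S' \<in> {S, - S}" for S'
    by (metis QE[OF S'] QW matrix_mul_assoc matrix_mul_lid matrix_mul_rid)
  have exp_block: "cmat (T ** block S' (mexp (t *\<^sub>R block S' B)) ** matrix_inv T) =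
      P ** diagm (\<lambda>l. E S' l * exp (of_real t * d l)) ** R" if S': "S' \<in> {S, - S}" for S' t
  proof -
    have "cmat (block S' (mexp (t *\<^sub>R block S' B))) =
        diagm (indicator S') ** (Q ** diagm (\<lambda>l. exp (of_real t * d l)) ** W) ** diagm (indicator S')"
      using block_exp_entry[of S' B, OF B0[OF S'] BQ QW(1)]
      by (simp add: vec_eq_iff cmat_nth matrix_mult_diagm diagm_mult_matrix indicator_def)
         (simp add: matrix_matrix_mult_def[of "Q ** _"] matrix_mult_diagm)
    also have "\<dots> = (Q ** diagm (E S')) ** diagm (\<lambda>l. exp (of_real t * d l)) ** (diagm (E S') ** W)"
      by (simp add: QE[OF S', symmetric] WE[OF S', symmetric] matrix_mul_assoc)
    also have "\<dots> = Q ** (diagm (E S') ** diagm (\<lambda>l. exp (of_real t * d l)) ** diagm (E S')) ** W"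
      by (simp add: matrix_mul_assoc)
    also have "diagm (E S') ** diagm (\<lambda>l. exp (of_real t * d l)) ** diagm (E S') =
        diagm (\<lambda>l. E S' l * exp (of_real t * d l))"
      by (simp add: vec_eq_iff matrix_mult_diagm diagm_mult_matrix) (simp add: diagm_def E_def)
    finally show ?thesis
      by (simp add: cmat_mult Tc_def[symmetric] Ti_def[symmetric] matrix_mul_assoc TQ)
         (simp add: matrix_mul_assoc[symmetric] WT)
  qed
  show ?thesis
  proof (rule that[OF PR AP1 RA d])
    fix t
    show "cmat (green A T S t) = P ** diagm (\<lambda>l. scalar_kernel (d l) t) ** R"
    proof (cases "t \<ge> 0")
      case True
      have "(\<lambda>l. E S l * exp (of_real t * d l)) = (\<lambda>l. scalar_kernel (d l) t)"
        using True by (auto simp: E_def scalar_kernel_def)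
      then show ?thesis using exp_block[of S t] True by (simp add: green_def B_def)
    next
      case False
      have S0: "- S \<noteq> S" by auto
      have "- (T ** block (- S) (mexp (t *\<^sub>R block (- S) B)) ** matrix_inv T) = green A T S t"
        using False by (simp add: green_def B_def)
          (simp add: vec_eq_iff matrix_matrix_mult_def sum_negf)
      then have "cmat (green A T S t) = - cmat (T ** block (- S) (mexp (t *\<^sub>R block (- S) B)) ** matrix_inv T)"
        by (simp add: vec_eq_iff cmat_nth flip: of_real_minus)
      also have "\<dots> = - (P ** diagm (\<lambda>l. E (- S) l * exp (of_real t * d l)) ** R)"
        using exp_block[of "- S" t] by simp
      also have "\<dots> = P ** diagm (\<lambda>l. - (E (- S) l * exp (of_real t * d l))) ** R"
        by (simp add: vec_eq_iff matrix_matrix_mult_def[of "P ** _"] matrix_mult_diagm sum_negf)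
      also have "(\<lambda>l. - (E (- S) l * exp (of_real t * d l))) = (\<lambda>l. scalar_kernel (d l) t)"
        using False S0 d by (auto simp: E_def scalar_kernel_def fun_eq_iff not_less antisym_conv2)
      finally show ?thesis .
    qed
  qed
qed

section \<open>The Green's function as solution operator on bounded functions\<close>

text \<open>A bounded velocity makes \<open>x\<close> Lipschitz. The velocity itself is measurable
  because it is integrable on every interval; subtracting the continuous function
  \<open>A *v x s\<close> leaves \<open>g\<close>.\<close>

lemma solves_bounded_measurable:
  fixes A :: "real^'n^'n" and g x :: "real \<Rightarrow> real^'n"
  assumes x: "solves (\<lambda>s y. A *v y + g s) x" and g: "\<And>t. norm (g t) \<le> B" and C: "\<And>t. norm (x t) \<le> C"
  shows "continuous_on UNIV x" "g \<in> borel_measurable lebesgue"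
proof -
  have I: "((\<lambda>s. A *v x s + g s) has_integral (x b - x a)) {a..b}" if "a \<le> b" for a b
    using x that by (simp add: solves_def)
  have bl: "bounded_linear ((*v) A)" by (rule matrix_vector_mul_bounded_linear)
  obtain M where M: "\<And>y. norm (A *v y) \<le> norm y * M" and M0: "M > 0"
    using bounded_linear.pos_bounded[OF bl] by blast
  define L where "L = C * M + B"
  have L: "norm (A *v x s + g s) \<le> L" for s
    using norm_triangle_mono[OF order_trans[OF M mult_right_mono[OF C]] g] M0 by (simp add: L_def)
  have L0: "L \<ge> 0" using order_trans[OF norm_ge_zero L] .
  have lip: "norm (x t - x s) \<le> L * (t - s)" if "s \<le> t" for s t
    using has_integral_bound_real[OF L0 finite.emptyI I[OF that] L] that by simp
  have "L-lipschitz_on UNIV x"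
  proof (rule lipschitz_onI)
    fix s t show "dist (x s) (x t) \<le> L * dist s t"
      using lip[of s t] lip[of t s] by (cases "s \<le> t") (auto simp: dist_norm norm_minus_commute)
  qed (rule L0)
  then show cx: "continuous_on UNIV x" by (rule lipschitz_on_continuous_on)
  let ?v = "\<lambda>s. A *v x s + g s"
  \<comment> \<open>Integrability is known on bounded intervals only, so the line is exhausted by
    \<open>{-n..n}\<close>.\<close>
  have "(\<lambda>s. indicator {- real n..real n} s *\<^sub>R ?v s) \<in> borel_measurable lebesgue" for n
    by (rule has_integral_implies_lebesgue_measurable[OF I]) simp
  moreover have "(\<lambda>n. indicator {- real n..real n} s *\<^sub>R ?v s) \<longlonglongrightarrow> ?v s" for s
  proof (rule tendsto_eventually, rule eventually_sequentiallyI)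
    fix n assume n: "nat \<lceil>\<bar>s\<bar>\<rceil> \<le> n"
    then have "\<bar>s\<bar> \<le> real n" by linarith
    then show "indicator {- real n..real n} s *\<^sub>R ?v s = ?v s" by (auto simp: indicator_def)
  qed
  ultimately have v: "?v \<in> borel_measurable lebesgue"
    by (rule borel_measurable_LIMSEQ_metric)
  have "continuous_on UNIV (\<lambda>s. A *v x s)"
    by (rule bounded_linear.continuous_on[OF bl cx])
  then have "(\<lambda>s. A *v x s) \<in> borel_measurable borel" by (rule borel_measurable_continuous_onI)
  then have "(\<lambda>s. A *v x s) \<in> borel_measurable lebesgue" by (intro measurable_completion) simp
  from borel_measurable_diff[OF v this] show "g \<in> borel_measurable lebesgue" by simp
qed

definition green_response :: "real^'n^'n \<Rightarrow> real^'n^'n \<Rightarrow> 'n set \<Rightarrow> (real \<Rightarrow> real^'n) \<Rightarrow> real \<Rightarrow> real^'n" where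
  "green_response A T S g t = (LINT \<tau>|lebesgue. green A T S (t - \<tau>) *v g \<tau>)"

text \<open>In the coordinates \<open>\<phi> l\<close> both \<open>A\<close> and the Green's
  function act by scalar multiplication, and \<open>\<psi> l\<close> maps back to real vectors. All
  four facts reduce to the scalar response in each coordinate.\<close>

lemma green_response:
  fixes A T :: "real^'n^'n"
  assumes A: "semisimple A" "hyperbolic A" and T: "splitting_basis A T S"
  obtains K where "K > 0"
    "\<And>g B t. g \<in> borel_measurable lebesgue \<Longrightarrow> (\<And>t. norm (g t) \<le> B) \<Longrightarrow>
      integrable lebesgue (\<lambda>\<tau>. green A T S (t - \<tau>) *v g \<tau>)"
    "\<And>g B t. g \<in> borel_measurable lebesgue \<Longrightarrow> (\<And>t. norm (g t) \<le> B) \<Longrightarrow>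
      norm (green_response A T S g t) \<le> K * B"
    "\<And>g B. g \<in> borel_measurable lebesgue \<Longrightarrow> (\<And>t. norm (g t) \<le> B) \<Longrightarrow>
      solves (\<lambda>s y. A *v y + g s) (green_response A T S g)"
    "\<And>g x B C. (\<And>t. norm (g t) \<le> B) \<Longrightarrow> (\<And>t. norm (x t) \<le> C) \<Longrightarrow>
      solves (\<lambda>s y. A *v y + g s) x \<Longrightarrow> x = green_response A T S g"
proof -
  obtain P R :: "complex^'n^'n" and d :: "'n \<Rightarrow> complex" where
    PR: "P ** R = mat 1" "R ** P = mat 1" and AP: "cmat A ** P = P ** diagm d"
    and RA: "R ** cmat A = diagm d ** R" and d: "\<And>l. Re (d l) \<noteq> 0"
    and G: "\<And>t. cmat (green A T S t) = P ** diagm (\<lambda>l. scalar_kernel (d l) t) ** R"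
    using green_diagonalization[OF assms] by metis
  \<comment> \<open>Single summands of the spectral decomposition are complex, but their sum over
    \<open>l\<close> is real for a real matrix. Taking real parts summand by summand therefore
    changes nothing in the sum.\<close>
  define \<psi> :: "'n \<Rightarrow> complex \<Rightarrow> real^'n" where "\<psi> l c = (\<chi> a. Re (P $ a $ l * c))" for l c
  define \<phi> :: "'n \<Rightarrow> real^'n \<Rightarrow> complex" where "\<phi> l w = (\<Sum>i\<in>UNIV. R $ l $ i * of_real (w $ i))" for l w
  have \<psi>: "bounded_linear (\<psi> l)" for l
    unfolding linear_conv_bounded_linear[symmetric]
    by (rule linearI) (simp_all add: \<psi>_def vec_eq_iff algebra_simps)
  have \<phi>: "bounded_linear (\<phi> l)" for l
    unfolding linear_conv_bounded_linear[symmetric]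
    by (rule linearI)
      (simp_all add: \<phi>_def distrib_left sum.distrib scaleR_conv_of_real[where 'a = complex] sum_distrib_left mult.left_commute)
  have mult_\<psi>\<phi>: "M *v w = (\<Sum>l\<in>UNIV. \<psi> l (c l * \<phi> l w))"
    if M: "cmat M = P ** diagm c ** R" for M :: "real^'n^'n" and c w
  proof -
    have "(\<Sum>l\<in>UNIV. P $ a $ l * (c l * \<phi> l w)) = complex_of_real ((M *v w) $ a)" for a
    proof -
      have "complex_of_real ((M *v w) $ a) = (\<Sum>b\<in>UNIV. cmat M $ a $ b * of_real (w $ b))"
        by (simp add: matrix_vector_mult_def cmat_nth)
      also have "\<dots> = (\<Sum>b\<in>UNIV. \<Sum>l\<in>UNIV. P $ a $ l * c l * R $ l $ b * of_real (w $ b))"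
        unfolding M by (simp add: matrix_matrix_mult_def[of "P ** _"] matrix_mult_diagm sum_distrib_right)
      also have "\<dots> = (\<Sum>l\<in>UNIV. P $ a $ l * (c l * \<phi> l w))"
        by (subst sum.swap) (simp add: \<phi>_def sum_distrib_left mult_ac)
      finally show ?thesis by simp
    qed
    then have "(\<Sum>l\<in>UNIV. Re (P $ a $ l * (c l * \<phi> l w))) = (M *v w) $ a" for a
      by (metis Re_complex_of_real Re_sum)
    then show ?thesis by (simp add: vec_eq_iff \<psi>_def)
  qed
  have green_mult: "green A T S t *v w = (\<Sum>l\<in>UNIV. \<psi> l (scalar_kernel (d l) t * \<phi> l w))" for t w
    by (rule mult_\<psi>\<phi>[OF G])
  have ident: "w = (\<Sum>l\<in>UNIV. \<psi> l (\<phi> l w))" for w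
  proof -
    have "diagm (\<lambda>l. 1) = (mat 1 :: complex^'n^'n)" by (simp add: diagm_def mat_def vec_eq_iff)
    then have "cmat (mat 1) = P ** diagm (\<lambda>l. 1) ** R" by (simp add: PR cmat_one)
    from mult_\<psi>\<phi>[OF this, of w] show ?thesis by simp
  qed
  have A\<psi>: "A *v (\<Sum>l\<in>UNIV. \<psi> l (z l)) = (\<Sum>l\<in>UNIV. \<psi> l (d l * z l))" for z
  proof -
    have row: "(\<Sum>b\<in>UNIV. of_real (A $ a $ b) * P $ b $ l) = P $ a $ l * d l" for a l
      using arg_cong[OF AP, of "\<lambda>M. M $ a $ l"]
      by (simp add: matrix_mult_diagm) (simp add: matrix_matrix_mult_def cmat_nth)
    have "(A *v (\<Sum>l\<in>UNIV. \<psi> l (z l))) $ a = (\<Sum>l\<in>UNIV. \<psi> l (d l * z l)) $ a" for a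
    proof -
      have "(A *v (\<Sum>l\<in>UNIV. \<psi> l (z l))) $ a =
          Re (\<Sum>b\<in>UNIV. of_real (A $ a $ b) * (\<Sum>l\<in>UNIV. P $ b $ l * z l))"
        by (simp add: matrix_vector_mult_def \<psi>_def Re_sum)
      also have "(\<Sum>b\<in>UNIV. of_real (A $ a $ b) * (\<Sum>l\<in>UNIV. P $ b $ l * z l)) =
          (\<Sum>l\<in>UNIV. (\<Sum>b\<in>UNIV. of_real (A $ a $ b) * P $ b $ l) * z l)"
        unfolding sum_distrib_left sum_distrib_right by (subst sum.swap) (simp add: mult_ac)
      finally show ?thesis unfolding row by (simp add: \<psi>_def Re_sum mult.assoc)
    qed
    then show ?thesis by (simp add: vec_eq_iff)
  qed
  have \<phi>A: "\<phi> l (A *v w) = d l * \<phi> l w" for l w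
  proof -
    have row: "(\<Sum>b\<in>UNIV. R $ l $ b * of_real (A $ b $ a)) = d l * R $ l $ a" for a
      using arg_cong[OF RA, of "\<lambda>M. M $ l $ a"]
      by (simp add: diagm_mult_matrix) (simp add: matrix_matrix_mult_def cmat_nth)
    have "\<phi> l (A *v w) = (\<Sum>a\<in>UNIV. (\<Sum>b\<in>UNIV. R $ l $ b * of_real (A $ b $ a)) * of_real (w $ a))"
      unfolding \<phi>_def matrix_vector_mult_def sum_distrib_right
      by (subst sum.swap) (simp add: sum_distrib_left mult_ac)
    then show ?thesis unfolding row by (simp add: \<phi>_def sum_distrib_left mult_ac)
  qed
  obtain a where a: "\<And>l w. norm (\<phi> l w) \<le> norm w * a l"
    using bounded_linear.bounded[OF \<phi>] by metis
  obtain b where b: "\<And>l c. norm (\<psi> l c) \<le> norm c * b l" "\<And>l. b l > 0"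
    using bounded_linear.pos_bounded[OF \<psi>] by metis
  \<comment> \<open>For each eigenvalue: the integral of the exponential majorant, times the bounds
    \<open>a l\<close> and \<open>b l\<close> of the two coordinate maps. The one makes
    \<open>K\<close> positive.\<close>
  define K where "K = 1 + (\<Sum>l\<in>UNIV. \<bar>a l * (LINT s|lebesgue. exp (- \<bar>Re (d l)\<bar> * \<bar>s\<bar>)) * b l\<bar>)"
  let ?z = "\<lambda>g l. scalar_response (d l) (\<lambda>\<tau>. \<phi> l (g \<tau>))"
  have integrable_\<phi>: "integrable lebesgue (\<lambda>\<tau>. scalar_kernel (d l) (t - \<tau>) * \<phi> l (g \<tau>))"
    and response_le: "norm (?z g l t)
      \<le> B * a l * (LINT s|lebesgue. exp (- \<bar>Re (d l)\<bar> * \<bar>s\<bar>))"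
    and response_solves: "u \<le> v \<Longrightarrow>
      ((\<lambda>s. d l * ?z g l s + \<phi> l (g s)) has_integral
        (?z g l v - ?z g l u)) {u..v}"
    if g: "g \<in> borel_measurable lebesgue" "\<And>t. norm (g t) \<le> B" for g B l t u v
  proof -
    have a0: "a l \<ge> 0"
      using order_trans[OF norm_ge_zero a[of l "axis l 1"]] by simp
    have m: "(\<lambda>\<tau>. \<phi> l (g \<tau>)) \<in> borel_measurable lebesgue"
      by (rule measurable_compose[OF g(1) borel_measurable_continuous_onI])
         (rule linear_continuous_on[OF \<phi>])
    have B: "norm (\<phi> l (g t)) \<le> B * a l" for t
      using order_trans[OF a mult_right_mono[OF g(2) a0]] .
    note * = d[of l] m B
    show "integrable lebesgue (\<lambda>\<tau>. scalar_kernel (d l) (t - \<tau>) * \<phi> l (g \<tau>))"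
      by (rule integrable_scalar_kernel[OF *])
    show "norm (?z g l t)
      \<le> B * a l * (LINT s|lebesgue. exp (- \<bar>Re (d l)\<bar> * \<bar>s\<bar>))"
      by (rule norm_scalar_response_le[OF *])
    show "u \<le> v \<Longrightarrow>
      ((\<lambda>s. d l * ?z g l s + \<phi> l (g s)) has_integral
        (?z g l v - ?z g l u)) {u..v}"
      by (rule scalar_response_solves[OF *])
  qed
  have response_eq: "green_response A T S g t = (\<Sum>l\<in>UNIV. \<psi> l (?z g l t))"
    if g: "g \<in> borel_measurable lebesgue" "\<And>t. norm (g t) \<le> B" for g B t
  proof -
    have "green_response A T S g t = (\<Sum>l\<in>UNIV. LINT \<tau>|lebesgue. \<psi> l (scalar_kernel (d l) (t - \<tau>) * \<phi> l (g \<tau>)))"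
      unfolding green_response_def green_mult
      by (intro Bochner_Integration.integral_sum integrable_bounded_linear[OF \<psi>] integrable_\<phi>[OF g])
    then show ?thesis
      by (simp add: integral_bounded_linear[OF \<psi> integrable_\<phi>[OF g]] scalar_response_def)
  qed
  have solves_response: "solves (\<lambda>s y. A *v y + g s) (green_response A T S g)"
    if g: "g \<in> borel_measurable lebesgue" "\<And>t. norm (g t) \<le> B" for g B
    unfolding solves_def
  proof (intro allI impI)
    fix u v :: real assume uv: "u \<le> v"
    have "((\<lambda>s. \<Sum>l\<in>UNIV. \<psi> l (d l * ?z g l s + \<phi> l (g s))) has_integral
        (\<Sum>l\<in>UNIV. \<psi> l (?z g l v - ?z g l u))) {u..v}"
      using has_integral_linear[OF response_solves[OF g uv] \<psi>] by (intro has_integral_sum) (auto simp: o_def)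
    moreover have "(\<Sum>l\<in>UNIV. \<psi> l (d l * ?z g l s + \<phi> l (g s))) = A *v green_response A T S g s + g s" for s
      unfolding response_eq[OF g] A\<psi> linear_add[OF bounded_linear.linear[OF \<psi>]] sum.distrib
      using ident[of "g s"] by simp
    moreover have "(\<Sum>l\<in>UNIV. \<psi> l (?z g l v - ?z g l u)) = green_response A T S g v - green_response A T S g u"
      unfolding response_eq[OF g] linear_diff[OF bounded_linear.linear[OF \<psi>]] sum_subtractf ..
    ultimately show "((\<lambda>s. A *v green_response A T S g s + g s) has_integral
        green_response A T S g v - green_response A T S g u) {u..v}" by simp
  qed
  have le: "norm (green_response A T S g t) \<le> K * B"
    if g: "g \<in> borel_measurable lebesgue" "\<And>t. norm (g t) \<le> B" for g B t
  proof -
    let ?L = "\<lambda>l. LINT s|lebesgue. exp (- \<bar>Re (d l)\<bar> * \<bar>s\<bar>)"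
    have B0: "B \<ge> 0" using order_trans[OF norm_ge_zero g(2)] .
    have "norm (green_response A T S g t) \<le> (\<Sum>l\<in>UNIV. (B * a l * ?L l) * b l)"
      unfolding response_eq[OF g]
    proof (rule sum_norm_le)
      fix l
      show "norm (\<psi> l (?z g l t)) \<le> (B * a l * ?L l) * b l"
        by (rule order_trans[OF b(1) mult_right_mono[OF response_le[OF g]]]) (use b(2)[of l] in simp)
    qed
    also have "\<dots> \<le> (\<Sum>l\<in>UNIV. B * \<bar>a l * ?L l * b l\<bar>)"
    proof (rule sum_mono)
      fix l
      show "(B * a l * ?L l) * b l \<le> B * \<bar>a l * ?L l * b l\<bar>"
        using mult_left_mono[OF abs_ge_self B0, of "a l * ?L l * b l"] by (simp only: mult.assoc)
    qed
    also have "\<dots> \<le> K * B" using B0 by (simp add: K_def sum_distrib_left[symmetric] algebra_simps)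
    finally show ?thesis .
  qed
  show ?thesis
  proof (rule that[of K])
    show "K > 0" unfolding K_def by (intro add_pos_nonneg sum_nonneg) auto
    show "integrable lebesgue (\<lambda>\<tau>. green A T S (t - \<tau>) *v g \<tau>)"
      if g: "g \<in> borel_measurable lebesgue" "\<And>t. norm (g t) \<le> B" for g B t
      unfolding green_mult
      by (intro Bochner_Integration.integrable_sum integrable_bounded_linear[OF \<psi>] integrable_\<phi>[OF g])
    show "x = green_response A T S g"
      if B: "\<And>t. norm (g t) \<le> B" and C: "\<And>t. norm (x t) \<le> C"
        and x: "solves (\<lambda>s y. A *v y + g s) x" for g x B C
    proof
      fix t
      note g = solves_bounded_measurable(2)[OF x B C] B
      let ?y = "green_response A T S g"
      \<comment> \<open>The inhomogeneity cancels in the difference of two bounded solutions, so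
        each coordinate is a bounded solution of a scalar homogeneous equation.\<close>
      have "\<phi> l (x t - ?y t) = 0" for l
      proof (rule bounded_scalar_homogeneous_zero[where w = "\<lambda>t. \<phi> l (x t - ?y t)", OF d])
        fix u v :: real assume uv: "u \<le> v"
        have "((\<lambda>s. (A *v x s + g s) - (A *v ?y s + g s)) has_integral (x v - x u) - (?y v - ?y u)) {u..v}"
          using x solves_response[OF g] uv by (intro has_integral_diff) (auto simp: solves_def)
        from has_integral_linear[OF this \<phi>[of l]]
        have "((\<lambda>s. \<phi> l (A *v (x s - ?y s))) has_integral \<phi> l ((x v - ?y v) - (x u - ?y u))) {u..v}"
          by (simp add: o_def matrix_vector_mult_diff_distrib algebra_simps)
        then show "((\<lambda>s. d l * \<phi> l (x s - ?y s)) has_integral \<phi> l (x v - ?y v) - \<phi> l (x u - ?y u)) {u..v}"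
          by (simp only: \<phi>A linear_diff[OF bounded_linear.linear[OF \<phi>], of l "x v - ?y v"])
      next
        fix t
        have "norm (\<phi> l (x t - ?y t)) \<le> norm (x t - ?y t) * \<bar>a l\<bar>"
          by (rule order_trans[OF a mult_left_mono]) auto
        also have "\<dots> \<le> (C + K * B) * \<bar>a l\<bar>"
          by (intro mult_right_mono order_trans[OF norm_triangle_ineq4 add_mono] C le[OF g]) auto
        finally show "norm (\<phi> l (x t - ?y t)) \<le> (C + K * B) * \<bar>a l\<bar>" .
      qed
      then have "x t - ?y t = 0"
        using ident[of "x t - ?y t"] linear_0[OF bounded_linear.linear[OF \<psi>]] by simp
      then show "x t = ?y t" by simp
    qed
  qed (fact le solves_response)+
qed

section \<open>Partial derivatives and Frechet derivatives\<close>

text \<open>Phrased with \<open>closed_segment\<close> because it is applied to coordinate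
  increments of either sign.\<close>

lemma norm_diff_le_vector_derivative:
  fixes \<phi> :: "real \<Rightarrow> 'a::real_normed_vector"
  assumes "\<And>t. t \<in> closed_segment a b \<Longrightarrow> (\<phi> has_vector_derivative \<phi>' t) (at t)"
    and "\<And>t. t \<in> closed_segment a b \<Longrightarrow> norm (\<phi>' t) \<le> B"
  shows "norm (\<phi> b - \<phi> a) \<le> B * \<bar>b - a\<bar>"
proof -
  have "norm (\<phi> b - \<phi> a) \<le> B * norm (b - a)"
  proof (rule differentiable_bound[of "closed_segment a b" \<phi> "\<lambda>t h. h *\<^sub>R \<phi>' t"])
    fix t assume t: "t \<in> closed_segment a b"
    show "(\<phi> has_derivative (\<lambda>h. h *\<^sub>R \<phi>' t)) (at t within closed_segment a b)"
      using has_vector_derivative_at_within[OF assms(1)[OF t]] by (simp add: has_vector_derivative_def)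
    show "onorm (\<lambda>h. h *\<^sub>R \<phi>' t) \<le> B"
      by (rule onorm_le) (use assms(2)[OF t] in \<open>simp add: mult.commute[of B] mult_left_mono\<close>)
  qed auto
  then show ?thesis by simp
qed

text \<open>\<open>pd\<close> differentiates at parameter zero only; moving the base point gives the
  derivative everywhere on the line.\<close>

lemma has_vector_derivative_along_line:
  fixes g :: "'a::real_normed_vector \<Rightarrow> 'b::real_normed_vector"
  assumes "((\<lambda>h. g ((x + a *\<^sub>R v) + h *\<^sub>R v)) has_vector_derivative D) (at 0)"
  shows "((\<lambda>h. g (x + h *\<^sub>R v)) has_vector_derivative D) (at a)"
proof -
  have "((\<lambda>h. h - a) has_vector_derivative 1) (at a)"
    by (auto intro!: derivative_eq_intros simp: has_vector_derivative_def)
  then have "((\<lambda>h. g ((x + a *\<^sub>R v) + h *\<^sub>R v)) \<circ> (\<lambda>h. h - a) has_vector_derivative 1 *\<^sub>R D) (at a)"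
    by (rule vector_diff_chain_at) (use assms in simp)
  moreover have "(\<lambda>h. g ((x + a *\<^sub>R v) + h *\<^sub>R v)) \<circ> (\<lambda>h. h - a) = (\<lambda>h. g (x + h *\<^sub>R v))"
    by (rule ext) (simp add: algebra_simps)
  ultimately show ?thesis by simp
qed

lemma has_vector_derivative_scaleR_const: "((\<lambda>t. t *\<^sub>R w) has_vector_derivative w) (at t)"
  unfolding has_vector_derivative_def
  by (rule bounded_linear_imp_has_derivative[OF bounded_linear_scaleR_left])

text \<open>The coordinates are switched on one at a time. Each switch costs at most \<eta> times
  the size of that coordinate by the mean value inequality, since all points visited stay
  \<delta>-close to \<open>x\<close>.\<close>

lemma has_derivative_of_continuous_partials:
  fixes g :: "real^'n \<Rightarrow> 'b::real_normed_vector"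
  assumes V: "open V" and D: "\<And>x i. x \<in> V \<Longrightarrow> ((\<lambda>h. g (x + h *\<^sub>R axis i 1)) has_vector_derivative D i x) (at 0)"
    and cont: "\<And>i. continuous_on V (D i)" and x: "x \<in> V"
  shows "(g has_derivative (\<lambda>h. \<Sum>i\<in>UNIV. (h $ i) *\<^sub>R D i x)) (at x)"
  unfolding has_derivative_at_alt
proof (intro conjI allI impI)
  have "linear (\<lambda>h. \<Sum>i\<in>UNIV. (h $ i) *\<^sub>R D i x)"
    by (rule linearI) (simp_all add: algebra_simps sum.distrib scaleR_sum_right)
  then show "bounded_linear (\<lambda>h. \<Sum>i\<in>UNIV. (h $ i) *\<^sub>R D i x)"
    by (simp add: linear_conv_bounded_linear)
  fix e :: real assume e: "e > 0"
  define \<eta> where "\<eta> = e / real CARD('n)"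
  have \<eta>: "\<eta> > 0" using e by (simp add: \<eta>_def)
  have "\<forall>\<^sub>F y in nhds x. y \<in> V \<and> (\<forall>i. dist (D i y) (D i x) < \<eta>)"
  proof (intro eventually_conj eventually_all_finite)
    show "\<forall>\<^sub>F y in nhds x. y \<in> V" using V x by (rule eventually_nhds_in_open)
    fix i
    have "isCont (D i) x" using cont V x by (simp add: continuous_on_eq_continuous_at)
    then show "\<forall>\<^sub>F y in nhds x. dist (D i y) (D i x) < \<eta>"
      using \<eta> unfolding isCont_def tendsto_iff by (auto simp: eventually_nhds_conv_at)
  qed
  then obtain \<delta> where \<delta>: "\<delta> > 0" "\<And>y. dist y x < \<delta> \<Longrightarrow> y \<in> V"
      "\<And>y i. dist y x < \<delta> \<Longrightarrow> dist (D i y) (D i x) < \<eta>"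
    unfolding eventually_nhds_metric by blast
  show "\<exists>d>0. \<forall>y. norm (y - x) < d \<longrightarrow>
      norm (g y - g x - (\<Sum>i\<in>UNIV. ((y - x) $ i) *\<^sub>R D i x)) \<le> e * norm (y - x)"
  proof (intro exI[of _ \<delta>] conjI \<delta>(1) allI impI)
    fix y assume y: "norm (y - x) < \<delta>"
    define h where "h = y - x"
    \<comment> \<open>The displacement with only the coordinates in \<open>I\<close> moved.
      Induction over finite sets \<open>I\<close> makes an ordering of the coordinates
      unnecessary.\<close>
    define p where "p I = (\<chi> i. if i \<in> I then h $ i else 0)" for I
    have near: "dist (x + p I + s *\<^sub>R axis j 1) x < \<delta>" if "j \<notin> I" "s \<in> closed_segment 0 (h $ j)" for I j s
    proof -
      have "norm (p I + s *\<^sub>R axis j 1) \<le> norm h"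
      proof (rule norm_le_componentwise_cart)
        fix i show "norm ((p I + s *\<^sub>R axis j 1) $ i) \<le> norm (h $ i)"
          using that by (auto simp: p_def axis_def closed_segment_eq_real_ivl split: if_splits)
      qed
      then show ?thesis using y by (simp add: dist_norm h_def add.assoc)
    qed
    have part: "norm (g (x + p I) - g x - (\<Sum>i\<in>I. (h $ i) *\<^sub>R D i x)) \<le> (\<Sum>i\<in>I. \<eta> * \<bar>h $ i\<bar>)" if "finite I" for I
      using that
    proof (induction I rule: finite_induct)
      case empty
      have "p {} = 0" by (simp add: p_def vec_eq_iff)
      then show ?case by simp
    next
      case (insert j I)
      let ?w = "x + p I"
      let ?\<phi> = "\<lambda>s. g (?w + s *\<^sub>R axis j 1) - s *\<^sub>R D j x"
      have pj: "x + p (insert j I) = ?w + (h $ j) *\<^sub>R axis j 1"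
        using insert(2) by (auto simp: p_def vec_eq_iff axis_def)
      have "norm (?\<phi> (h $ j) - ?\<phi> 0) \<le> \<eta> * \<bar>h $ j - 0\<bar>"
      proof (rule norm_diff_le_vector_derivative)
        fix s assume s: "s \<in> closed_segment 0 (h $ j)"
        note n = near[OF insert(2) s]
        show "(?\<phi> has_vector_derivative (D j (?w + s *\<^sub>R axis j 1) - D j x)) (at s)"
          by (rule has_vector_derivative_diff[OF has_vector_derivative_along_line[OF D[OF \<delta>(2)[OF n]]]
                has_vector_derivative_scaleR_const])
        show "norm (D j (?w + s *\<^sub>R axis j 1) - D j x) \<le> \<eta>"
          using \<delta>(3)[OF n, of j] by (simp add: dist_norm)
      qed
      then have 1: "norm (g (x + p (insert j I)) - g ?w - (h $ j) *\<^sub>R D j x) \<le> \<eta> * \<bar>h $ j\<bar>"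
        by (simp add: pj algebra_simps)
      have "g (x + p (insert j I)) - g x - (\<Sum>i\<in>insert j I. (h $ i) *\<^sub>R D i x) =
          (g (x + p (insert j I)) - g ?w - (h $ j) *\<^sub>R D j x) + (g ?w - g x - (\<Sum>i\<in>I. (h $ i) *\<^sub>R D i x))"
        using insert by simp
      also have "norm \<dots> \<le> \<eta> * \<bar>h $ j\<bar> + (\<Sum>i\<in>I. \<eta> * \<bar>h $ i\<bar>)"
        by (rule norm_triangle_mono[OF 1 insert.IH])
      finally show ?case using insert by simp
    qed
    have "x + p UNIV = y" by (simp add: p_def h_def vec_eq_iff)
    then have "norm (g y - g x - (\<Sum>i\<in>UNIV. ((y - x) $ i) *\<^sub>R D i x)) \<le> (\<Sum>i\<in>UNIV. \<eta> * \<bar>h $ i\<bar>)"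
      using part[OF finite_class.finite_UNIV] unfolding h_def by simp
    also have "\<dots> \<le> (\<Sum>i\<in>(UNIV::'n set). \<eta> * norm h)"
      using \<eta> by (intro sum_mono mult_left_mono component_le_norm_cart) auto
    also have "\<dots> = e * norm (y - x)" by (simp add: \<eta>_def h_def)
    finally show "norm (g y - g x - (\<Sum>i\<in>UNIV. ((y - x) $ i) *\<^sub>R D i x)) \<le> e * norm (y - x)" .
  qed
qed

section \<open>Symmetry of mixed partial derivatives\<close>

definition second_difference :: "('a::real_vector \<Rightarrow> 'b::real_vector) \<Rightarrow> 'a \<Rightarrow> 'a \<Rightarrow> 'a \<Rightarrow> 'b" where
  "second_difference g x u v = g (x + u + v) - g (x + u) - g (x + v) + g x"

lemma second_difference_commute: "second_difference g x u v = second_difference g x v u"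
  by (simp add: second_difference_def algebra_simps)

text \<open>Differentiability of the \<open>u\<close>-derivative at the single point
  \<open>x\<close> is enough to identify the limit as its derivative along \<open>v\<close>. The
  quotient is symmetric in \<open>u\<close> and \<open>v\<close>, which is how mixed partial
  derivatives get exchanged.\<close>

lemma second_difference_tendsto:
  fixes g :: "'a::real_normed_vector \<Rightarrow> 'b::real_normed_vector"
  assumes D: "(g' has_derivative D) (at x)" and r: "r > 0"
    and g': "\<And>y. dist y x < r \<Longrightarrow> ((\<lambda>h. g (y + h *\<^sub>R u)) has_vector_derivative g' y) (at 0)"
  shows "((\<lambda>s. (1 / s\<^sup>2) *\<^sub>R second_difference g x (s *\<^sub>R u) (s *\<^sub>R v)) \<longlongrightarrow> D v)
    (at_right 0)"
proof (rule tendstoI)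
  fix e :: real assume e: "e > 0"
  \<comment> \<open>Any number above \<open>norm u + norm v\<close> would serve; it bounds the
    displacements per unit \<open>s\<close> and makes the final inequality strict.\<close>
  define M where "M = 2 * norm u + norm v + 1"
  have M: "M > 0" by (simp add: M_def add_nonneg_pos)
  define \<eta> where "\<eta> = e / (2 * M)"
  have \<eta>: "\<eta> > 0" using e M by (simp add: \<eta>_def)
  interpret D: bounded_linear D by (rule has_derivative_bounded_linear[OF D])
  obtain \<delta> where \<delta>: "\<delta> > 0" "\<And>y. norm (y - x) < \<delta> \<Longrightarrow> norm (g' y - g' x - D (y - x)) \<le> \<eta> * norm (y - x)"
    using D \<eta> unfolding has_derivative_at_alt by blast
  have \<delta>': "norm (g' (x + w) - g' x - D w) \<le> \<eta> * b" if "norm w \<le> b" "b < \<delta>" for w b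
    using order_trans[OF \<delta>(2)[of "x + w"] mult_left_mono, of b] that \<eta> by simp
  have "\<forall>\<^sub>F s in at_right 0. s \<in> {0<..<min \<delta> r / M}"
    using \<delta>(1) r M by (intro eventually_at_right_real) auto
  then show "\<forall>\<^sub>F s in at_right 0. dist ((1 / s\<^sup>2) *\<^sub>R second_difference g x (s *\<^sub>R u) (s *\<^sub>R v)) (D v) < e"
  proof eventually_elim
    case (elim s)
    then have s: "s > 0" and sM: "s * M < min \<delta> r" using M by (auto simp: field_simps)
    have bnd: "norm (t *\<^sub>R u + q *\<^sub>R v) \<le> s * (norm u + norm v)" if "0 \<le> t" "t \<le> s" "q \<in> {0, s}" for t q
      using that s by (intro order_trans[OF norm_triangle_ineq])
        (auto simp: distrib_left intro!: add_mono mult_right_mono)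
    have lt: "s * (norm u + norm v) < min \<delta> r"
    proof -
      have "s * (norm u + norm v) \<le> s * M" using s by (simp add: M_def)
      then show ?thesis using sM by simp
    qed
    \<comment> \<open>With the expected value subtracted, the derivative in \<open>t\<close> is the
      difference of two linearization errors of \<open>g'\<close>, at points within reach of
      \<delta>. The mean value inequality then yields the factor \<open>s\<^sup>2\<close>.\<close>
    let ?\<phi> = "\<lambda>t. g (x + s *\<^sub>R v + t *\<^sub>R u) - g (x + t *\<^sub>R u) - t *\<^sub>R (s *\<^sub>R D v)"
    have "norm (?\<phi> s - ?\<phi> 0) \<le> (\<eta> * (s * (norm u + norm v)) + \<eta> * (s * (norm u + norm v))) * \<bar>s - 0\<bar>"
    proof (rule norm_diff_le_vector_derivative)
      fix t assume "t \<in> closed_segment 0 s"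
      then have t: "0 \<le> t" "t \<le> s" using s by (auto simp: closed_segment_eq_real_ivl)
      have b1: "norm (t *\<^sub>R u + s *\<^sub>R v) \<le> s * (norm u + norm v)" using bnd[OF t, of s] by simp
      have b2: "norm (t *\<^sub>R u) \<le> s * (norm u + norm v)" using bnd[OF t, of 0] by simp
      have d1: "dist (x + s *\<^sub>R v + t *\<^sub>R u) x < r" "dist (x + t *\<^sub>R u) x < r"
        using b1 b2 lt by (simp_all add: dist_norm algebra_simps)
      show "(?\<phi> has_vector_derivative (g' (x + s *\<^sub>R v + t *\<^sub>R u) - g' (x + t *\<^sub>R u) - s *\<^sub>R D v)) (at t)"
        by (rule has_vector_derivative_diff[OF has_vector_derivative_diff[OF
              has_vector_derivative_along_line[OF g'[OF d1(1)]] has_vector_derivative_along_line[OF g'[OF d1(2)]]]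
              has_vector_derivative_scaleR_const])
      have "x + s *\<^sub>R v + t *\<^sub>R u = x + (t *\<^sub>R u + s *\<^sub>R v)" by simp
      then have "norm (g' (x + s *\<^sub>R v + t *\<^sub>R u) - g' x - D (t *\<^sub>R u + s *\<^sub>R v)) \<le> \<eta> * (s * (norm u + norm v))"
        using \<delta>'[OF b1] lt by (simp only: min_less_iff_conj)
      moreover have "norm (g' (x + t *\<^sub>R u) - g' x - D (t *\<^sub>R u)) \<le> \<eta> * (s * (norm u + norm v))"
        using \<delta>'[OF b2] lt by simp
      ultimately have "norm ((g' (x + s *\<^sub>R v + t *\<^sub>R u) - g' x - D (t *\<^sub>R u + s *\<^sub>R v)) -
          (g' (x + t *\<^sub>R u) - g' x - D (t *\<^sub>R u))) \<le> \<eta> * (s * (norm u + norm v)) + \<eta> * (s * (norm u + norm v))"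
        by (rule order_trans[OF norm_triangle_ineq4 add_mono])
      moreover have "(g' (x + s *\<^sub>R v + t *\<^sub>R u) - g' x - D (t *\<^sub>R u + s *\<^sub>R v)) -
          (g' (x + t *\<^sub>R u) - g' x - D (t *\<^sub>R u)) = g' (x + s *\<^sub>R v + t *\<^sub>R u) - g' (x + t *\<^sub>R u) - s *\<^sub>R D v"
        by (simp add: D.add D.scaleR)
      ultimately show "norm (g' (x + s *\<^sub>R v + t *\<^sub>R u) - g' (x + t *\<^sub>R u) - s *\<^sub>R D v)
          \<le> \<eta> * (s * (norm u + norm v)) + \<eta> * (s * (norm u + norm v))"
        by (simp only:)
    qed
    moreover have "(\<eta> * (s * (norm u + norm v)) + \<eta> * (s * (norm u + norm v))) * \<bar>s - 0\<bar> =
        s\<^sup>2 * (\<eta> * (2 * (norm u + norm v)))"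
      using s by (simp add: power2_eq_square)
    ultimately have est: "norm (?\<phi> s - ?\<phi> 0) \<le> s\<^sup>2 * (\<eta> * (2 * (norm u + norm v)))"
      by (simp only:)
    define \<Delta> where "\<Delta> = second_difference g x (s *\<^sub>R u) (s *\<^sub>R v)"
    have comm: "x + s *\<^sub>R v + s *\<^sub>R u = x + s *\<^sub>R u + s *\<^sub>R v" by (simp add: add_ac)
    have "?\<phi> s - ?\<phi> 0 = \<Delta> - s\<^sup>2 *\<^sub>R D v"
      unfolding comm \<Delta>_def second_difference_def by (simp add: power2_eq_square)
    with est have est: "norm (\<Delta> - s\<^sup>2 *\<^sub>R D v) \<le> s\<^sup>2 * (\<eta> * (2 * (norm u + norm v)))"
      by (simp only:)
    have "(1 / s\<^sup>2) *\<^sub>R \<Delta> - D v = (1 / s\<^sup>2) *\<^sub>R (\<Delta> - s\<^sup>2 *\<^sub>R D v)"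
      using s by (simp add: scaleR_diff_right)
    then have "dist ((1 / s\<^sup>2) *\<^sub>R \<Delta>) (D v) = norm (\<Delta> - s\<^sup>2 *\<^sub>R D v) / s\<^sup>2"
      by (simp add: dist_norm)
    also have "\<dots> \<le> \<eta> * (2 * (norm u + norm v))" using est s by (simp add: pos_divide_le_eq mult.commute)
    also have "\<dots> < \<eta> * (2 * M)" using \<eta> by (intro mult_strict_left_mono) (auto simp: M_def intro: add_nonneg_pos)
    also have "\<dots> = e" using M by (simp add: \<eta>_def)
    finally show ?case unfolding \<Delta>_def .
  qed
qed

lemma pd_cong:
  assumes "open V" "x \<in> V" "\<And>y. y \<in> V \<Longrightarrow> f y = g y"
  shows "pd i f x = pd i g x"
  unfolding pd_def
proof (rule vector_derivative_cong_eq)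
  have "((\<lambda>h. x + h *\<^sub>R axis i 1) \<longlongrightarrow> x + 0 *\<^sub>R axis i (1::real)) (nhds 0)"
    by (intro tendsto_intros filterlim_ident)
  then have "\<forall>\<^sub>F h in nhds 0. x + h *\<^sub>R axis i 1 \<in> V"
    using assms by (auto dest: topological_tendstoD)
  then show "\<forall>\<^sub>F h in nhds 0. h \<in> UNIV \<longrightarrow> f (x + h *\<^sub>R axis i 1) = g (x + h *\<^sub>R axis i 1)"
    by eventually_elim (use assms in auto)
qed auto

lemma Ck_open_has_pd:
  assumes "Ck_open r V f" "length is < r" "x \<in> V"
  shows "((\<lambda>h. pds is f (x + h *\<^sub>R axis i 1)) has_vector_derivative pds (i # is) f x) (at 0)"
proof -
  have "(\<lambda>h. pds is f (x + h *\<^sub>R axis i 1)) differentiable (at 0)"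
    using assms unfolding Ck_open_def by blast
  from this[unfolded vector_derivative_works] show ?thesis by (simp add: pd_def)
qed

lemma Ck_open_continuous: "Ck_open r V f \<Longrightarrow> length is \<le> r \<Longrightarrow> continuous_on V (pds is f)"
  by (simp add: Ck_open_def)

lemma Ck_open_has_derivative:
  assumes "Ck_open r V f" "open V" "length is < r" "x \<in> V"
  shows "(pds is f has_derivative (\<lambda>h. \<Sum>i\<in>UNIV. (h $ i) *\<^sub>R pds (i # is) f x)) (at x)"
proof (rule has_derivative_of_continuous_partials[OF assms(2) Ck_open_has_pd[OF assms(1,3)] _ assms(4)])
  show "continuous_on V (pds (i # is) f)" for i
    by (rule Ck_open_continuous[OF assms(1)]) (use assms(3) in simp)
qed

text \<open>Both orders are limits of the same symmetric second difference quotient of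
  \<open>pds is f\<close>.\<close>

lemma pds_swap:
  assumes f: "Ck_open r V f" "open V" and l: "length is + 2 \<le> r" and x: "x \<in> V"
  shows "pds (i # j # is) f x = pds (j # i # is) f x"
proof -
  obtain \<rho> where \<rho>: "\<rho> > 0" "\<And>y. dist y x < \<rho> \<Longrightarrow> y \<in> V"
    using f(2) x unfolding open_dist by blast
  have 1: "((\<lambda>s. (1 / s\<^sup>2) *\<^sub>R second_difference (pds is f) x (s *\<^sub>R axis j 1) (s *\<^sub>R axis i 1))
    \<longlongrightarrow> pds (i # j # is) f x) (at_right 0)" for i j
  proof -
    have "(\<Sum>k\<in>UNIV. (axis i 1 $ k) *\<^sub>R pds (k # j # is) f x) =
        (\<Sum>k\<in>UNIV. if k = i then pds (k # j # is) f x else 0)"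
      by (rule sum.cong) (auto simp: axis_def)
    also have "\<dots> = pds (i # j # is) f x" by simp
    finally have eq: "(\<Sum>k\<in>UNIV. (axis i 1 $ k) *\<^sub>R pds (k # j # is) f x) = pds (i # j # is) f x" .
    show ?thesis
      unfolding eq[symmetric]
      by (rule second_difference_tendsto[OF Ck_open_has_derivative[OF f] \<rho>(1) Ck_open_has_pd[OF f(1)]])
         (use l x \<rho>(2) in auto)
  qed
  have "((\<lambda>s. (1 / s\<^sup>2) *\<^sub>R second_difference (pds is f) x (s *\<^sub>R axis j 1) (s *\<^sub>R axis i 1))
    \<longlongrightarrow> pds (j # i # is) f x) (at_right 0)"
    using 1[where i = j and j = i] by (simp only: second_difference_commute)
  from tendsto_unique[OF _ 1[where i = i and j = j] this] show ?thesis by simp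
qed

lemma pds_move_front:
  assumes f: "Ck_open r V f" "open V"
  shows "length as + length bs + 1 \<le> r \<Longrightarrow> x \<in> V \<Longrightarrow> pds (as @ i # bs) f x = pds (i # as @ bs) f x"
proof (induction as arbitrary: x)
  case (Cons a as)
  have "pds ((a # as) @ i # bs) f x = pd a (pds (as @ i # bs) f) x" by simp
  also have "\<dots> = pd a (pds (i # as @ bs) f) x"
    by (rule pd_cong[OF f(2) Cons.prems(2) Cons.IH]) (use Cons in auto)
  also have "\<dots> = pds (a # i # as @ bs) f x" by simp
  also have "\<dots> = pds (i # a # as @ bs) f x"
    by (rule pds_swap[OF f]) (use Cons in auto)
  finally show ?case by simp
qed simp

lemma pds_perm:
  assumes f: "Ck_open r V f" "open V"
  shows "mset is = mset js \<Longrightarrow> length is \<le> r \<Longrightarrow> x \<in> V \<Longrightarrow> pds is f x = pds js f x"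
proof (induction "is" arbitrary: js x)
  case (Cons i "is")
  then have "i \<in> set js" by (metis list.set_intros(1) set_mset_mset)
  then obtain as bs where js: "js = as @ i # bs" by (meson split_list)
  have m: "mset is = mset (as @ bs)" using Cons.prems(1) js by simp
  have len: "length is = length as + length bs" using mset_eq_length[OF m] by simp
  have "pds (i # is) f x = pd i (pds is f) x" by simp
  also have "\<dots> = pd i (pds (as @ bs) f) x"
    by (rule pd_cong[OF f(2) Cons.prems(3) Cons.IH[OF m]]) (use Cons in auto)
  also have "\<dots> = pds (i # as @ bs) f x" by simp
  also have "\<dots> = pds js f x"
    unfolding js by (rule pds_move_front[OF f, symmetric]) (use Cons len in auto)
  finally show ?case .
qed auto

section \<open>Multi-index derivatives as lists of directions\<close>

text \<open>The directions used by \<open>mpartial\<close>, in its order. As a multiset this list is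
  the multi-index itself, so that symmetry of derivatives becomes invariance under permutation of
  lists.\<close>

definition mi_list :: "nat^'n \<Rightarrow> 'n::finite list" where
  "mi_list \<gamma> = concat (map (\<lambda>i. replicate (\<gamma> $ i) i) coords)"

lemma count_mi_list: "count (mset (mi_list \<gamma>)) i = \<gamma> $ i"
proof -
  have "distinct xs \<Longrightarrow> count (mset (concat (map (\<lambda>i. replicate (\<gamma> $ i) i) xs))) i = (if i \<in> set xs then \<gamma> $ i else 0)" for xs
    by (induction xs) auto
  from this[OF coords(1)] show ?thesis by (simp add: mi_list_def coords(2))
qed

lemma length_mi_list: "length (mi_list \<gamma>) = mi_abs \<gamma>"
proof -
  have "length (mi_list \<gamma>) = size (mset (mi_list \<gamma>))" by simp
  also have "\<dots> = (\<Sum>i\<in>UNIV. count (mset (mi_list \<gamma>)) i)"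
    unfolding size_multiset_overloaded_eq
    by (rule sum.mono_neutral_left) (auto simp: not_in_iff)
  finally show ?thesis by (simp add: count_mi_list mi_abs_def)
qed

lemma mpartial_eq_pds: "mpartial \<gamma> f = pds (mi_list \<gamma>) f"
proof -
  have "foldr (\<lambda>i. pd i ^^ (\<gamma> $ i)) xs f = pds (concat (map (\<lambda>i. replicate (\<gamma> $ i) i) xs)) f" for xs
    by (induction xs) auto
  then show ?thesis by (simp add: mpartial_def mi_list_def)
qed

lemma mi_abs_add: "mi_abs (\<gamma> + \<delta>) = mi_abs \<gamma> + mi_abs \<delta>"
  by (simp add: mi_abs_def sum.distrib)

lemma mi_abs_axis [simp]: "mi_abs (axis i (Suc 0)) = 1"
  by (simp add: mi_abs_def axis_def)

lemma mi_abs_zero [simp]: "mi_abs 0 = 0"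
  by (simp add: mi_abs_def)

lemma mi_abs_eq_0_iff [simp]: "mi_abs \<gamma> = 0 \<longleftrightarrow> \<gamma> = 0"
  by (auto simp: mi_abs_def vec_eq_iff)

text \<open>The new direction arrives at the front of the list, not at its canonical place;
  permuting the list repairs this.\<close>

lemma pd_mpartial:
  assumes f: "Ck_open r V f" "open V" and "mi_abs \<gamma> < r" "x \<in> V"
  shows "pds (i # mi_list \<gamma>) f x = mpartial (\<gamma> + axis i 1) f x"
  unfolding mpartial_eq_pds
proof (rule pds_perm[OF f])
  show "mset (i # mi_list \<gamma>) = mset (mi_list (\<gamma> + axis i 1))"
    by (rule multiset_eqI) (auto simp: count_mi_list axis_def)
qed (use assms in \<open>auto simp: length_mi_list\<close>)

lemma mpartial_has_derivative:
  assumes f: "Ck_open r V f" "open V" and "mi_abs \<gamma> < r" "x \<in> V"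
  shows "(mpartial \<gamma> f has_derivative (\<lambda>h. \<Sum>i\<in>UNIV. (h $ i) *\<^sub>R mpartial (\<gamma> + axis i 1) f x)) (at x)"
  using Ck_open_has_derivative[OF f, of "mi_list \<gamma>" x] pd_mpartial[OF assms] assms
  by (simp add: length_mi_list mpartial_eq_pds[of \<gamma>])

lemma mpartial_continuous:
  assumes "Ck_open r V f" "mi_abs \<gamma> \<le> r"
  shows "continuous_on V (mpartial \<gamma> f)"
  using Ck_open_continuous[OF assms(1), of "mi_list \<gamma>"] assms(2) by (simp add: mpartial_eq_pds length_mi_list)

section \<open>Taylor expansion in multi-index form\<close>

text \<open>The divided power \<open>x^\<gamma> / \<gamma>!\<close>. With the factorials built in,
  both the Taylor polynomial and the binomial formula lose their coefficients.\<close>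

definition divpow :: "nat^'n \<Rightarrow> real^'n \<Rightarrow> real" where
  "divpow \<gamma> x = (\<Prod>i\<in>UNIV. (x $ i) ^ (\<gamma> $ i)) / (\<Prod>i\<in>UNIV. fact (\<gamma> $ i))"

lemma divpow_zero_index [simp]: "divpow 0 x = 1"
  by (simp add: divpow_def)

lemma divpow_add_axis: "real ((\<gamma> + axis i 1) $ i) * divpow (\<gamma> + axis i 1) x = (x $ i) * divpow \<gamma> x"
proof -
  have e: "(\<gamma> + axis i 1) $ i = Suc (\<gamma> $ i)" by (simp add: axis_def)
  have p: "(\<Prod>j\<in>UNIV. h j ((\<gamma> + axis i 1) $ j)) = h i (Suc (\<gamma> $ i)) * (\<Prod>j\<in>UNIV - {i}. h j (\<gamma> $ j))"
    for h :: "'a \<Rightarrow> nat \<Rightarrow> real"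
    by (subst prod.remove[of UNIV i]) (auto simp: axis_def intro!: prod.cong)
  have q: "(\<Prod>j\<in>UNIV. h j (\<gamma> $ j)) = h i (\<gamma> $ i) * (\<Prod>j\<in>UNIV - {i}. h j (\<gamma> $ j))"
    for h :: "'a \<Rightarrow> nat \<Rightarrow> real"
    by (subst prod.remove[of UNIV i]) auto
  show ?thesis
    unfolding divpow_def p[of "\<lambda>j n. (x $ j) ^ n"] p[of "\<lambda>j n. fact n"] q[of "\<lambda>j n. (x $ j) ^ n"] q[of "\<lambda>j n. fact n"]
    by (simp only: e power_Suc fact_Suc of_nat_mult) (simp del: of_nat_Suc)
qed

lemma abs_divpow_le: "\<bar>divpow \<gamma> x\<bar> \<le> norm x ^ mi_abs \<gamma>"
proof -
  have "\<bar>\<Prod>i\<in>UNIV. (x $ i) ^ (\<gamma> $ i)\<bar> \<le> (\<Prod>i\<in>UNIV. norm x ^ (\<gamma> $ i))"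
    unfolding abs_prod power_abs
    by (intro prod_mono conjI power_mono component_le_norm_cart) auto
  also have "\<dots> = norm x ^ mi_abs \<gamma>" by (simp add: power_sum mi_abs_def)
  finally have "\<bar>\<Prod>i\<in>UNIV. (x $ i) ^ (\<gamma> $ i)\<bar> \<le> norm x ^ mi_abs \<gamma>" .
  moreover have "(1::real) \<le> (\<Prod>i\<in>UNIV. fact (\<gamma> $ i))"
    by (intro prod_ge_1 fact_ge_1)
  ultimately show ?thesis
    unfolding divpow_def abs_divide
    by (smt (verit) abs_of_pos divide_le_eq_1 frac_le div_by_1 abs_ge_zero)
qed

lemma finite_mi_abs_eq [simp]: "finite {\<gamma> :: nat^'n. mi_abs \<gamma> = m}"
  by (rule finite_subset[OF _ finite_mi_abs_le[of m]]) auto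

lemma finite_mi_abs_less [simp]: "finite {\<gamma> :: nat^'n. mi_abs \<gamma> < m}"
  by (rule finite_subset[OF _ finite_mi_abs_le[of m]]) auto

lemma sum_mi_abs_less: "(\<Sum>\<gamma> | mi_abs \<gamma> < m. F \<gamma>) = (\<Sum>k<m. \<Sum>\<gamma> | mi_abs \<gamma> = k. F \<gamma>)"
  for F :: "nat^'n \<Rightarrow> 'b::comm_monoid_add"
proof -
  have "(\<Sum>\<gamma> | mi_abs \<gamma> < m. F \<gamma>) = (\<Sum>k<m. \<Sum>\<gamma> | \<gamma> \<in> {\<gamma>. mi_abs \<gamma> < m} \<and> mi_abs \<gamma> = k. F \<gamma>)"
    by (rule sum.group[symmetric]) auto
  also have "\<dots> = (\<Sum>k<m. \<Sum>\<gamma> | mi_abs \<gamma> = k. F \<gamma>)"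
    by (intro sum.cong) auto
  finally show ?thesis .
qed

text \<open>Euler's identity for homogeneous sums, which makes the derivatives along a ray telescope.\<close>

lemma sum_divpow_axis:
  fixes c :: "nat^'n \<Rightarrow> real"
  shows "(\<Sum>\<gamma> | mi_abs \<gamma> = k. divpow \<gamma> x * (\<Sum>i\<in>UNIV. x $ i * c (\<gamma> + axis i 1))) =
    real (Suc k) * (\<Sum>\<delta> | mi_abs \<delta> = Suc k. divpow \<delta> x * c \<delta>)"
proof -
  let ?S = "{\<delta> :: nat^'n. mi_abs \<delta> = Suc k}"
  have "(\<Sum>\<gamma> | mi_abs \<gamma> = k. divpow \<gamma> x * (\<Sum>i\<in>UNIV. x $ i * c (\<gamma> + axis i 1))) =
      (\<Sum>i\<in>UNIV. \<Sum>\<gamma> | mi_abs \<gamma> = k. real ((\<gamma> + axis i 1) $ i) * divpow (\<gamma> + axis i 1) x * c (\<gamma> + axis i 1))"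
    unfolding divpow_add_axis sum_distrib_left by (subst sum.swap) (simp add: mult_ac)
  also have "\<dots> = (\<Sum>i\<in>UNIV. \<Sum>\<delta>\<in>?S. real (\<delta> $ i) * divpow \<delta> x * c \<delta>)"
  proof (rule sum.cong[OF refl])
    fix i :: 'n
    \<comment> \<open>Indices with \<open>\<delta> $ i = 0\<close> carry a zero factor; all others
      arise from exactly one \<gamma> by raising component \<open>i\<close>.\<close>
    have "(\<Sum>\<delta>\<in>?S. real (\<delta> $ i) * divpow \<delta> x * c \<delta>) =
        (\<Sum>\<delta>\<in>{\<delta> \<in> ?S. \<delta> $ i \<noteq> 0}. real (\<delta> $ i) * divpow \<delta> x * c \<delta>)"
      by (rule sum.mono_neutral_right) auto
    also have "{\<delta> \<in> ?S. \<delta> $ i \<noteq> 0} = (\<lambda>\<gamma>. \<gamma> + axis i 1) ` {\<gamma>. mi_abs \<gamma> = k}"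
    proof (intro equalityI subsetI)
      fix \<delta> :: "nat^'n" assume "\<delta> \<in> {\<delta> \<in> ?S. \<delta> $ i \<noteq> 0}"
      then have \<delta>: "mi_abs \<delta> = Suc k" "\<delta> $ i \<noteq> 0" by auto
      define \<gamma> where "\<gamma> = (\<chi> j. if j = i then \<delta> $ i - 1 else \<delta> $ j)"
      have e: "\<delta> = \<gamma> + axis i 1" using \<delta>(2) by (auto simp: \<gamma>_def vec_eq_iff axis_def)
      then have "mi_abs \<gamma> = k" using \<delta>(1) by (simp add: mi_abs_add)
      with e show "\<delta> \<in> (\<lambda>\<gamma>. \<gamma> + axis i 1) ` {\<gamma>. mi_abs \<gamma> = k}" by blast
    qed (auto simp: mi_abs_add axis_nth)
    also have "(\<Sum>\<delta>\<in>(\<lambda>\<gamma>. \<gamma> + axis i 1) ` {\<gamma>. mi_abs \<gamma> = k}. real (\<delta> $ i) * divpow \<delta> x * c \<delta>) =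
        (\<Sum>\<gamma> | mi_abs \<gamma> = k. real ((\<gamma> + axis i 1) $ i) * divpow (\<gamma> + axis i 1) x * c (\<gamma> + axis i 1))"
      by (subst sum.reindex) (auto simp: inj_on_def)
    finally show "(\<Sum>\<gamma> | mi_abs \<gamma> = k. real ((\<gamma> + axis i 1) $ i) * divpow (\<gamma> + axis i 1) x * c (\<gamma> + axis i 1)) =
        (\<Sum>\<delta>\<in>?S. real (\<delta> $ i) * divpow \<delta> x * c \<delta>)" by simp
  qed
  also have "\<dots> = (\<Sum>\<delta>\<in>?S. real (mi_abs \<delta>) * (divpow \<delta> x * c \<delta>))"
  proof -
    have "(\<Sum>i\<in>UNIV. real (\<delta> $ i) * divpow \<delta> x * c \<delta>) = real (mi_abs \<delta>) * (divpow \<delta> x * c \<delta>)" for \<delta>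
      by (simp add: mi_abs_def sum_distrib_right mult.assoc)
    then show ?thesis by (subst sum.swap) (simp only:)
  qed
  also have "\<dots> = real (Suc k) * (\<Sum>\<delta>\<in>?S. divpow \<delta> x * c \<delta>)"
    by (simp add: sum_distrib_left)
  finally show ?thesis .
qed

lemma mpartial_zero_index: "mpartial 0 g = g"
proof -
  have "mi_list (0 :: nat^'a) = []" using length_mi_list[of "0 :: nat^'a"] by simp
  then show ?thesis by (simp add: mpartial_eq_pds)
qed

text \<open>Maclaurin's formula along the ray through \<open>x\<close>. It is stated for one
  component because the intermediate point \<theta> differs between components.\<close>

lemma Taylor_component:
  fixes f :: "real^'n \<Rightarrow> real^'n"
  assumes f: "Ck_open m V f" "open V" and m: "0 < m"
    and ray: "\<And>s. 0 \<le> s \<Longrightarrow> s \<le> 1 \<Longrightarrow> s *\<^sub>R x \<in> V"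
  obtains \<theta> where "0 < \<theta>" "\<theta> < 1"
    "f x $ j = (\<Sum>\<gamma> | mi_abs \<gamma> < m. divpow \<gamma> x * mpartial \<gamma> f 0 $ j) +
      (\<Sum>\<gamma> | mi_abs \<gamma> = m. divpow \<gamma> x * mpartial \<gamma> f (\<theta> *\<^sub>R x) $ j)"
proof -
  \<comment> \<open>The \<open>k\<close>-th derivative of the component along the ray; the factorial
    compensates for the divided powers.\<close>
  define D where "D k s = fact k * (\<Sum>\<gamma> | mi_abs \<gamma> = k. divpow \<gamma> x * mpartial \<gamma> f (s *\<^sub>R x) $ j)" for k s
  have "DERIV (D k) s :> D (Suc k) s" if k: "k < m" and s: "0 \<le> s" "s \<le> 1" for k s
  proof -
    have "((\<lambda>s. mpartial \<gamma> f (s *\<^sub>R x) $ j) has_real_derivative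
        (\<Sum>i\<in>UNIV. x $ i * mpartial (\<gamma> + axis i 1) f (s *\<^sub>R x) $ j)) (at s)" if \<gamma>: "mi_abs \<gamma> = k" for \<gamma>
    proof -
      have "(mpartial \<gamma> f has_derivative (\<lambda>h. \<Sum>i\<in>UNIV. (h $ i) *\<^sub>R mpartial (\<gamma> + axis i 1) f (s *\<^sub>R x))) (at (s *\<^sub>R x))"
        by (rule mpartial_has_derivative[OF f]) (use \<gamma> k ray[OF s] in auto)
      from vector_derivative_diff_chain_within[OF has_vector_derivative_scaleR_const has_derivative_at_withinI[OF this]]
      have "(mpartial \<gamma> f \<circ> (\<lambda>s. s *\<^sub>R x) has_vector_derivative
          (\<Sum>i\<in>UNIV. (x $ i) *\<^sub>R mpartial (\<gamma> + axis i 1) f (s *\<^sub>R x))) (at s)" .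
      from bounded_linear.has_vector_derivative[OF bounded_linear_vec_nth[of j] this]
      show ?thesis by (simp add: o_def has_real_derivative_iff_has_vector_derivative)
    qed
    then have "((\<lambda>s. fact k * (\<Sum>\<gamma> | mi_abs \<gamma> = k. divpow \<gamma> x * mpartial \<gamma> f (s *\<^sub>R x) $ j)) has_real_derivative
        fact k * (\<Sum>\<gamma> | mi_abs \<gamma> = k. divpow \<gamma> x * (\<Sum>i\<in>UNIV. x $ i * mpartial (\<gamma> + axis i 1) f (s *\<^sub>R x) $ j))) (at s)"
      by (intro DERIV_cmult DERIV_sum) auto
    then show ?thesis
      unfolding sum_divpow_axis[where c = "\<lambda>\<delta>. mpartial \<delta> f (s *\<^sub>R x) $ j"] D_def
      by (simp only: fact_Suc mult_ac of_nat_mult)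
  qed
  then obtain \<theta> where \<theta>: "0 < \<theta>" "\<theta> < 1" "D 0 1 = (\<Sum>k<m. D k 0 / fact k * 1 ^ k) + D m \<theta> / fact m * 1 ^ m"
    using Maclaurin[of 1 m D "D 0"] m by auto
  have "{\<gamma> :: nat^'n. mi_abs \<gamma> = 0} = {0}" by auto
  then have "f x $ j = D 0 1" by (simp add: D_def mpartial_zero_index)
  with \<theta> show ?thesis
    by (intro that[of \<theta>]) (simp_all add: D_def sum_mi_abs_less)
qed

text \<open>The free comparison values \<open>a \<gamma>\<close> serve two uses: derivatives at zero
  keep the top order in the polynomial with a small error, while zero moves the whole top order into
  the remainder.\<close>

lemma Taylor_bound:
  fixes f :: "real^'n \<Rightarrow> real^'n"
  assumes f: "Ck_open m V f" "open V" and m: "0 < m"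
    and ray: "\<And>s. 0 \<le> s \<Longrightarrow> s \<le> 1 \<Longrightarrow> s *\<^sub>R x \<in> V"
    and a: "\<And>\<gamma> s. mi_abs \<gamma> = m \<Longrightarrow> 0 \<le> s \<Longrightarrow> s \<le> 1 \<Longrightarrow> norm (mpartial \<gamma> f (s *\<^sub>R x) - a \<gamma>) \<le> M"
  shows "norm (f x - (\<Sum>\<gamma> | mi_abs \<gamma> < m. divpow \<gamma> x *\<^sub>R mpartial \<gamma> f 0) - (\<Sum>\<gamma> | mi_abs \<gamma> = m. divpow \<gamma> x *\<^sub>R a \<gamma>))
    \<le> real CARD('n) * real (card {\<gamma> :: nat^'n. mi_abs \<gamma> = m}) * M * norm x ^ m"
    (is "norm ?R \<le> _")
proof -
  have "\<bar>?R $ j\<bar> \<le> real (card {\<gamma> :: nat^'n. mi_abs \<gamma> = m}) * M * norm x ^ m" for j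
  proof -
    obtain \<theta> where \<theta>: "0 < \<theta>" "\<theta> < 1" and eq: "f x $ j = (\<Sum>\<gamma> | mi_abs \<gamma> < m. divpow \<gamma> x * mpartial \<gamma> f 0 $ j) +
      (\<Sum>\<gamma> | mi_abs \<gamma> = m. divpow \<gamma> x * mpartial \<gamma> f (\<theta> *\<^sub>R x) $ j)"
      using Taylor_component[OF f m ray] by blast
    have "?R $ j = (\<Sum>\<gamma> | mi_abs \<gamma> = m. divpow \<gamma> x * (mpartial \<gamma> f (\<theta> *\<^sub>R x) - a \<gamma>) $ j)"
      by (simp add: eq sum_subtractf right_diff_distrib)
    also have "\<bar>\<dots>\<bar> \<le> (\<Sum>\<gamma> | mi_abs \<gamma> = m. \<bar>divpow \<gamma> x * (mpartial \<gamma> f (\<theta> *\<^sub>R x) - a \<gamma>) $ j\<bar>)"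
      by (rule sum_abs)
    also have "\<dots> \<le> (\<Sum>\<gamma> :: nat^'n | mi_abs \<gamma> = m. norm x ^ m * M)"
    proof (rule sum_mono)
      fix \<gamma> :: "nat^'n" assume "\<gamma> \<in> {\<gamma>. mi_abs \<gamma> = m}"
      then have \<gamma>: "mi_abs \<gamma> = m" by simp
      have "\<bar>(mpartial \<gamma> f (\<theta> *\<^sub>R x) - a \<gamma>) $ j\<bar> \<le> M"
        by (rule order_trans[OF component_le_norm_cart a[OF \<gamma>]]) (use \<theta> in auto)
      then show "\<bar>divpow \<gamma> x * (mpartial \<gamma> f (\<theta> *\<^sub>R x) - a \<gamma>) $ j\<bar> \<le> norm x ^ m * M"
        unfolding abs_mult using abs_divpow_le[of \<gamma> x] \<gamma> by (intro mult_mono) auto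
    qed
    finally show ?thesis by (simp add: mult_ac)
  qed
  then have "(\<Sum>j\<in>UNIV. \<bar>?R $ j\<bar>) \<le> (\<Sum>j\<in>(UNIV::'n set). real (card {\<gamma> :: nat^'n. mi_abs \<gamma> = m}) * M * norm x ^ m)"
    by (intro sum_mono) auto
  with norm_le_l1_cart[of ?R] show ?thesis by (simp add: mult_ac)
qed

lemma Lipschitz_ball:
  fixes f :: "real^'n \<Rightarrow> real^'n"
  assumes f: "Ck_open r V f" "open V" "1 \<le> r" and B: "ball 0 \<delta> \<subseteq> V"
    and M: "\<And>i x. x \<in> ball 0 \<delta> \<Longrightarrow> norm (pds [i] f x) \<le> M"
    and x: "x \<in> ball 0 \<delta>" and y: "y \<in> ball 0 \<delta>"
  shows "norm (f x - f y) \<le> real CARD('n) * M * norm (x - y)"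
proof (rule differentiable_bound[of "ball 0 \<delta>", OF convex_ball _ _ x y])
  fix z assume z: "z \<in> ball (0::real^'n) \<delta>"
  show "(f has_derivative (\<lambda>h. \<Sum>i\<in>UNIV. (h $ i) *\<^sub>R pds [i] f z)) (at z within ball 0 \<delta>)"
  proof (rule has_derivative_at_withinI)
    show "(f has_derivative (\<lambda>h. \<Sum>i\<in>UNIV. (h $ i) *\<^sub>R pds [i] f z)) (at z)"
      using Ck_open_has_derivative[OF f(1,2), of "[]" z] f(3) B z by auto
  qed
  show "onorm (\<lambda>h. \<Sum>i\<in>UNIV. (h $ i) *\<^sub>R pds [i] f z) \<le> real CARD('n) * M"
  proof (rule onorm_le)
    fix h :: "real^'n"
    have "norm (\<Sum>i\<in>UNIV. (h $ i) *\<^sub>R pds [i] f z) \<le> (\<Sum>i\<in>(UNIV::'n set). norm h * M)"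
    proof (rule sum_norm_le)
      fix i
      show "norm ((h $ i) *\<^sub>R pds [i] f z) \<le> norm h * M"
        unfolding norm_scaleR using component_le_norm_cart[of h i] M[OF z, of i]
        by (intro mult_mono) auto
    qed
    then show "norm (\<Sum>i\<in>UNIV. (h $ i) *\<^sub>R pds [i] f z) \<le> real CARD('n) * M * norm h" by (simp add: mult_ac)
  qed
qed

section \<open>Derivatives depending on a parameter\<close>

lemma has_vector_derivative_imp_quotient:
  assumes "(g has_vector_derivative D) (at 0)"
  shows "((\<lambda>h. (1 / h) *\<^sub>R (g h - g 0)) \<longlongrightarrow> D) (at 0)"
proof -
  have "((\<lambda>h. norm (g h - g 0 - h *\<^sub>R D) / norm h) \<longlongrightarrow> 0) (at 0)"
    using assms unfolding has_vector_derivative_def has_derivative_at by simp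
  then have "((\<lambda>h. norm ((1 / h) *\<^sub>R (g h - g 0) - D)) \<longlongrightarrow> 0) (at 0)"
  proof (rule Lim_transform_eventually)
    have "norm (g h - g 0 - h *\<^sub>R D) / norm h = norm ((1 / h) *\<^sub>R (g h - g 0) - D)" if "h \<noteq> 0" for h
    proof -
      have "(1 / h) *\<^sub>R (g h - g 0) - D = (1 / h) *\<^sub>R (g h - g 0 - h *\<^sub>R D)"
        using that by (simp add: scaleR_diff_right)
      then show ?thesis by simp
    qed
    then show "\<forall>\<^sub>F h in at 0. norm (g h - g 0 - h *\<^sub>R D) / norm h = norm ((1 / h) *\<^sub>R (g h - g 0) - D)"
      by (simp add: eventually_at_filter)
  qed
  then show ?thesis by (simp add: LIM_zero_iff tendsto_norm_zero_iff)
qed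

text \<open>Each spatial derivative is a sequential limit of difference quotients, which are
  measurable in time by induction on the list of directions.\<close>

lemma pds_measurable:
  assumes V: "open V" and f: "\<And>t. Ck_open r V (\<lambda>x. f x t)"
    and m: "\<And>x. x \<in> V \<Longrightarrow> (\<lambda>t. f x t) \<in> borel_measurable lebesgue"
  shows "length is \<le> r \<Longrightarrow> x \<in> V \<Longrightarrow> (\<lambda>t::real. pds is (\<lambda>x. f x t) x) \<in> borel_measurable lebesgue"
proof (induction "is" arbitrary: x)
  case Nil
  then show ?case using m by simp
next
  case (Cons i "is")
  obtain \<rho> where \<rho>: "\<rho> > 0" "\<And>y. dist y x < \<rho> \<Longrightarrow> y \<in> V"
    using V Cons.prems(2) unfolding open_dist by blast
  obtain n0 :: nat where n0: "1 / \<rho> < real n0" using reals_Archimedean2 by blast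
  \<comment> \<open>Starting beyond \<open>n0\<close> keeps every increment below \<rho>, so that
    all points of evaluation lie in \<open>V\<close>.\<close>
  define h where "h n = 1 / real (Suc n + n0)" for n
  have h0: "h n > 0" for n by (simp add: h_def)
  have h\<rho>: "h n < \<rho>" for n
  proof -
    have "1 / \<rho> < real (Suc n + n0)" using n0 by simp
    then show ?thesis using \<rho>(1) by (simp add: h_def field_simps)
  qed
  have "h \<longlonglongrightarrow> 0"
    unfolding h_def using LIMSEQ_ignore_initial_segment[OF LIMSEQ_Suc[OF lim_1_over_n], of n0]
    by (simp add: add.commute)
  then have hlim: "filterlim h (at 0) sequentially"
    using h0 by (intro filterlim_atI) (auto intro!: always_eventually simp: less_imp_neq[symmetric])
  have inV: "x + h n *\<^sub>R axis i 1 \<in> V" for n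
    using \<rho>(2)[of "x + h n *\<^sub>R axis i 1"] h\<rho>[of n] h0[of n] by (simp add: dist_norm)
  show ?case
  proof (rule borel_measurable_LIMSEQ_metric)
    show "(\<lambda>t. (1 / h n) *\<^sub>R (pds is (\<lambda>x. f x t) (x + h n *\<^sub>R axis i 1) - pds is (\<lambda>x. f x t) x)) \<in> borel_measurable lebesgue" for n
      using Cons.IH[OF _ inV[of n]] Cons.IH[of x] Cons.prems by (intro borel_measurable_scaleR borel_measurable_diff) auto
    fix t
    have "((\<lambda>h. pds is (\<lambda>x. f x t) (x + h *\<^sub>R axis i 1)) has_vector_derivative pds (i # is) (\<lambda>x. f x t) x) (at 0)"
      by (rule Ck_open_has_pd[OF f]) (use Cons.prems in auto)
    from has_vector_derivative_imp_quotient[OF this]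
    have "((\<lambda>h. (1 / h) *\<^sub>R (pds is (\<lambda>x. f x t) (x + h *\<^sub>R axis i 1) - pds is (\<lambda>x. f x t) x)) \<longlongrightarrow>
        pds (i # is) (\<lambda>x. f x t) x) (at 0)" by simp
    from filterlim_compose[OF this hlim]
    show "(\<lambda>n. (1 / h n) *\<^sub>R (pds is (\<lambda>x. f x t) (x + h n *\<^sub>R axis i 1) - pds is (\<lambda>x. f x t) x)) \<longlonglongrightarrow> pds (i # is) (\<lambda>x. f x t) x" .
  qed
qed

lemma pd_eqI: "((\<lambda>h. f (x + h *\<^sub>R axis i 1)) has_vector_derivative D) (at 0) \<Longrightarrow> pd i f x = D"
  unfolding pd_def by (rule vector_derivative_at)

lemma pds_scaled:
  assumes V: "open V" and f: "Ck_open r V f"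
  shows "length is \<le> r \<Longrightarrow> x \<in> V \<Longrightarrow> pds is (\<lambda>x. c *\<^sub>R f x) x = c *\<^sub>R pds is f x"
proof (induction "is" arbitrary: x)
  case (Cons i "is")
  have "pd i (pds is (\<lambda>x. c *\<^sub>R f x)) x = pd i (\<lambda>x. c *\<^sub>R pds is f x) x"
    by (rule pd_cong[OF V Cons.prems(2) Cons.IH]) (use Cons in auto)
  also have "\<dots> = c *\<^sub>R pds (i # is) f x"
  proof (rule pd_eqI)
    show "((\<lambda>h. c *\<^sub>R pds is f (x + h *\<^sub>R axis i 1)) has_vector_derivative c *\<^sub>R pds (i # is) f x) (at 0)"
      by (intro bounded_linear.has_vector_derivative[OF bounded_linear_scaleR_right] Ck_open_has_pd[OF f])
         (use Cons.prems in auto)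
  qed
  finally show ?case by simp
qed simp

lemma Ck_open_mono: "Ck_open r V f \<Longrightarrow> m \<le> r \<Longrightarrow> W \<subseteq> V \<Longrightarrow> Ck_open m W f"
  unfolding Ck_open_def by (meson continuous_on_subset le_trans less_le_trans subsetD)

section \<open>Taylor coefficients of curves\<close>

text \<open>Continuous differentiability up to order \<open>k\<close> with derivatives as
  existential witnesses. Closure properties then follow by plain induction;
  \<open>smooth_iterate\<close> identifies the witnesses with iterated
  \<open>vector_derivative\<close>.\<close>

primrec smooth :: "real set \<Rightarrow> nat \<Rightarrow> (real \<Rightarrow> 'a::real_normed_vector) \<Rightarrow> bool" where
  "smooth I 0 u \<longleftrightarrow> continuous_on I u"
| "smooth I (Suc k) u \<longleftrightarrow> (\<exists>u'. (\<forall>t\<in>I. (u has_vector_derivative u' t) (at t)) \<and> smooth I k u')"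

lemma smooth_add: "smooth I k u \<Longrightarrow> smooth I k w \<Longrightarrow> smooth I k (\<lambda>t. u t + w t)"
proof (induction k arbitrary: u w)
  case 0
  then show ?case by (auto intro: continuous_on_add)
next
  case (Suc k)
  then obtain u' w' where "\<forall>t\<in>I. (u has_vector_derivative u' t) (at t)" "smooth I k u'"
      "\<forall>t\<in>I. (w has_vector_derivative w' t) (at t)" "smooth I k w'" by auto
  then show ?case
    using Suc.IH[of u' w'] by (auto intro!: exI[of _ "\<lambda>t. u' t + w' t"] has_vector_derivative_add)
qed

lemma smooth_poly_scaleR: "smooth I k (\<lambda>t. poly Q t *\<^sub>R v)"
proof (induction k arbitrary: Q)
  case 0
  then show ?case by (auto intro!: continuous_intros)
next
  case (Suc k)
  have "((\<lambda>t. poly Q t *\<^sub>R v) has_vector_derivative poly Q t *\<^sub>R 0 + poly (pderiv Q) t *\<^sub>R v) (at t)" for t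
    by (rule has_vector_derivative_scaleR[OF poly_DERIV has_vector_derivative_const])
  then show ?case using Suc[of "pderiv Q"] by (auto intro!: exI[of _ "\<lambda>t. poly (pderiv Q) t *\<^sub>R v"])
qed

lemma smooth_sum:
  assumes "finite J" "\<And>j. j \<in> J \<Longrightarrow> smooth I k (u j)"
  shows "smooth I k (\<lambda>t. \<Sum>j\<in>J. u j t)"
  using assms
proof (induction J rule: finite_induct)
  case empty
  show ?case using smooth_poly_scaleR[of I k 0 0] by simp
next
  case (insert j J)
  then show ?case using smooth_add[of I k "u j" "\<lambda>t. \<Sum>j\<in>J. u j t"] by simp
qed

text \<open>Along a curve with polynomial velocity, the functions polynomial times partial
  derivative have derivatives that are sums of functions of the same kind. This closure carries the
  induction and explains the general \<open>Q\<close> and \<open>is\<close>.\<close>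

lemma smooth_compose:
  fixes f :: "real^'n \<Rightarrow> real^'n" and p q :: "real \<Rightarrow> real^'n"
  assumes f: "Ck_open r V f" "open V" and pV: "\<And>t. t \<in> I \<Longrightarrow> p t \<in> V"
    and p: "\<And>t. (p has_vector_derivative q t) (at t)" and q: "\<And>t i. q t $ i = poly (P i) t"
  shows "length is + k \<le> r \<Longrightarrow> smooth I k (\<lambda>t. poly Q t *\<^sub>R pds is f (p t))"
proof (induction k arbitrary: Q "is")
  case 0
  have "continuous_on I p"
    by (intro continuous_at_imp_continuous_on ballI has_vector_derivative_continuous[OF p])
  moreover have "continuous_on V (pds is f)" using Ck_open_continuous[OF f(1)] 0 by simp
  ultimately have "continuous_on I (\<lambda>t. pds is f (p t))"
    using continuous_on_compose2[of V "pds is f" I p] pV by blast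
  then show ?case by (auto intro!: continuous_intros)
next
  case (Suc k)
  let ?u' = "\<lambda>t. (\<Sum>i\<in>UNIV. poly (Q * P i) t *\<^sub>R pds (i # is) f (p t)) + poly (pderiv Q) t *\<^sub>R pds is f (p t)"
  have "((\<lambda>t. poly Q t *\<^sub>R pds is f (p t)) has_vector_derivative ?u' t) (at t)" if t: "t \<in> I" for t
  proof -
    have "(pds is f has_derivative (\<lambda>h. \<Sum>i\<in>UNIV. (h $ i) *\<^sub>R pds (i # is) f (p t))) (at (p t))"
      by (rule Ck_open_has_derivative[OF f]) (use Suc.prems pV[OF t] in auto)
    from vector_derivative_diff_chain_within[OF p has_derivative_at_withinI[OF this]]
    have "((\<lambda>t. pds is f (p t)) has_vector_derivative (\<Sum>i\<in>UNIV. (q t $ i) *\<^sub>R pds (i # is) f (p t))) (at t)"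
      by (simp add: o_def)
    from has_vector_derivative_scaleR[OF poly_DERIV this, of Q]
    show ?thesis by (simp add: q scaleR_sum_right del: foldr.simps)
  qed
  moreover have "smooth I k ?u'"
    by (intro smooth_add smooth_sum Suc.IH) (use Suc.prems in auto)
  ultimately show ?case by (auto simp del: foldr.simps intro!: exI[of _ ?u'])
qed

abbreviation vd :: "(real \<Rightarrow> 'a::real_normed_vector) \<Rightarrow> real \<Rightarrow> 'a" where
  "vd \<equiv> (\<lambda>u \<epsilon>. vector_derivative u (at \<epsilon>))"

lemma vd_iterate_cong:
  assumes "open I" "\<And>t. t \<in> I \<Longrightarrow> u t = w t"
  shows "t \<in> I \<Longrightarrow> (vd ^^ m) u t = (vd ^^ m) w t"
proof (induction m arbitrary: t)
  case (Suc m)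
  have "\<forall>\<^sub>F s in nhds t. s \<in> I" using assms(1) Suc.prems by (rule eventually_nhds_in_open)
  then have "\<forall>\<^sub>F s in nhds t. s \<in> UNIV \<longrightarrow> (vd ^^ m) u s = (vd ^^ m) w s"
    by eventually_elim (use Suc.IH in auto)
  then show ?case by (auto intro: vector_derivative_cong_eq)
qed (use assms in simp)

lemma smooth_iterate:
  assumes I: "open I"
  shows "smooth I k u \<Longrightarrow> (\<forall>m<k. \<forall>t\<in>I. ((vd ^^ m) u has_vector_derivative (vd ^^ Suc m) u t) (at t)) \<and>
    continuous_on I ((vd ^^ k) u)"
proof (induction k arbitrary: u)
  case (Suc k)
  then obtain u' where u': "\<And>t. t \<in> I \<Longrightarrow> (u has_vector_derivative u' t) (at t)" "smooth I k u'"
    unfolding smooth.simps by blast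
  have vd: "(vd ^^ Suc m) u t = (vd ^^ m) u' t" if "t \<in> I" for m t
    unfolding funpow_Suc_right o_def
    by (rule vd_iterate_cong[OF I _ that]) (rule vector_derivative_at[OF u'(1)])
  have "((vd ^^ m) u has_vector_derivative (vd ^^ Suc m) u t) (at t)" if m: "m < Suc k" and t: "t \<in> I" for m t
  proof (cases m)
    case 0
    then show ?thesis using u'(1)[OF t] vector_derivative_at[OF u'(1)[OF t]] by simp
  next
    case (Suc l)
    have "((vd ^^ l) u' has_vector_derivative (vd ^^ Suc l) u' t) (at t)"
      using Suc.IH[OF u'(2)] m t Suc by auto
    then have "((vd ^^ Suc l) u has_vector_derivative (vd ^^ Suc l) u' t) (at t)"
      by (rule has_vector_derivative_transform_within_open[OF _ I t]) (rule vd[symmetric])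
    then show ?thesis using vd[OF t, of "Suc l"] Suc by simp
  qed
  moreover have "continuous_on I ((vd ^^ Suc k) u)"
    by (rule iffD2[OF continuous_on_cong[OF refl vd]]) (use Suc.IH[OF u'(2)] in blast)+
  ultimately show ?case by blast
qed simp

text \<open>Lagrange's remainder evaluates the derivative of order \<open>N\<close> at an
  intermediate point; continuity at zero replaces that value by the true coefficient up to the
  required tolerance.\<close>

lemma smooth_Taylor:
  fixes u :: "real \<Rightarrow> real^'n"
  assumes I: "open I" "0 \<in> I" and u: "smooth I N u" and N: "0 < N" and e: "e > 0"
  obtains \<delta> where "\<delta> > 0"
    "\<And>\<epsilon>. 0 < \<epsilon> \<Longrightarrow> \<epsilon> < \<delta> \<Longrightarrow> norm (u \<epsilon> - (\<Sum>\<nu>\<le>N. \<epsilon> ^ \<nu> *\<^sub>R power_coeff \<nu> u)) \<le> e * \<epsilon> ^ N"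
proof -
  define D where "D m = (vd ^^ m) u" for m
  have D: "(D m has_vector_derivative D (Suc m) t) (at t)" if "m < N" "t \<in> I" for m t
    using smooth_iterate[OF I(1) u] that by (auto simp: D_def)
  have cont: "continuous_on I (D N)" using smooth_iterate[OF I(1) u] by (simp add: D_def)
  define \<eta> where "\<eta> = e / real CARD('n)"
  have \<eta>: "\<eta> > 0" using e by (simp add: \<eta>_def)
  have "isCont (D N) 0" using cont I by (simp add: continuous_on_eq_continuous_at)
  then obtain \<delta>1 where \<delta>1: "\<delta>1 > 0" "\<And>t. dist t 0 < \<delta>1 \<Longrightarrow> dist (D N t) (D N 0) < \<eta>"
    using \<eta> unfolding continuous_at_eps_delta by blast
  obtain \<delta>2 where \<delta>2: "\<delta>2 > 0" "\<And>t. dist t 0 < \<delta>2 \<Longrightarrow> t \<in> I"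
    using I unfolding open_dist by blast
  show ?thesis
  proof (rule that[of "min \<delta>1 \<delta>2"])
    show "min \<delta>1 \<delta>2 > 0" using \<delta>1 \<delta>2 by simp
    fix \<epsilon> :: real assume \<epsilon>: "0 < \<epsilon>" "\<epsilon> < min \<delta>1 \<delta>2"
    let ?R = "u \<epsilon> - (\<Sum>\<nu>\<le>N. \<epsilon> ^ \<nu> *\<^sub>R power_coeff \<nu> u)"
    have "\<bar>?R $ j\<bar> \<le> \<eta> * \<epsilon> ^ N" for j
    proof -
      have "DERIV (\<lambda>t. D m t $ j) t :> D (Suc m) t $ j" if "m < N" "0 \<le> t" "t \<le> \<epsilon>" for m t
        unfolding has_real_derivative_iff_has_vector_derivative
        by (rule bounded_linear.has_vector_derivative[OF bounded_linear_vec_nth D])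
           (use that \<epsilon> in \<open>auto intro!: \<delta>2(2)\<close>)
      then obtain \<theta> where \<theta>: "0 < \<theta>" "\<theta> < \<epsilon>"
          "u \<epsilon> $ j = (\<Sum>m<N. D m 0 $ j / fact m * \<epsilon> ^ m) + D N \<theta> $ j / fact N * \<epsilon> ^ N"
        using Maclaurin[of \<epsilon> N "\<lambda>m t. D m t $ j" "\<lambda>t. u t $ j"] \<epsilon>(1) N by (auto simp: D_def)
      have "(\<Sum>\<nu>\<le>N. \<epsilon> ^ \<nu> *\<^sub>R power_coeff \<nu> u) $ j = (\<Sum>\<nu>\<le>N. D \<nu> 0 $ j / fact \<nu> * \<epsilon> ^ \<nu>)"
        by (simp add: power_coeff_def D_def mult.commute)
      also have "\<dots> = (\<Sum>m<N. D m 0 $ j / fact m * \<epsilon> ^ m) + D N 0 $ j / fact N * \<epsilon> ^ N"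
        by (simp add: lessThan_Suc_atMost[symmetric])
      finally have "?R $ j = (D N \<theta> - D N 0) $ j / fact N * \<epsilon> ^ N"
        using \<theta>(3) by (simp add: algebra_simps diff_divide_distrib)
      also have "\<bar>\<dots>\<bar> = \<bar>(D N \<theta> - D N 0) $ j\<bar> / fact N * \<epsilon> ^ N"
        using \<epsilon> by (simp add: abs_mult)
      also have "\<dots> \<le> \<eta> * \<epsilon> ^ N"
      proof (rule mult_right_mono)
        have "\<bar>(D N \<theta> - D N 0) $ j\<bar> \<le> \<eta>"
          using order_trans[OF component_le_norm_cart[of "D N \<theta> - D N 0" j]] \<delta>1(2)[of \<theta>] \<theta> \<epsilon>
          by (auto simp: dist_norm)
        moreover have "\<bar>(D N \<theta> - D N 0) $ j\<bar> / fact N \<le> \<bar>(D N \<theta> - D N 0) $ j\<bar> / 1"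
          by (intro divide_left_mono fact_ge_1) auto
        ultimately show "\<bar>(D N \<theta> - D N 0) $ j\<bar> / fact N \<le> \<eta>" by simp
      qed (use \<epsilon> in simp)
      finally show ?thesis .
    qed
    then have "(\<Sum>j\<in>UNIV. \<bar>?R $ j\<bar>) \<le> (\<Sum>j\<in>(UNIV::'n set). \<eta> * \<epsilon> ^ N)"
      by (intro sum_mono) auto
    also have "\<dots> = e * \<epsilon> ^ N" by (simp add: \<eta>_def)
    finally show "norm ?R \<le> e * \<epsilon> ^ N" using norm_le_l1_cart[of ?R] by (rule order_trans[rotated])
  qed
qed

section \<open>Uniqueness of asymptotic polynomials\<close>

lemma small_polynomial_constant_zero:
  fixes a :: "nat \<Rightarrow> 'a::real_normed_vector"
  assumes small: "\<And>e. e > 0 \<Longrightarrow>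
      \<exists>\<delta>>0. \<forall>\<epsilon>. 0 < \<epsilon> \<and> \<epsilon> < \<delta> \<longrightarrow> norm (\<Sum>\<nu>\<le>N. \<epsilon> ^ \<nu> *\<^sub>R a \<nu>) \<le> e * \<epsilon> ^ N"
  shows "a 0 = 0"
proof -
  have "((\<lambda>\<epsilon>. norm (\<Sum>\<nu>\<le>N. \<epsilon> ^ \<nu> *\<^sub>R a \<nu>)) \<longlongrightarrow> norm (\<Sum>\<nu>\<le>N. 0 ^ \<nu> *\<^sub>R a \<nu>)) (at_right (0::real))"
    by (intro tendsto_intros)
  moreover have "(\<Sum>\<nu>\<le>N. (0::real) ^ \<nu> *\<^sub>R a \<nu>) = a 0"
    by (subst sum.mono_neutral_right[of "{..N}" "{0}"]) auto
  ultimately have lim: "((\<lambda>\<epsilon>. norm (\<Sum>\<nu>\<le>N. \<epsilon> ^ \<nu> *\<^sub>R a \<nu>)) \<longlongrightarrow> norm (a 0)) (at_right 0)" by simp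
  have le: "norm (a 0) \<le> e" if e: "e > 0" for e
  proof -
    obtain \<delta> where \<delta>: "\<delta> > 0" "\<And>\<epsilon>. 0 < \<epsilon> \<Longrightarrow> \<epsilon> < \<delta> \<Longrightarrow> norm (\<Sum>\<nu>\<le>N. \<epsilon> ^ \<nu> *\<^sub>R a \<nu>) \<le> e * \<epsilon> ^ N"
      using small[OF e] by blast
    have "\<forall>\<^sub>F \<epsilon> in at_right 0. \<epsilon> \<in> {0<..<min \<delta> 1}"
      using \<delta>(1) by (intro eventually_at_right_real) auto
    then have "\<forall>\<^sub>F \<epsilon> in at_right 0. norm (\<Sum>\<nu>\<le>N. \<epsilon> ^ \<nu> *\<^sub>R a \<nu>) \<le> e"
    proof eventually_elim
      case (elim \<epsilon>)
      then have "e * \<epsilon> ^ N \<le> e * 1" using e by (intro mult_left_mono power_le_one) auto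
      with \<delta>(2)[of \<epsilon>] elim show ?case by simp
    qed
    then show ?thesis by (intro tendsto_upperbound[OF lim]) auto
  qed
  have "norm (a 0) \<le> 0" by (rule field_le_epsilon) (simp add: le)
  then show ?thesis by simp
qed

text \<open>Once the constant coefficient is known to vanish, one factor \<epsilon> can be divided
  out, which lowers both the degree and the order of smallness by one.\<close>

lemma small_polynomial_zero:
  fixes a :: "nat \<Rightarrow> 'a::real_normed_vector"
  assumes "\<And>e. e > 0 \<Longrightarrow> \<exists>\<delta>>0. \<forall>\<epsilon>. 0 < \<epsilon> \<and> \<epsilon> < \<delta> \<longrightarrow> norm (\<Sum>\<nu>\<le>N. \<epsilon> ^ \<nu> *\<^sub>R a \<nu>) \<le> e * \<epsilon> ^ N"
    and "\<nu> \<le> N"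
  shows "a \<nu> = 0"
  using assms
proof (induction N arbitrary: a \<nu>)
  case 0
  have "a 0 = 0" by (rule small_polynomial_constant_zero[OF 0(1)])
  with 0(2) show ?case by simp
next
  case (Suc N)
  have z: "a 0 = 0" by (rule small_polynomial_constant_zero[OF Suc.prems(1)])
  show ?case
  proof (cases \<nu>)
    case 0
    then show ?thesis using z by simp
  next
    case (Suc m)
    have "a (Suc m) = 0"
    proof (rule Suc.IH[of "\<lambda>\<nu>. a (Suc \<nu>)"])
      fix e :: real assume "e > 0"
      from Suc.prems(1)[OF this] obtain \<delta> where \<delta>: "\<delta> > 0"
        "\<And>\<epsilon>. 0 < \<epsilon> \<Longrightarrow> \<epsilon> < \<delta> \<Longrightarrow> norm (\<Sum>\<nu>\<le>Suc N. \<epsilon> ^ \<nu> *\<^sub>R a \<nu>) \<le> e * \<epsilon> ^ Suc N" by blast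
      have "norm (\<Sum>\<nu>\<le>N. \<epsilon> ^ \<nu> *\<^sub>R a (Suc \<nu>)) \<le> e * \<epsilon> ^ N" if \<epsilon>: "0 < \<epsilon>" "\<epsilon> < \<delta>" for \<epsilon>
      proof -
        have "(\<Sum>\<nu>\<le>Suc N. \<epsilon> ^ \<nu> *\<^sub>R a \<nu>) = \<epsilon> *\<^sub>R (\<Sum>\<nu>\<le>N. \<epsilon> ^ \<nu> *\<^sub>R a (Suc \<nu>))"
          unfolding sum.atMost_Suc_shift by (simp add: z scaleR_sum_right)
        with \<delta>(2)[OF \<epsilon>] have "\<epsilon> * norm (\<Sum>\<nu>\<le>N. \<epsilon> ^ \<nu> *\<^sub>R a (Suc \<nu>)) \<le> \<epsilon> * (e * \<epsilon> ^ N)"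
          using \<epsilon> by (simp add: mult_ac)
        then show ?thesis using \<epsilon> by simp
      qed
      with \<delta>(1) show "\<exists>\<delta>>0. \<forall>\<epsilon>. 0 < \<epsilon> \<and> \<epsilon> < \<delta> \<longrightarrow> norm (\<Sum>\<nu>\<le>N. \<epsilon> ^ \<nu> *\<^sub>R a (Suc \<nu>)) \<le> e * \<epsilon> ^ N" by blast
    qed (use Suc.prems(2) Suc in simp)
    then show ?thesis using Suc by simp
  qed
qed

text \<open>Identifies Taylor coefficients without computing a derivative: two polynomials that
  approximate \<open>u\<close> to order \<open>o(\<epsilon>^N)\<close> coincide. Positive \<epsilon>
  suffice for the comparison.\<close>

lemma power_coeff_eqI:
  fixes u :: "real \<Rightarrow> real^'n"
  assumes I: "open I" "0 \<in> I" and u: "smooth I N u" and N: "0 < N" and \<nu>: "\<nu> \<le> N"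
    and c: "\<And>e. e > 0 \<Longrightarrow> \<exists>\<delta>>0. \<forall>\<epsilon>. 0 < \<epsilon> \<and> \<epsilon> < \<delta> \<longrightarrow> norm (u \<epsilon> - (\<Sum>\<nu>\<le>N. \<epsilon> ^ \<nu> *\<^sub>R c \<nu>)) \<le> e * \<epsilon> ^ N"
  shows "power_coeff \<nu> u = c \<nu>"
proof -
  have "power_coeff \<nu> u - c \<nu> = 0"
  proof (rule small_polynomial_zero[OF _ \<nu>])
    fix e :: real assume e: "e > 0"
    obtain \<delta>1 where \<delta>1: "\<delta>1 > 0" "\<And>\<epsilon>. 0 < \<epsilon> \<Longrightarrow> \<epsilon> < \<delta>1 \<Longrightarrow>
        norm (u \<epsilon> - (\<Sum>\<nu>\<le>N. \<epsilon> ^ \<nu> *\<^sub>R power_coeff \<nu> u)) \<le> e / 2 * \<epsilon> ^ N"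
      using smooth_Taylor[OF I u N half_gt_zero[OF e]] by blast
    obtain \<delta>2 where \<delta>2: "\<delta>2 > 0" "\<And>\<epsilon>. 0 < \<epsilon> \<Longrightarrow> \<epsilon> < \<delta>2 \<Longrightarrow>
        norm (u \<epsilon> - (\<Sum>\<nu>\<le>N. \<epsilon> ^ \<nu> *\<^sub>R c \<nu>)) \<le> e / 2 * \<epsilon> ^ N"
      using c[OF half_gt_zero[OF e]] by blast
    have "norm (\<Sum>\<nu>\<le>N. \<epsilon> ^ \<nu> *\<^sub>R (power_coeff \<nu> u - c \<nu>)) \<le> e * \<epsilon> ^ N"
      if \<epsilon>: "0 < \<epsilon>" "\<epsilon> < min \<delta>1 \<delta>2" for \<epsilon>
    proof -
      have "(\<Sum>\<nu>\<le>N. \<epsilon> ^ \<nu> *\<^sub>R (power_coeff \<nu> u - c \<nu>)) =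
          (u \<epsilon> - (\<Sum>\<nu>\<le>N. \<epsilon> ^ \<nu> *\<^sub>R c \<nu>)) - (u \<epsilon> - (\<Sum>\<nu>\<le>N. \<epsilon> ^ \<nu> *\<^sub>R power_coeff \<nu> u))"
        by (simp add: scaleR_diff_right sum_subtractf)
      also have "norm \<dots> \<le> e / 2 * \<epsilon> ^ N + e / 2 * \<epsilon> ^ N"
        by (rule order_trans[OF norm_triangle_ineq4 add_mono]) (use \<delta>1 \<delta>2 \<epsilon> in auto)
      finally show ?thesis by simp
    qed
    then show "\<exists>\<delta>>0. \<forall>\<epsilon>. 0 < \<epsilon> \<and> \<epsilon> < \<delta> \<longrightarrow> norm (\<Sum>\<nu>\<le>N. \<epsilon> ^ \<nu> *\<^sub>R (power_coeff \<nu> u - c \<nu>)) \<le> e * \<epsilon> ^ N"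
      using \<delta>1(1) \<delta>2(1) by (intro exI[of _ "min \<delta>1 \<delta>2"]) auto
  qed
  then show ?thesis by simp
qed

section \<open>Powers of a power series\<close>

lemma finite_mi_pairs: "finite {(a, k :: nat^'n). a + k = \<gamma>}"
proof (rule finite_subset)
  show "{(a, k). a + k = \<gamma>} \<subseteq> {a. mi_abs a \<le> mi_abs \<gamma>} \<times> {k. mi_abs k \<le> mi_abs \<gamma>}"
    by (auto simp: mi_abs_add)
qed (intro finite_cartesian_product finite_mi_abs_le)

text \<open>The product over coordinates of the one-variable binomial formulas. Choosing a summand
  in each coordinate amounts to choosing the multi-index \<open>k\<close>, with \<gamma> -
  \<open>k\<close> left for the other argument.\<close>

lemma divpow_add: "divpow \<gamma> (u + v) = (\<Sum>(a, k) | a + k = \<gamma>. divpow a u * divpow k v)"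
proof -
  define B where "B i j = (u $ i) ^ (\<gamma> $ i - j) / fact (\<gamma> $ i - j) * ((v $ i) ^ j / fact j)" for i j
  have bin: "((u + v) $ i) ^ (\<gamma> $ i) / fact (\<gamma> $ i) = (\<Sum>j\<le>\<gamma> $ i. B i j)" for i
  proof -
    have "((u + v) $ i) ^ (\<gamma> $ i) = (\<Sum>j\<le>\<gamma> $ i. of_nat (\<gamma> $ i choose j) * (v $ i) ^ j * (u $ i) ^ (\<gamma> $ i - j))"
      by (simp add: add.commute[of "u $ i"] binomial_ring)
    also have "\<dots> = (\<Sum>j\<le>\<gamma> $ i. fact (\<gamma> $ i) * B i j)"
      by (rule sum.cong) (auto simp: B_def binomial_fact field_simps)
    finally show ?thesis by (simp add: sum_distrib_left[symmetric])
  qed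
  have "divpow \<gamma> (u + v) = (\<Prod>i\<in>UNIV. \<Sum>j\<le>\<gamma> $ i. B i j)"
    unfolding divpow_def prod_dividef[symmetric] bin ..
  also have "\<dots> = (\<Sum>g\<in>PiE UNIV (\<lambda>i. {..\<gamma> $ i}). \<Prod>i\<in>UNIV. B i (g i))"
    by (rule prod_sum_PiE) auto
  also have "\<dots> = (\<Sum>(a, k) | a + k = \<gamma>. divpow a u * divpow k v)"
  proof (rule sum.reindex_bij_witness[of _ "\<lambda>(a, k) i. k $ i" "\<lambda>g. (\<gamma> - (\<chi> i. g i), \<chi> i. g i)"])
    fix g assume g: "g \<in> PiE UNIV (\<lambda>i. {..\<gamma> $ i})"
    then have le: "g i \<le> \<gamma> $ i" for i by auto
    then show "(\<gamma> - (\<chi> i. g i), \<chi> i. g i) \<in> {(a, k). a + k = \<gamma>}" by (simp add: vec_eq_iff)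
    show "(case (\<gamma> - (\<chi> i. g i), \<chi> i. g i) of (a, k) \<Rightarrow> divpow a u * divpow k v) = (\<Prod>i\<in>UNIV. B i (g i))"
      by (simp add: divpow_def B_def prod.distrib prod_dividef)
  next
    fix p assume "p \<in> {(a, k). a + k = \<gamma>}"
    then obtain a k where p: "p = (a, k)" and \<gamma>: "\<gamma> = a + k" by auto
    show "(case p of (a, k) \<Rightarrow> \<lambda>i. k $ i) \<in> PiE UNIV (\<lambda>i. {..\<gamma> $ i})" by (auto simp: p \<gamma> PiE_iff)
    show "(\<gamma> - (\<chi> i. (case p of (a, k) \<Rightarrow> \<lambda>i. k $ i) i), \<chi> i. (case p of (a, k) \<Rightarrow> \<lambda>i. k $ i) i) = p"
      by (simp add: p \<gamma>)
  qed auto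
  finally show ?thesis .
qed

text \<open>Encodes the ways to distribute \<gamma> over the levels \<open>1, ..., L\<close>: levels
  that receive a nonzero multi-index are listed in increasing order, the others are omitted. These
  are the members of \<open>p_set\<close> of all lengths and weights with levels up to
  \<open>L\<close>.\<close>

definition chain_lists :: "nat \<Rightarrow> nat^'n \<Rightarrow> ((nat^'n) list \<times> nat list) set" where
  "chain_lists L \<gamma> = {(ks, ls). length ks = length ls \<and> 0 \<notin> set ks \<and> 0 \<notin> set ls \<and> sorted_wrt (<) ls \<and>
     set ls \<subseteq> {..L} \<and> sum_list ks = \<gamma>}"

text \<open>The power of \<epsilon> carried by a term when level \<open>l\<close> is scaled by
  \<open>\<epsilon> ^ l\<close>.\<close>

definition weight :: "(nat^'n) list \<Rightarrow> nat list \<Rightarrow> nat" where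
  "weight ks ls = (\<Sum>j<length ls. mi_abs (ks ! j) * ls ! j)"

lemma mi_abs_sum: "mi_abs (\<Sum>j\<in>J. k j) = (\<Sum>j\<in>J. mi_abs (k j))"
  unfolding mi_abs_def sum_component by (rule sum.swap)

lemma p_set_iff: "(ks, ls) \<in> p_set s \<nu> \<gamma> \<longleftrightarrow> length ls = s \<and> weight ks ls = \<nu> \<and> length ks = length ls \<and>
    0 \<notin> set ks \<and> 0 \<notin> set ls \<and> sorted_wrt (<) ls \<and> sum_list ks = \<gamma>"
  by (auto simp: p_set_def weight_def sum_list_sum_nth atLeast0LessThan in_set_conv_nth)

lemma p_set_bounds:
  assumes "(ks, ls) \<in> p_set s \<nu> \<gamma>"
  shows "s \<le> mi_abs \<gamma>" "mi_abs \<gamma> \<le> \<nu>" "set ls \<subseteq> {..\<nu>}"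
proof -
  have p: "\<gamma> = (\<Sum>j<s. ks ! j)" "\<nu> = (\<Sum>j<s. mi_abs (ks ! j) * ls ! j)" "length ls = s" "length ks = s"
    and pos: "\<And>j. j < s \<Longrightarrow> ks ! j \<noteq> 0" "\<And>j. j < s \<Longrightarrow> 1 \<le> ls ! j"
    using assms by (auto simp: p_set_def Suc_le_eq)
  have nz: "1 \<le> mi_abs (ks ! j)" "1 \<le> ls ! j" if "j < s" for j
    using pos[OF that] mi_abs_eq_0_iff[of "ks ! j"] by (simp_all del: mi_abs_eq_0_iff)
  have "(\<Sum>j<s. 1) \<le> (\<Sum>j<s. mi_abs (ks ! j))" using nz by (intro sum_mono) auto
  then show "s \<le> mi_abs \<gamma>" unfolding p(1) mi_abs_sum by simp
  show "mi_abs \<gamma> \<le> \<nu>"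
    unfolding p(1,2) mi_abs_sum using nz(2) by (intro sum_mono) auto
  show "set ls \<subseteq> {..\<nu>}"
  proof
    fix l assume "l \<in> set ls"
    then obtain j where j: "j < s" "l = ls ! j" using p(3) by (metis in_set_conv_nth)
    have "l \<le> mi_abs (ks ! j) * ls ! j" using nz(1)[OF j(1)] j(2) by simp
    also have "\<dots> \<le> \<nu>" unfolding p(2) using j by (intro member_le_sum) auto
    finally show "l \<in> {..\<nu>}" by simp
  qed
qed

lemma finite_chain_lists: "finite (chain_lists L \<gamma>)"
proof -
  have "chain_lists L \<gamma> \<subseteq> (\<Union>s\<le>mi_abs \<gamma>. \<Union>\<nu>\<le>L * mi_abs \<gamma>. p_set s \<nu> \<gamma>)"
  proof clarify
    fix ks ls assume c: "(ks, ls) \<in> chain_lists L \<gamma>"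
    then have p: "(ks, ls) \<in> p_set (length ls) (weight ks ls) \<gamma>" by (auto simp: chain_lists_def p_set_iff)
    have "weight ks ls \<le> (\<Sum>j<length ls. mi_abs (ks ! j) * L)"
      unfolding weight_def using c by (intro sum_mono mult_left_mono) (auto simp: chain_lists_def subset_iff)
    also have "\<dots> = L * mi_abs (\<Sum>j<length ls. ks ! j)"
      by (simp add: mi_abs_sum sum_distrib_left mult.commute)
    also have "(\<Sum>j<length ls. ks ! j) = \<gamma>" using p by (simp add: p_set_def)
    finally show "(ks, ls) \<in> (\<Union>s\<le>mi_abs \<gamma>. \<Union>\<nu>\<le>L * mi_abs \<gamma>. p_set s \<nu> \<gamma>)"
      using p p_set_bounds(1)[OF p] by blast
  qed
  then show ?thesis by (rule finite_subset) (auto intro: finite_p_set)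
qed

lemma chain_factor_divpow: "chain_factor s ks ls y = (\<Prod>j<s. divpow (ks ! j) (y (ls ! j)))"
  by (simp add: chain_factor_def divpow_def)

lemma chain_factor_snoc:
  assumes "length ks = length ls"
  shows "chain_factor (Suc (length ls)) (ks @ [k]) (ls @ [l]) y = chain_factor (length ls) ks ls y * divpow k (y l)"
  using assms by (simp add: chain_factor_divpow nth_append)

lemma divpow_zero: "divpow \<gamma> 0 = (if \<gamma> = 0 then 1 else 0)"
proof (cases "\<gamma> = 0")
  case False
  then obtain i where "\<gamma> $ i \<noteq> 0" by (auto simp: vec_eq_iff)
  then have "(\<Prod>i\<in>UNIV. (0::real^'a) $ i ^ (\<gamma> $ i)) = 0" by (intro prod_zero) auto
  then show ?thesis using False by (simp add: divpow_def)
qed simp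

text \<open>Induction on the number of levels: the binomial formula splits off the top level, which
  is listed precisely when its share of \<gamma> is nonzero.\<close>

lemma divpow_sum:
  "divpow \<gamma> (\<Sum>l=1..L. y l) = (\<Sum>(ks, ls)\<in>chain_lists L \<gamma>. chain_factor (length ls) ks ls y)"
proof (induction L arbitrary: \<gamma>)
  case 0
  have "chain_lists 0 \<gamma> = (if \<gamma> = 0 then {([], [])} else {})"
  proof -
    have nil: "ls = []" if "0 \<notin> set ls" "set ls \<subseteq> {..0}" for ls :: "nat list"
      using that by (cases ls) auto
    have "(ks, ls) \<in> chain_lists 0 \<gamma> \<longleftrightarrow> \<gamma> = 0 \<and> ks = [] \<and> ls = []" for ks ls
      using nil[of ls] by (auto simp: chain_lists_def)
    then show ?thesis by auto
  qed
  then show ?case by (simp add: divpow_zero chain_factor_def)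
next
  case (Suc L)
  \<comment> \<open>\<open>F\<close> appends the top level with its share \<open>k\<close>, or
    nothing if \<open>k\<close> is zero. Its inverse \<open>G\<close> recognizes the first case by
    the last level, since \<open>Suc L\<close> does not occur in chains with levels up to
    \<open>L\<close>.\<close>
  define F where "F = (\<lambda>((a :: nat^'a, k :: nat^'a), ks, ls). if k = 0 then (ks, ls) else (ks @ [k], ls @ [Suc L]))"
  define G where "G = (\<lambda>(ks, ls). if ls \<noteq> [] \<and> last ls = Suc L
    then ((sum_list (butlast ks), last ks), butlast ks, butlast ls) else ((\<gamma>, 0), ks, ls))"
  have split: "(\<Sum>l=1..Suc L. y l) = (\<Sum>l=1..L. y l) + y (Suc L)" by simp
  have "divpow \<gamma> (\<Sum>l=1..Suc L. y l) =
      (\<Sum>(a, k) | a + k = \<gamma>. (\<Sum>(ks, ls)\<in>chain_lists L a. chain_factor (length ls) ks ls y) * divpow k (y (Suc L)))"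
    unfolding split divpow_add Suc.IH ..
  also have "\<dots> = (\<Sum>p\<in>{(a, k). a + k = \<gamma>}. \<Sum>(ks, ls)\<in>chain_lists L (fst p).
      chain_factor (length ls) ks ls y * divpow (snd p) (y (Suc L)))"
    by (rule sum.cong) (auto simp: sum_distrib_right case_prod_beta)
  also have "\<dots> = (\<Sum>(p, ks, ls)\<in>Sigma {(a, k). a + k = \<gamma>} (\<lambda>p. chain_lists L (fst p)).
      chain_factor (length ls) ks ls y * divpow (snd p) (y (Suc L)))"
    by (rule sum.Sigma) (auto intro: finite_mi_pairs finite_chain_lists)
  also have "\<dots> = (\<Sum>(ks, ls)\<in>chain_lists (Suc L) \<gamma>. chain_factor (length ls) ks ls y)"
  proof (rule sum.reindex_bij_witness[of _ G F])
    fix q assume q: "q \<in> Sigma {(a, k). a + k = \<gamma>} (\<lambda>p. chain_lists L (fst p))"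
    then obtain a k ks ls where qe: "q = ((a, k), ks, ls)" and ak: "a + k = \<gamma>" and c: "(ks, ls) \<in> chain_lists L a"
      by auto
    have nl: "Suc L \<notin> set ls" using c by (auto simp: chain_lists_def)
    have sl: "sum_list ks = a" and len: "length ks = length ls" using c by (auto simp: chain_lists_def)
    show "G (F q) = q"
    proof (cases "k = 0")
      case True
      then have "last ls \<noteq> Suc L" if "ls \<noteq> []" using nl that last_in_set by metis
      then show ?thesis using True ak by (auto simp: F_def G_def qe)
    next
      case False
      then show ?thesis using sl by (simp add: F_def G_def qe)
    qed
    show "F q \<in> chain_lists (Suc L) \<gamma>"
      using c ak by (auto simp: F_def qe chain_lists_def sorted_wrt_append less_Suc_eq_le)
    show "(case F q of (ks, ls) \<Rightarrow> chain_factor (length ls) ks ls y) =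
        (case q of (p, ks, ls) \<Rightarrow> chain_factor (length ls) ks ls y * divpow (snd p) (y (Suc L)))"
      using chain_factor_snoc[OF len] by (auto simp: F_def qe)
  next
    fix q assume q: "q \<in> chain_lists (Suc L) \<gamma>"
    obtain ks ls where qe: "q = (ks, ls)" by (cases q)
    have c: "length ks = length ls" "0 \<notin> set ks" "0 \<notin> set ls" "sorted_wrt (<) ls" "set ls \<subseteq> {..Suc L}" "sum_list ks = \<gamma>"
      using q by (auto simp: qe chain_lists_def)
    have "F (G q) = q \<and> G q \<in> Sigma {(a, k). a + k = \<gamma>} (\<lambda>p. chain_lists L (fst p))"
    proof (cases "ls \<noteq> [] \<and> last ls = Suc L")
      case True
      then obtain ls' where ls: "ls = ls' @ [Suc L]" by (metis append_butlast_last_id)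
      with c(1) obtain ks' k where ks: "ks = ks' @ [k]" by (cases ks rule: rev_cases) auto
      have "set ls' \<subseteq> {..L}" using c(4) by (auto simp: ls sorted_wrt_append less_Suc_eq_le)
      then show ?thesis
        using c True by (auto simp: F_def G_def qe ls ks chain_lists_def sorted_wrt_append)
    next
      case False
      have "set ls \<subseteq> {..L}"
      proof (cases ls rule: rev_cases)
        case (snoc ls' l)
        then have "l \<le> L" using False c(5) by auto
        then show ?thesis using c(4) by (force simp: snoc sorted_wrt_append)
      qed simp
      then show ?thesis using c False by (auto simp: F_def G_def qe chain_lists_def)
    qed
    then show "F (G q) = q" "G q \<in> Sigma {(a, k). a + k = \<gamma>} (\<lambda>p. chain_lists L (fst p))" by simp_all
  qed
  finally show ?case .
qed

lemma chain_factor_scale: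
  "chain_factor (length ls) ks ls (\<lambda>l. \<epsilon> ^ l *\<^sub>R y l) = \<epsilon> ^ weight ks ls * chain_factor (length ls) ks ls y"
proof -
  have "divpow k (\<epsilon> ^ l *\<^sub>R x) = \<epsilon> ^ (mi_abs k * l) * divpow k x" for k :: "nat^'a" and l x
  proof -
    have "(\<Prod>i\<in>UNIV. ((\<epsilon> ^ l *\<^sub>R x) $ i) ^ (k $ i)) = (\<Prod>i\<in>UNIV. \<epsilon> ^ (l * k $ i)) * (\<Prod>i\<in>UNIV. (x $ i) ^ (k $ i))"
      by (simp add: prod.distrib power_mult_distrib power_mult)
    also have "(\<Prod>i\<in>UNIV. \<epsilon> ^ (l * k $ i)) = \<epsilon> ^ (mi_abs k * l)"
      by (simp add: power_sum[symmetric] mi_abs_def sum_distrib_left mult.commute)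
    finally show ?thesis by (simp add: divpow_def)
  qed
  then show ?thesis by (simp add: chain_factor_divpow prod.distrib weight_def power_sum)
qed

lemma abs_chain_factor_le:
  assumes "\<And>l. l \<in> set ls \<Longrightarrow> norm (y l) \<le> C" "1 \<le> C" "length ks = length ls"
  shows "\<bar>chain_factor (length ls) ks ls y\<bar> \<le> C ^ mi_abs (sum_list ks)"
proof -
  have "\<bar>chain_factor (length ls) ks ls y\<bar> = (\<Prod>j<length ls. \<bar>divpow (ks ! j) (y (ls ! j))\<bar>)"
    by (simp add: chain_factor_divpow abs_prod)
  also have "\<dots> \<le> (\<Prod>j<length ls. C ^ mi_abs (ks ! j))"
  proof (rule prod_mono, intro conjI)
    fix j assume "j \<in> {..<length ls}"
    then have "norm (y (ls ! j)) \<le> C" using assms(1) by simp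
    then show "\<bar>divpow (ks ! j) (y (ls ! j))\<bar> \<le> C ^ mi_abs (ks ! j)"
      by (intro order_trans[OF abs_divpow_le power_mono]) auto
  qed simp
  also have "\<dots> = C ^ mi_abs (sum_list ks)"
    using assms(3) by (simp add: power_sum[symmetric] sum_list_sum_nth atLeast0LessThan mi_abs_sum)
  finally show ?thesis .
qed

text \<open>The coefficient of \<open>\<epsilon> ^ \<nu>\<close> in \<open>divpow \<gamma>\<close>
  of the sum of \<open>\<epsilon> ^ l *\<^sub>R y l\<close>. The length \<open>s\<close> starts at
  zero so that the empty chain gives the value one for \<gamma> and \<nu> equal to zero.\<close>

definition chain_coeff :: "nat \<Rightarrow> nat^'n \<Rightarrow> (nat \<Rightarrow> real^'n) \<Rightarrow> real" where
  "chain_coeff \<nu> \<gamma> y = (\<Sum>s\<le>\<nu>. \<Sum>(ks, ls)\<in>p_set s \<nu> \<gamma>. chain_factor s ks ls y)"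

lemma chain_coeff_eq_0: "\<nu> < mi_abs \<gamma> \<Longrightarrow> chain_coeff \<nu> \<gamma> y = 0"
  unfolding chain_coeff_def by (intro sum.neutral ballI) (use p_set_bounds(2) in fastforce)

lemma chain_coeff_chains:
  assumes "\<nu> \<le> L"
  shows "(\<Sum>(ks, ls) | (ks, ls) \<in> chain_lists L \<gamma> \<and> weight ks ls = \<nu>. chain_factor (length ls) ks ls y) = chain_coeff \<nu> \<gamma> y"
proof -
  have "{(ks, ls). (ks, ls) \<in> chain_lists L \<gamma> \<and> weight ks ls = \<nu>} = (\<Union>s\<le>\<nu>. p_set s \<nu> \<gamma>)"
  proof safe
    fix ks ls assume "(ks, ls) \<in> chain_lists L \<gamma>" "\<nu> = weight ks ls"
    then have p: "(ks, ls) \<in> p_set (length ls) (weight ks ls) \<gamma>" by (auto simp: chain_lists_def p_set_iff)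
    then show "(ks, ls) \<in> (\<Union>s\<le>weight ks ls. p_set s (weight ks ls) \<gamma>)"
      using p_set_bounds(1,2)[OF p] by (auto intro: order_trans)
  next
    fix ks ls s assume p: "(ks, ls) \<in> p_set s \<nu> \<gamma>"
    then show "(ks, ls) \<in> chain_lists L \<gamma>"
      using p_set_bounds(3)[OF p] assms by (auto simp: chain_lists_def p_set_iff)
    show "weight ks ls = \<nu>" using p by (simp add: p_set_iff)
  qed
  then have "(\<Sum>(ks, ls) | (ks, ls) \<in> chain_lists L \<gamma> \<and> weight ks ls = \<nu>. chain_factor (length ls) ks ls y) =
      (\<Sum>(ks, ls)\<in>(\<Union>s\<le>\<nu>. p_set s \<nu> \<gamma>). chain_factor (length ls) ks ls y)" by simp
  also have "\<dots> = (\<Sum>s\<le>\<nu>. \<Sum>(ks, ls)\<in>p_set s \<nu> \<gamma>. chain_factor (length ls) ks ls y)"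
    by (rule sum.UNION_disjoint) (auto simp: finite_p_set p_set_iff)
  also have "\<dots> = chain_coeff \<nu> \<gamma> y"
    unfolding chain_coeff_def by (intro sum.cong) (auto simp: p_set_iff)
  finally show ?thesis .
qed

definition coeff_sum :: "nat \<Rightarrow> (nat \<Rightarrow> real^'n) \<Rightarrow> (nat^'n \<Rightarrow> real^'n) \<Rightarrow> real^'n" where
  "coeff_sum \<nu> y c = (\<Sum>\<gamma> | mi_abs \<gamma> \<le> \<nu>. chain_coeff \<nu> \<gamma> y *\<^sub>R c \<gamma>)"

text \<open>A crude count of all chains, each estimated by the largest possible factor. What matters
  is its independence of \<epsilon> and of time.\<close>

definition expansion_bound :: "'n::finite itself \<Rightarrow> nat \<Rightarrow> nat \<Rightarrow> real \<Rightarrow> real \<Rightarrow> real" where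
  "expansion_bound _ L m C M = (\<Sum>\<gamma> :: nat^'n | mi_abs \<gamma> \<le> m. real (card (chain_lists L \<gamma>)) * C ^ mi_abs \<gamma> * M)"

text \<open>Chains of weight at most \<open>m\<close> give exactly the polynomial in \<epsilon>;
  \<open>m \<le> L\<close> ensures that no level is missing from them. The remaining chains are
  finitely many and each carries at least \<open>\<epsilon> ^ Suc m\<close>.\<close>

lemma composition_expansion:
  fixes y :: "nat \<Rightarrow> real^'n" and c :: "nat^'n \<Rightarrow> real^'n"
  assumes C: "1 \<le> C" and m: "m \<le> L"
    and y: "\<And>l. l \<in> {1..L} \<Longrightarrow> norm (y l) \<le> C" and c: "\<And>\<gamma>. mi_abs \<gamma> \<le> m \<Longrightarrow> norm (c \<gamma>) \<le> M"
    and \<epsilon>: "0 \<le> \<epsilon>" "\<epsilon> \<le> 1"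
  shows "norm ((\<Sum>\<gamma> | mi_abs \<gamma> \<le> m. divpow \<gamma> (\<Sum>l=1..L. \<epsilon> ^ l *\<^sub>R y l) *\<^sub>R c \<gamma>) -
      (\<Sum>\<nu>\<le>m. \<epsilon> ^ \<nu> *\<^sub>R coeff_sum \<nu> y c)) \<le> expansion_bound TYPE('n) L m C M * \<epsilon> ^ Suc m"
proof -
  let ?P = "\<Sum>l=1..L. \<epsilon> ^ l *\<^sub>R y l"
  have tail: "\<bar>divpow \<gamma> ?P - (\<Sum>\<nu>\<le>m. \<epsilon> ^ \<nu> * chain_coeff \<nu> \<gamma> y)\<bar> \<le>
      real (card (chain_lists L \<gamma>)) * C ^ mi_abs \<gamma> * \<epsilon> ^ Suc m" for \<gamma>
  proof -
    let ?g = "\<lambda>(ks, ls). \<epsilon> ^ weight ks ls * chain_factor (length ls) ks ls y"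
    let ?low = "{p \<in> chain_lists L \<gamma>. (case p of (ks, ls) \<Rightarrow> weight ks ls) \<le> m}"
    let ?high = "chain_lists L \<gamma> - ?low"
    have "divpow \<gamma> ?P = sum ?g (chain_lists L \<gamma>)"
      unfolding divpow_sum chain_factor_scale ..
    also have "\<dots> = sum ?g ?high + sum ?g ?low"
      by (rule sum.subset_diff) (auto simp: finite_chain_lists)
    also have "sum ?g ?low = (\<Sum>\<nu>\<le>m. \<Sum>p | p \<in> ?low \<and> (case p of (ks, ls) \<Rightarrow> weight ks ls) = \<nu>. ?g p)"
      by (rule sum.group[symmetric]) (auto simp: finite_chain_lists)
    also have "\<dots> = (\<Sum>\<nu>\<le>m. \<epsilon> ^ \<nu> * chain_coeff \<nu> \<gamma> y)"
    proof (rule sum.cong[OF refl])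
      fix \<nu> assume "\<nu> \<in> {..m}"
      then have \<nu>: "\<nu> \<le> m" "\<nu> \<le> L" using m by auto
      have "{p. p \<in> ?low \<and> (case p of (ks, ls) \<Rightarrow> weight ks ls) = \<nu>} =
          {(ks, ls). (ks, ls) \<in> chain_lists L \<gamma> \<and> weight ks ls = \<nu>}" using \<nu> by auto
      then have "(\<Sum>p | p \<in> ?low \<and> (case p of (ks, ls) \<Rightarrow> weight ks ls) = \<nu>. ?g p) =
          (\<Sum>(ks, ls) | (ks, ls) \<in> chain_lists L \<gamma> \<and> weight ks ls = \<nu>. \<epsilon> ^ \<nu> * chain_factor (length ls) ks ls y)"
        by (auto intro!: sum.cong)
      also have "\<dots> = \<epsilon> ^ \<nu> * chain_coeff \<nu> \<gamma> y"
        unfolding chain_coeff_chains[OF \<nu>(2), symmetric] sum_distrib_left by (simp add: case_prod_beta)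
      finally show "(\<Sum>p | p \<in> ?low \<and> (case p of (ks, ls) \<Rightarrow> weight ks ls) = \<nu>. ?g p) = \<epsilon> ^ \<nu> * chain_coeff \<nu> \<gamma> y" .
    qed
    finally have "divpow \<gamma> ?P - (\<Sum>\<nu>\<le>m. \<epsilon> ^ \<nu> * chain_coeff \<nu> \<gamma> y) = sum ?g ?high" by simp
    also have "\<bar>\<dots>\<bar> \<le> (\<Sum>p\<in>?high. \<bar>?g p\<bar>)" by (rule sum_abs)
    also have "\<dots> \<le> (\<Sum>p\<in>?high. C ^ mi_abs \<gamma> * \<epsilon> ^ Suc m)"
    proof (rule sum_mono)
      fix p assume p: "p \<in> ?high"
      obtain ks ls where pe: "p = (ks, ls)" by (cases p)
      have ch: "length ks = length ls" "sum_list ks = \<gamma>" "0 \<notin> set ls" "set ls \<subseteq> {..L}"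
        using p by (auto simp: pe chain_lists_def)
      have yl: "norm (y l) \<le> C" if "l \<in> set ls" for l
        using ch(3,4) that by (intro y) (auto simp: Suc_le_eq intro: gr0I)
      have "\<epsilon> ^ weight ks ls \<le> \<epsilon> ^ Suc m" using p \<epsilon> by (intro power_decreasing) (auto simp: pe)
      moreover have "\<bar>chain_factor (length ls) ks ls y\<bar> \<le> C ^ mi_abs \<gamma>"
        using abs_chain_factor_le[OF yl C ch(1)] ch(2) by simp
      ultimately have "\<epsilon> ^ weight ks ls * \<bar>chain_factor (length ls) ks ls y\<bar> \<le> \<epsilon> ^ Suc m * C ^ mi_abs \<gamma>"
        using \<epsilon> by (intro mult_mono) auto
      then show "\<bar>?g p\<bar> \<le> C ^ mi_abs \<gamma> * \<epsilon> ^ Suc m"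
        using \<epsilon> by (simp add: pe abs_mult mult.commute)
    qed
    also have "\<dots> = real (card ?high) * (C ^ mi_abs \<gamma> * \<epsilon> ^ Suc m)" by simp
    also have "\<dots> \<le> real (card (chain_lists L \<gamma>)) * (C ^ mi_abs \<gamma> * \<epsilon> ^ Suc m)"
      using C \<epsilon> by (intro mult_right_mono) (auto intro!: card_mono finite_chain_lists)
    finally show ?thesis by (simp add: mult.assoc)
  qed
  have "(\<Sum>\<nu>\<le>m. \<epsilon> ^ \<nu> *\<^sub>R coeff_sum \<nu> y c) =
      (\<Sum>\<nu>\<le>m. \<Sum>\<gamma> | mi_abs \<gamma> \<le> m. (\<epsilon> ^ \<nu> * chain_coeff \<nu> \<gamma> y) *\<^sub>R c \<gamma>)"
  proof (rule sum.cong[OF refl])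
    fix \<nu> assume \<nu>: "\<nu> \<in> {..m}"
    have "(\<Sum>\<gamma> | mi_abs \<gamma> \<le> \<nu>. chain_coeff \<nu> \<gamma> y *\<^sub>R c \<gamma>) = (\<Sum>\<gamma> | mi_abs \<gamma> \<le> m. chain_coeff \<nu> \<gamma> y *\<^sub>R c \<gamma>)"
      using \<nu> by (intro sum.mono_neutral_left finite_mi_abs_le) (auto simp: chain_coeff_eq_0)
    then show "\<epsilon> ^ \<nu> *\<^sub>R coeff_sum \<nu> y c =
        (\<Sum>\<gamma> | mi_abs \<gamma> \<le> m. (\<epsilon> ^ \<nu> * chain_coeff \<nu> \<gamma> y) *\<^sub>R c \<gamma>)"
      by (simp add: coeff_sum_def scaleR_sum_right)
  qed
  also have "\<dots> = (\<Sum>\<gamma> | mi_abs \<gamma> \<le> m. (\<Sum>\<nu>\<le>m. \<epsilon> ^ \<nu> * chain_coeff \<nu> \<gamma> y) *\<^sub>R c \<gamma>)"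
    by (subst sum.swap) (simp add: scaleR_sum_left)
  finally have "(\<Sum>\<gamma> | mi_abs \<gamma> \<le> m. divpow \<gamma> ?P *\<^sub>R c \<gamma>) -
      (\<Sum>\<nu>\<le>m. \<epsilon> ^ \<nu> *\<^sub>R coeff_sum \<nu> y c) =
      (\<Sum>\<gamma> | mi_abs \<gamma> \<le> m. (divpow \<gamma> ?P - (\<Sum>\<nu>\<le>m. \<epsilon> ^ \<nu> * chain_coeff \<nu> \<gamma> y)) *\<^sub>R c \<gamma>)"
    by (simp add: sum_subtractf scaleR_diff_left)
  also have "norm \<dots> \<le> (\<Sum>\<gamma> :: nat^'n | mi_abs \<gamma> \<le> m. real (card (chain_lists L \<gamma>)) * C ^ mi_abs \<gamma> * \<epsilon> ^ Suc m * M)"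
  proof (rule sum_norm_le)
    fix \<gamma> :: "nat^'n" assume "\<gamma> \<in> {\<gamma>. mi_abs \<gamma> \<le> m}"
    then show "norm ((divpow \<gamma> ?P - (\<Sum>\<nu>\<le>m. \<epsilon> ^ \<nu> * chain_coeff \<nu> \<gamma> y)) *\<^sub>R c \<gamma>) \<le>
        real (card (chain_lists L \<gamma>)) * C ^ mi_abs \<gamma> * \<epsilon> ^ Suc m * M"
      unfolding norm_scaleR using tail[of \<gamma>] c[of \<gamma>] C \<epsilon> by (intro mult_mono) auto
  qed
  also have "\<dots> = expansion_bound TYPE('n) L m C M * \<epsilon> ^ Suc m"
    unfolding expansion_bound_def sum_distrib_right by (simp add: mult_ac)
  finally show ?thesis .
qed

section \<open>The formal expansion\<close>

lemma mi_abs_le_0_iff [simp]: "{\<gamma> :: nat^'n. mi_abs \<gamma> = 0} = {0}"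
  by auto

lemma chain_coeff_0_0 [simp]: "chain_coeff 0 0 y = 1"
proof -
  have "p_set 0 0 (0 :: nat^'a) = {([], [])}"
    by (auto simp: p_set_iff weight_def)
  then show ?thesis by (simp add: chain_coeff_def chain_factor_def)
qed

lemma coeff_sum_0 [simp]: "coeff_sum 0 y c = c 0"
  by (simp add: coeff_sum_def)

text \<open>Passes to the summation ranges of \<open>coefficient_formulas\<close>: in positive order
  there is no chain of length zero and none for the zero multi-index.\<close>

lemma coeff_sum_expand:
  assumes "1 \<le> \<nu>"
  shows "coeff_sum \<nu> y c = (\<Sum>\<gamma> | 1 \<le> mi_abs \<gamma> \<and> mi_abs \<gamma> \<le> \<nu>. \<Sum>s=1..\<nu>. \<Sum>(ks, ls)\<in>p_set s \<nu> \<gamma>.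
    chain_factor s ks ls y *\<^sub>R c \<gamma>)"
proof -
  have p0: "p_set 0 \<nu> \<gamma> = {}" for \<gamma> :: "nat^'a" using assms by (auto simp: p_set_def)
  have z: "chain_coeff \<nu> 0 y = 0"
    unfolding chain_coeff_def
  proof (intro sum.neutral ballI)
    fix s and p :: "(nat^'a) list \<times> nat list" assume p: "p \<in> p_set s \<nu> 0"
    then have "s = 0" using p_set_bounds(1)[of "fst p" "snd p" s \<nu> 0] by simp
    then show "(case p of (ks, ls) \<Rightarrow> chain_factor s ks ls y) = 0" using p p0 by simp
  qed
  have "coeff_sum \<nu> y c = (\<Sum>\<gamma> | 1 \<le> mi_abs \<gamma> \<and> mi_abs \<gamma> \<le> \<nu>. chain_coeff \<nu> \<gamma> y *\<^sub>R c \<gamma>)"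
    unfolding coeff_sum_def
    by (rule sum.mono_neutral_right) (auto simp: finite_mi_abs_le z Suc_le_eq intro!: gr0I)
  moreover have "chain_coeff \<nu> \<gamma> y = (\<Sum>s=1..\<nu>. \<Sum>(ks, ls)\<in>p_set s \<nu> \<gamma>. chain_factor s ks ls y)" for \<gamma>
    unfolding chain_coeff_def
    by (rule sum.mono_neutral_right) (auto simp: p0 Suc_le_eq intro: gr0I)
  ultimately show ?thesis by (simp add: scaleR_sum_left case_prod_beta)
qed

lemma chain_factor_cong:
  assumes "(ks, ls) \<in> p_set s \<nu> \<gamma>" "\<And>l. l \<in> set ls \<Longrightarrow> y l = y' l"
  shows "chain_factor s ks ls y = chain_factor s ks ls y'"
  using assms by (auto simp: chain_factor_divpow p_set_def intro!: prod.cong)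

lemma chain_coeff_cong:
  assumes "\<And>s ks ls l. (ks, ls) \<in> p_set s \<nu> \<gamma> \<Longrightarrow> l \<in> set ls \<Longrightarrow> y l = y' l"
  shows "chain_coeff \<nu> \<gamma> y = chain_coeff \<nu> \<gamma> y'"
  unfolding chain_coeff_def
  by (intro sum.cong refl) (auto intro!: chain_factor_cong assms)

lemma p_set_pos: "(ks, ls) \<in> p_set s \<nu> \<gamma> \<Longrightarrow> l \<in> set ls \<Longrightarrow> 1 \<le> l"
  by (auto simp: p_set_iff Suc_le_eq intro: gr0I)

text \<open>Terms of order at least two only involve earlier coefficients, which makes the recursion explicit.\<close>

lemma p_set_less:
  assumes p: "(ks, ls) \<in> p_set s \<nu> \<gamma>" and l: "l \<in> set ls" and \<gamma>: "2 \<le> mi_abs \<gamma>"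
  shows "l < \<nu>"
proof -
  have q: "\<gamma> = (\<Sum>j<s. ks ! j)" "\<nu> = (\<Sum>j<s. mi_abs (ks ! j) * ls ! j)" "length ls = s"
    and pos: "\<And>j. j < s \<Longrightarrow> ks ! j \<noteq> 0" "\<And>j. j < s \<Longrightarrow> 1 \<le> ls ! j"
    using p by (auto simp: p_set_def Suc_le_eq)
  obtain j where j: "j < s" "l = ls ! j" using l q(3) by (metis in_set_conv_nth)
  have "mi_abs (ks ! j) \<noteq> 0" using pos(1)[OF j(1)] by simp
  then obtain k where k: "mi_abs (ks ! j) = Suc k" by (cases "mi_abs (ks ! j)") auto
  obtain l' where l': "l = Suc l'" using p_set_pos[OF p l] by (cases l) auto
  have "(\<Sum>i\<in>{..<s} - {j}. mi_abs (ks ! i)) \<le> (\<Sum>i\<in>{..<s} - {j}. mi_abs (ks ! i) * ls ! i)"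
    using pos(2) by (intro sum_mono) auto
  moreover have "mi_abs \<gamma> = mi_abs (ks ! j) + (\<Sum>i\<in>{..<s} - {j}. mi_abs (ks ! i))"
    unfolding q(1) mi_abs_sum using j by (intro sum.remove) auto
  moreover have "\<nu> = mi_abs (ks ! j) * ls ! j + (\<Sum>i\<in>{..<s} - {j}. mi_abs (ks ! i) * ls ! i)"
    unfolding q(2) using j by (intro sum.remove) auto
  \<comment> \<open>Every other entry weighs at least its size. With \<open>Suc k\<close> for the
    size of entry \<open>j\<close> and \<open>Suc l'\<close> for its level, this reduces to
    \<open>l' + k * l' + mi_abs \<gamma> \<le> \<nu>\<close>, and degree two leaves room for one
    more than \<open>l\<close>.\<close>
  ultimately have "mi_abs (ks ! j) * l + mi_abs \<gamma> \<le> \<nu> + mi_abs (ks ! j)"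
    unfolding j(2) by linarith
  then have "l' + k * l' + mi_abs \<gamma> \<le> \<nu>" unfolding k l' by simp
  then show ?thesis using \<gamma> unfolding l' by linarith
qed

section \<open>Residual of the polynomial ansatz\<close>

text \<open>Collects the local nonlinear data on an open neighbourhood \<open>V\<close>. The
  condition \<open>f0(x) = o(|x|)\<close> enters through its consequences at the origin. The linear
  part is arbitrary here; hyperbolicity is added in an extension of the locale.\<close>

locale perturbed_system =
  fixes A :: "real^'n^'n" and f0 :: "real^'n \<Rightarrow> real^'n" and f :: "real^'n \<Rightarrow> real \<Rightarrow> real^'n"
    and V :: "(real^'n) set" and r N :: nat
  assumes V: "open V" "0 \<in> V"
    and f0: "Ck_open r V f0" "f0 0 = 0" "\<And>i. pd i f0 0 = 0"
    and f: "\<And>t. Ck_open r V (\<lambda>x. f x t)"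
    and f_bounds: "\<And>is. length is \<le> r \<Longrightarrow> \<exists>M. \<forall>x\<in>V. \<forall>t. norm (pds is (\<lambda>x. f x t) x) \<le> M"
    and f_measurable: "\<And>x. x \<in> V \<Longrightarrow> (\<lambda>t. f x t) \<in> borel_measurable lebesgue"
    and N: "1 \<le> N" "N \<le> r"
begin

text \<open>The inhomogeneity of the equation of order \<nu>. The forcing contributes with order
  \<open>\<nu> - 1\<close> because it carries one factor \<epsilon> of its own.\<close>

definition rhs :: "nat \<Rightarrow> (nat \<Rightarrow> real^'n) \<Rightarrow> real \<Rightarrow> real^'n" where
  "rhs \<nu> y t = coeff_sum \<nu> y (\<lambda>\<gamma>. mpartial \<gamma> f0 0) + coeff_sum (\<nu> - 1) y (\<lambda>\<gamma>. mpartial \<gamma> (\<lambda>x. f x t) 0)"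

definition residual :: "real \<Rightarrow> (nat \<Rightarrow> real^'n) \<Rightarrow> real \<Rightarrow> real^'n" where
  "residual \<epsilon> y t = f0 (\<Sum>l=1..N. \<epsilon> ^ l *\<^sub>R y l) + \<epsilon> *\<^sub>R f (\<Sum>l=1..N. \<epsilon> ^ l *\<^sub>R y l) t
    - (\<Sum>\<nu>=1..N. \<epsilon> ^ \<nu> *\<^sub>R rhs \<nu> y t)"

lemma mpartial_f0_zero:
  assumes "mi_abs \<gamma> \<le> 1" shows "mpartial \<gamma> f0 0 = 0"
proof (cases "mi_abs \<gamma> = 0")
  case True
  then show ?thesis by (simp add: mpartial_zero_index f0)
next
  case False
  then have "length (mi_list \<gamma>) = Suc 0" using assms unfolding length_mi_list by linarith
  then obtain i where "mi_list \<gamma> = [i]" by (auto simp: length_Suc_conv)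
  then show ?thesis by (simp add: mpartial_eq_pds f0)
qed

text \<open>Makes the hierarchy triangular: first-order terms of \<open>f0\<close> vanish, its terms
  of degree at least two involve only levels below \<nu>, and the forcing terms have weight
  \<open>\<nu> - 1\<close> to begin with.\<close>

lemma rhs_cong:
  assumes "\<And>l. 1 \<le> l \<Longrightarrow> l < \<nu> \<Longrightarrow> y l = y' l" "1 \<le> \<nu>"
  shows "rhs \<nu> y t = rhs \<nu> y' t"
proof -
  have "chain_coeff \<nu> \<gamma> y *\<^sub>R mpartial \<gamma> f0 0 = chain_coeff \<nu> \<gamma> y' *\<^sub>R mpartial \<gamma> f0 0" for \<gamma>
  proof (cases "mi_abs \<gamma> \<le> 1")
    case False
    then have "chain_coeff \<nu> \<gamma> y = chain_coeff \<nu> \<gamma> y'"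
      by (intro chain_coeff_cong assms p_set_pos p_set_less) auto
    then show ?thesis by simp
  qed (simp add: mpartial_f0_zero)
  moreover have "chain_coeff (\<nu> - 1) \<gamma> y = chain_coeff (\<nu> - 1) \<gamma> y'" for \<gamma>
  proof (rule chain_coeff_cong)
    fix s ks ls l assume p: "(ks, ls) \<in> p_set s (\<nu> - 1) \<gamma>" and l: "l \<in> set ls"
    then show "y l = y' l" using p_set_pos[OF p l] p_set_bounds(3)[OF p] assms(2) by (intro assms(1)) auto
  qed
  ultimately show ?thesis unfolding rhs_def coeff_sum_def by (simp only:)
qed

lemma mpartial_bounds:
  obtains M where "M \<ge> 0" "\<And>\<gamma>. mi_abs \<gamma> \<le> N \<Longrightarrow> norm (mpartial \<gamma> f0 0) \<le> M"
    "\<And>\<gamma> x t. mi_abs \<gamma> \<le> N \<Longrightarrow> x \<in> V \<Longrightarrow> norm (mpartial \<gamma> (\<lambda>x. f x t) x) \<le> M"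
proof -
  have "\<exists>M. \<forall>x\<in>V. \<forall>t. norm (mpartial \<gamma> (\<lambda>x. f x t) x) \<le> M" if "mi_abs \<gamma> \<le> N" for \<gamma>
    using f_bounds[of "mi_list \<gamma>"] that N by (simp add: mpartial_eq_pds length_mi_list)
  then obtain B where B: "\<And>\<gamma> x t. mi_abs \<gamma> \<le> N \<Longrightarrow> x \<in> V \<Longrightarrow> norm (mpartial \<gamma> (\<lambda>x. f x t) x) \<le> B \<gamma>"
    by metis
  define M where "M = (\<Sum>\<gamma> | mi_abs \<gamma> \<le> N. \<bar>B \<gamma>\<bar> + norm (mpartial \<gamma> f0 0))"
  have le: "\<bar>B \<gamma>\<bar> + norm (mpartial \<gamma> f0 0) \<le> M" if "mi_abs \<gamma> \<le> N" for \<gamma>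
    unfolding M_def using that by (intro member_le_sum finite_mi_abs_le) auto
  show ?thesis
  proof (rule that)
    show "M \<ge> 0" unfolding M_def by (intro sum_nonneg) auto
    show "norm (mpartial \<gamma> f0 0) \<le> M" if "mi_abs \<gamma> \<le> N" for \<gamma>
      using le[OF that] by simp
    show "norm (mpartial \<gamma> (\<lambda>x. f x t) x) \<le> M" if "mi_abs \<gamma> \<le> N" "x \<in> V" for \<gamma> x t
      using le[OF that(1)] B[OF that, of t] norm_ge_zero[of "mpartial \<gamma> f0 0"] by linarith
  qed
qed

lemma norm_ansatz_le:
  fixes y :: "nat \<Rightarrow> real^'n"
  assumes "\<And>l. l \<in> {1..N} \<Longrightarrow> norm (y l) \<le> C" "0 \<le> \<epsilon>" "\<epsilon> \<le> 1" "0 \<le> C"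
  shows "norm (\<Sum>l=1..N. \<epsilon> ^ l *\<^sub>R y l) \<le> real N * C * \<epsilon>"
proof -
  have "norm (\<Sum>l=1..N. \<epsilon> ^ l *\<^sub>R y l) \<le> (\<Sum>l=1..N. \<epsilon> * C)"
  proof (rule sum_norm_le)
    fix l assume l: "l \<in> {1..N}"
    then have "\<epsilon> ^ l \<le> \<epsilon> ^ 1" using assms by (intro power_decreasing) auto
    then show "norm (\<epsilon> ^ l *\<^sub>R y l) \<le> \<epsilon> * C"
      using assms l by (auto intro!: mult_mono)
  qed
  then show ?thesis by (simp add: mult_ac)
qed

text \<open>The order \<open>N\<close> stays in the polynomial, and continuity of its derivatives at
  zero makes the error smaller than any multiple of \<open>norm x ^ N\<close>.\<close>

lemma Taylor_f0:
  assumes e: "e > 0"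
  obtains \<delta> where "\<delta> > 0" "\<And>x. norm x < \<delta> \<Longrightarrow> x \<in> V" "\<And>x. norm x < \<delta> \<Longrightarrow>
    norm (f0 x - (\<Sum>\<gamma> | mi_abs \<gamma> \<le> N. divpow \<gamma> x *\<^sub>R mpartial \<gamma> f0 0)) \<le> e * norm x ^ N"
proof -
  define c where "c = real CARD('n) * real (card {\<gamma> :: nat^'n. mi_abs \<gamma> = N})"
  define \<eta> where "\<eta> = e / (c + 1)"
  have c: "c \<ge> 0" by (simp add: c_def)
  have \<eta>: "\<eta> > 0" "c * \<eta> \<le> e" using e c by (auto simp: \<eta>_def field_simps)
  have "\<forall>\<^sub>F x in nhds 0. x \<in> V \<and> (\<forall>\<gamma>\<in>{\<gamma>. mi_abs \<gamma> = N}. dist (mpartial \<gamma> f0 x) (mpartial \<gamma> f0 0) < \<eta>)"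
  proof (intro eventually_conj eventually_ball_finite finite_mi_abs_eq ballI)
    show "\<forall>\<^sub>F x in nhds 0. x \<in> V" using V by (rule eventually_nhds_in_open)
    fix \<gamma> :: "nat^'n" assume "\<gamma> \<in> {\<gamma>. mi_abs \<gamma> = N}"
    then have "isCont (mpartial \<gamma> f0) 0"
      using mpartial_continuous[OF f0(1), of \<gamma>] V N by (simp add: continuous_on_eq_continuous_at)
    then show "\<forall>\<^sub>F x in nhds 0. dist (mpartial \<gamma> f0 x) (mpartial \<gamma> f0 0) < \<eta>"
      using \<eta> unfolding isCont_def tendsto_iff by (auto simp: eventually_nhds_conv_at)
  qed
  then obtain \<delta> where \<delta>: "\<delta> > 0" "\<And>x. norm x < \<delta> \<Longrightarrow> x \<in> V"
      "\<And>x \<gamma>. norm x < \<delta> \<Longrightarrow> mi_abs \<gamma> = N \<Longrightarrow> dist (mpartial \<gamma> f0 x) (mpartial \<gamma> f0 0) < \<eta>"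
    unfolding eventually_nhds_metric by (auto simp: dist_norm)
  show ?thesis
  proof (rule that[OF \<delta>(1,2)])
    fix x :: "real^'n" assume x: "norm x < \<delta>"
    have sx: "norm (s *\<^sub>R x) < \<delta>" if "0 \<le> s" "s \<le> 1" for s
      using mult_right_mono[OF that(2), of "norm x"] that x by simp
    have "norm (f0 x - (\<Sum>\<gamma> | mi_abs \<gamma> < N. divpow \<gamma> x *\<^sub>R mpartial \<gamma> f0 0)
        - (\<Sum>\<gamma> | mi_abs \<gamma> = N. divpow \<gamma> x *\<^sub>R mpartial \<gamma> f0 0))
      \<le> real CARD('n) * real (card {\<gamma> :: nat^'n. mi_abs \<gamma> = N}) * \<eta> * norm x ^ N"
    proof (rule Taylor_bound[OF Ck_open_mono[OF f0(1) N(2) order_refl] V(1)])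
      show "s *\<^sub>R x \<in> V" if "0 \<le> s" "s \<le> 1" for s using \<delta>(2)[OF sx[OF that]] .
      show "norm (mpartial \<gamma> f0 (s *\<^sub>R x) - mpartial \<gamma> f0 0) \<le> \<eta>"
        if "mi_abs \<gamma> = N" "0 \<le> s" "s \<le> 1" for \<gamma> s
        using \<delta>(3)[OF sx[OF that(2,3)] that(1)] by (simp add: dist_norm)
    qed (use N in simp)
    also have "\<dots> \<le> e * norm x ^ N"
      using \<eta>(2) by (intro mult_right_mono) (auto simp: c_def)
    also have "(\<Sum>\<gamma> | mi_abs \<gamma> < N. divpow \<gamma> x *\<^sub>R mpartial \<gamma> f0 0) =
        (\<Sum>\<gamma> | mi_abs \<gamma> \<le> N. divpow \<gamma> x *\<^sub>R mpartial \<gamma> f0 0) - (\<Sum>\<gamma> | mi_abs \<gamma> = N. divpow \<gamma> x *\<^sub>R mpartial \<gamma> f0 0)"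
    proof -
      have "{\<gamma> :: nat^'n. mi_abs \<gamma> \<le> N} = {\<gamma>. mi_abs \<gamma> < N} \<union> {\<gamma>. mi_abs \<gamma> = N}" by auto
      then show ?thesis by (simp add: sum.union_disjoint disjoint_iff)
    qed
    finally show "norm (f0 x - (\<Sum>\<gamma> | mi_abs \<gamma> \<le> N. divpow \<gamma> x *\<^sub>R mpartial \<gamma> f0 0)) \<le> e * norm x ^ N"
      by simp
  qed
qed

text \<open>Truncated one order earlier than for \<open>f0\<close>: with comparison value zero, the
  derivatives of order \<open>N\<close> count fully as remainder, so that a bound uniform in time is
  enough.\<close>

lemma Taylor_f:
  assumes M: "M \<ge> 0" "\<And>\<gamma> x t. mi_abs \<gamma> \<le> N \<Longrightarrow> x \<in> V \<Longrightarrow> norm (mpartial \<gamma> (\<lambda>x. f x t) x) \<le> M"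
    and ray: "\<And>s. 0 \<le> s \<Longrightarrow> s \<le> 1 \<Longrightarrow> s *\<^sub>R x \<in> V"
  shows "norm (f x t - (\<Sum>\<gamma> | mi_abs \<gamma> \<le> N - 1. divpow \<gamma> x *\<^sub>R mpartial \<gamma> (\<lambda>x. f x t) 0)) \<le>
    real CARD('n) * real (card {\<gamma> :: nat^'n. mi_abs \<gamma> = N}) * M * norm x ^ N"
proof -
  have "norm (f x t - (\<Sum>\<gamma> | mi_abs \<gamma> < N. divpow \<gamma> x *\<^sub>R mpartial \<gamma> (\<lambda>x. f x t) 0)
      - (\<Sum>\<gamma> | mi_abs \<gamma> = N. divpow \<gamma> x *\<^sub>R 0))
    \<le> real CARD('n) * real (card {\<gamma> :: nat^'n. mi_abs \<gamma> = N}) * M * norm x ^ N"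
    by (rule Taylor_bound[OF Ck_open_mono[OF f N(2) order_refl] V(1) _ ray]) (use M ray N in auto)
  moreover have "{\<gamma> :: nat^'n. mi_abs \<gamma> < N} = {\<gamma>. mi_abs \<gamma> \<le> N - 1}" using N by auto
  ultimately show ?thesis by simp
qed

text \<open>Four errors arise: Taylor remainder and truncation in \<epsilon>, each for
  \<open>f0\<close> and for the forcing. The Taylor remainder of \<open>f0\<close> is made small by
  choice of radius; the other three are \<open>O(\<epsilon>^(N+1))\<close> with a common constant
  \<open>S\<close>. The threshold \<delta> depends on \<open>C\<close> but not on \<open>y\<close>
  or \<open>t\<close>.\<close>

lemma residual_small:
  assumes C: "1 \<le> C" and e: "e > 0"
  obtains \<delta> where "\<delta> > 0" "\<And>\<epsilon> y t. 0 < \<epsilon> \<Longrightarrow> \<epsilon> < \<delta> \<Longrightarrow> (\<And>l. l \<in> {1..N} \<Longrightarrow> norm (y l) \<le> C) \<Longrightarrow>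
    norm (residual \<epsilon> y t) \<le> e * \<epsilon> ^ N"
proof -
  obtain M where M: "M \<ge> 0" "\<And>\<gamma>. mi_abs \<gamma> \<le> N \<Longrightarrow> norm (mpartial \<gamma> f0 0) \<le> M"
    "\<And>\<gamma> x t. mi_abs \<gamma> \<le> N \<Longrightarrow> x \<in> V \<Longrightarrow> norm (mpartial \<gamma> (\<lambda>x. f x t) x) \<le> M"
    using mpartial_bounds by blast
  define R where "R = real N * C"
  have R: "R \<ge> 1" using C N mult_mono[of 1 "real N" 1 C] by (simp add: R_def)
  define c where "c = real CARD('n) * real (card {\<gamma> :: nat^'n. mi_abs \<gamma> = N}) * M"
  have c: "c \<ge> 0" using M by (simp add: c_def)
  have RN: "R ^ N > 0" using R by simp
  obtain \<delta>0 where \<delta>0: "\<delta>0 > 0" "\<And>x. norm x < \<delta>0 \<Longrightarrow> x \<in> V" "\<And>x. norm x < \<delta>0 \<Longrightarrow>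
      norm (f0 x - (\<Sum>\<gamma> | mi_abs \<gamma> \<le> N. divpow \<gamma> x *\<^sub>R mpartial \<gamma> f0 0)) \<le> e / 2 / R ^ N * norm x ^ N"
    \<comment> \<open>The ansatz has norm at most \<open>R * \<epsilon>\<close>, so the tolerance is
      divided by \<open>R ^ N\<close> in advance.\<close>
    using Taylor_f0[of "e / 2 / R ^ N"] e RN by auto
  define K0 where "K0 = expansion_bound TYPE('n) N N C M"
  define K1 where "K1 = expansion_bound TYPE('n) N (N - 1) C M"
  have K: "K0 \<ge> 0" "K1 \<ge> 0"
    using C M(1) by (auto simp: K0_def K1_def expansion_bound_def intro!: sum_nonneg)
  define S where "S = K0 + c * R ^ N + K1"
  have S: "S \<ge> 0" using K c R by (simp add: S_def)
  \<comment> \<open>The three entries keep \<epsilon> below one, the ansatz within radius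
    \<open>\<delta>0\<close>, and the higher-order errors below half the tolerance.\<close>
  define \<delta> where "\<delta> = min 1 (min (\<delta>0 / R) (e / 2 / (S + 1)))"
  show ?thesis
  proof (rule that[of \<delta>])
    show "\<delta> > 0" using \<delta>0(1) R S e by (simp add: \<delta>_def)
    fix \<epsilon> t :: real and y :: "nat \<Rightarrow> real^'n"
    assume \<epsilon>: "0 < \<epsilon>" "\<epsilon> < \<delta>" and y: "\<And>l. l \<in> {1..N} \<Longrightarrow> norm (y l) \<le> C"
    have \<epsilon>1: "0 \<le> \<epsilon>" "\<epsilon> \<le> 1" and \<epsilon>R: "R * \<epsilon> < \<delta>0" and \<epsilon>S: "S * \<epsilon> \<le> e / 2"
    proof -
      show "0 \<le> \<epsilon>" "\<epsilon> \<le> 1" using \<epsilon> by (auto simp: \<delta>_def)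
      have "\<epsilon> < \<delta>0 / R" "\<epsilon> < e / 2 / (S + 1)" using \<epsilon> by (auto simp: \<delta>_def)
      then have "R * \<epsilon> < \<delta>0" "(S + 1) * \<epsilon> < e / 2" using R S by (auto simp: field_simps)
      then show "R * \<epsilon> < \<delta>0" "S * \<epsilon> \<le> e / 2" using \<epsilon>(1) by (auto simp: distrib_right)
    qed
    define P where "P = (\<Sum>l=1..N. \<epsilon> ^ l *\<^sub>R y l)"
    have P: "norm P \<le> R * \<epsilon>"
      unfolding P_def R_def using norm_ansatz_le[OF y \<epsilon>1] C by simp
    have PN: "norm P ^ N \<le> R ^ N * \<epsilon> ^ N"
      unfolding power_mult_distrib[symmetric] by (rule power_mono[OF P]) simp
    have ray: "s *\<^sub>R P \<in> V" if "0 \<le> s" "s \<le> 1" for s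
      using mult_right_mono[OF that(2), of "norm P"] that P \<epsilon>R by (intro \<delta>0(2)) simp
    let ?c0 = "\<lambda>\<gamma>. mpartial \<gamma> f0 0" and ?c1 = "\<lambda>\<gamma>. mpartial \<gamma> (\<lambda>x. f x t) 0"
    let ?T0 = "\<Sum>\<gamma> | mi_abs \<gamma> \<le> N. divpow \<gamma> P *\<^sub>R ?c0 \<gamma>"
    let ?T1 = "\<Sum>\<gamma> | mi_abs \<gamma> \<le> N - 1. divpow \<gamma> P *\<^sub>R ?c1 \<gamma>"
    let ?D0 = "\<Sum>\<nu>\<le>N. \<epsilon> ^ \<nu> *\<^sub>R coeff_sum \<nu> y ?c0"
    let ?D1 = "\<Sum>\<nu>\<le>N - 1. \<epsilon> ^ \<nu> *\<^sub>R coeff_sum \<nu> y ?c1"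
    have 1: "norm (f0 P - ?T0) \<le> e / 2 * \<epsilon> ^ N"
    proof -
      have "norm (f0 P - ?T0) \<le> e / 2 / R ^ N * norm P ^ N"
        by (rule \<delta>0(3)) (use P \<epsilon>R in simp)
      also have "\<dots> \<le> e / 2 / R ^ N * (R ^ N * \<epsilon> ^ N)"
        using e RN by (intro mult_left_mono PN) auto
      finally show ?thesis using RN R by simp
    qed
    have 2: "norm (?T0 - ?D0) \<le> K0 * \<epsilon> ^ Suc N"
      unfolding P_def K0_def by (rule composition_expansion[OF C order_refl y M(2) \<epsilon>1])
    have "norm (f P t - ?T1) \<le> c * norm P ^ N"
      unfolding c_def by (rule Taylor_f[OF M(1,3) ray])
    also have "\<dots> \<le> c * R ^ N * \<epsilon> ^ N"
      using mult_left_mono[OF PN c] by (simp add: mult.assoc)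
    finally have 3: "norm (f P t - ?T1) \<le> c * R ^ N * \<epsilon> ^ N" .
    have 4: "norm (?T1 - ?D1) \<le> K1 * \<epsilon> ^ N"
    proof -
      have "norm (?T1 - ?D1) \<le> K1 * \<epsilon> ^ Suc (N - 1)"
        unfolding P_def K1_def by (rule composition_expansion[OF C _ y M(3)[OF _ V(2)] \<epsilon>1]) auto
      then show ?thesis using N by simp
    qed
    have "(\<Sum>\<nu>=1..N. \<epsilon> ^ \<nu> *\<^sub>R rhs \<nu> y t) = ?D0 + \<epsilon> *\<^sub>R ?D1"
    proof -
      have "?D0 = (\<Sum>\<nu>=1..N. \<epsilon> ^ \<nu> *\<^sub>R coeff_sum \<nu> y ?c0)"
        by (rule sum.mono_neutral_right) (auto simp: mpartial_zero_index f0 Suc_le_eq)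
      moreover have "\<epsilon> *\<^sub>R ?D1 = (\<Sum>\<nu>=1..N. \<epsilon> ^ \<nu> *\<^sub>R coeff_sum (\<nu> - 1) y ?c1)"
        unfolding scaleR_sum_right
        by (rule sum.reindex_bij_witness[of _ "\<lambda>\<nu>. \<nu> - 1" Suc]) (use N in auto)
      ultimately show ?thesis by (simp add: rhs_def scaleR_add_right sum.distrib)
    qed
    then have "f0 P + \<epsilon> *\<^sub>R f P t - (\<Sum>\<nu>=1..N. \<epsilon> ^ \<nu> *\<^sub>R rhs \<nu> y t) =
        (f0 P - ?T0) + (?T0 - ?D0) + \<epsilon> *\<^sub>R ((f P t - ?T1) + (?T1 - ?D1))"
      by (simp add: scaleR_diff_right)
    also have "norm \<dots> \<le> (e / 2 * \<epsilon> ^ N + K0 * \<epsilon> ^ Suc N) + \<epsilon> * (c * R ^ N * \<epsilon> ^ N + K1 * \<epsilon> ^ N)"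
    proof (intro norm_triangle_mono 1 2)
      show "norm (\<epsilon> *\<^sub>R ((f P t - ?T1) + (?T1 - ?D1))) \<le> \<epsilon> * (c * R ^ N * \<epsilon> ^ N + K1 * \<epsilon> ^ N)"
        using mult_left_mono[OF norm_triangle_mono[OF 3 4] \<epsilon>1(1)] \<epsilon>1 by simp
    qed
    also have "\<dots> = (e / 2 + S * \<epsilon>) * \<epsilon> ^ N" by (simp add: S_def algebra_simps)
    also have "\<dots> \<le> e * \<epsilon> ^ N" using \<epsilon>S \<epsilon>1 by (intro mult_right_mono) auto
    finally show "norm (residual \<epsilon> y t) \<le> e * \<epsilon> ^ N"
      unfolding residual_def P_def .
  qed
qed

text \<open>The bridge from iterated derivatives to the explicit sums. The residual estimate
  exhibits a polynomial that matches the vector field along the ansatz up to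
  \<open>o(\<epsilon>^N)\<close>, and uniqueness of Taylor coefficients does the rest.\<close>

lemma power_coeff_vfield:
  assumes \<nu>: "\<nu> \<in> {1..N}"
  shows "power_coeff \<nu> (\<lambda>\<epsilon>. vfield A f0 (scaled \<epsilon> f) s (\<Sum>\<mu>=1..N. \<epsilon> ^ \<mu> *\<^sub>R y \<mu>)) = A *v y \<nu> + rhs \<nu> y s"
proof -
  define P where "P \<epsilon> = (\<Sum>\<mu>=1..N. \<epsilon> ^ \<mu> *\<^sub>R y \<mu>)" for \<epsilon> :: real
  define Q where "Q \<epsilon> = (\<Sum>\<mu>=1..N. (real \<mu> * \<epsilon> ^ (\<mu> - 1)) *\<^sub>R y \<mu>)" for \<epsilon> :: real
  define c where "c \<nu> = (if \<nu> = 0 then 0 else A *v y \<nu> + rhs \<nu> y s)" for \<nu>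
  have PQ: "(P has_vector_derivative Q \<epsilon>) (at \<epsilon>)" for \<epsilon>
    unfolding P_def Q_def
  proof (rule has_vector_derivative_sum)
    fix \<mu> assume "\<mu> \<in> {1..N}"
    have "((\<lambda>\<epsilon>. \<epsilon> ^ \<mu> *\<^sub>R y \<mu>) has_vector_derivative \<epsilon> ^ \<mu> *\<^sub>R 0 + (real \<mu> * \<epsilon> ^ (\<mu> - 1)) *\<^sub>R y \<mu>) (at \<epsilon>)"
      by (rule has_vector_derivative_scaleR[OF _ has_vector_derivative_const])
         (auto intro!: derivative_eq_intros)
    then show "((\<lambda>\<epsilon>. \<epsilon> ^ \<mu> *\<^sub>R y \<mu>) has_vector_derivative (real \<mu> * \<epsilon> ^ (\<mu> - 1)) *\<^sub>R y \<mu>) (at \<epsilon>)" by simp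
  qed
  have Qpoly: "Q \<epsilon> $ i = poly (\<Sum>\<mu>=1..N. monom (real \<mu> * y \<mu> $ i) (\<mu> - 1)) \<epsilon>" for \<epsilon> i
    by (simp add: Q_def poly_sum poly_monom mult_ac)
  have P0: "P 0 = 0" unfolding P_def by (intro sum.neutral) auto
  have Pcont: "continuous_on UNIV P"
    by (intro continuous_at_imp_continuous_on ballI has_vector_derivative_continuous[OF PQ])
  \<comment> \<open>The polynomial curve is guaranteed to stay in \<open>V\<close> only for
    \<epsilon> near zero.\<close>
  let ?I = "P -` V"
  have I: "open ?I" "0 \<in> ?I" using open_vimage[OF V(1) Pcont] P0 V(2) by auto
  \<comment> \<open>The vector field is rewritten as polynomials times functions along the curve,
    the shape required by \<open>smooth_compose\<close>; \<open>[:0, 1:]\<close> is the factor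
    \<epsilon> of the forcing.\<close>
  have "smooth ?I N (\<lambda>\<epsilon>. (\<Sum>\<mu>=1..N. poly (monom 1 \<mu>) \<epsilon> *\<^sub>R (A *v y \<mu>)) + poly 1 \<epsilon> *\<^sub>R pds [] f0 (P \<epsilon>)
      + poly [:0, 1:] \<epsilon> *\<^sub>R pds [] (\<lambda>x. f x s) (P \<epsilon>))"
    by (intro smooth_add smooth_sum smooth_poly_scaleR
        smooth_compose[OF f0(1) V(1) _ PQ Qpoly] smooth_compose[OF f V(1) _ PQ Qpoly]) (use N in auto)
  moreover have "(\<lambda>\<epsilon>. (\<Sum>\<mu>=1..N. poly (monom 1 \<mu>) \<epsilon> *\<^sub>R (A *v y \<mu>)) + poly 1 \<epsilon> *\<^sub>R pds [] f0 (P \<epsilon>)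
      + poly [:0, 1:] \<epsilon> *\<^sub>R pds [] (\<lambda>x. f x s) (P \<epsilon>)) = (\<lambda>\<epsilon>. vfield A f0 (scaled \<epsilon> f) s (P \<epsilon>))"
    by (simp add: vfield_def P_def poly_monom linear_sum[OF matrix_vector_mul_linear]
        matrix_vector_mult_scaleR o_def)
  ultimately have smooth: "smooth ?I N (\<lambda>\<epsilon>. vfield A f0 (scaled \<epsilon> f) s (P \<epsilon>))" by simp
  define C where "C = 1 + (\<Sum>l=1..N. norm (y l))"
  have C: "1 \<le> C" unfolding C_def by (simp add: sum_nonneg)
  have yC: "norm (y l) \<le> C" if "l \<in> {1..N}" for l
    using member_le_sum[OF that, of "\<lambda>l. norm (y l)"] by (simp add: C_def)
  have "power_coeff \<nu> (\<lambda>\<epsilon>. vfield A f0 (scaled \<epsilon> f) s (P \<epsilon>)) = c \<nu>"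
  proof (rule power_coeff_eqI[OF I smooth])
    fix e :: real assume e: "e > 0"
    obtain \<delta> where \<delta>: "\<delta> > 0" "\<And>\<epsilon> y t. 0 < \<epsilon> \<Longrightarrow> \<epsilon> < \<delta> \<Longrightarrow> (\<And>l. l \<in> {1..N} \<Longrightarrow> norm (y l) \<le> C) \<Longrightarrow>
        norm (residual \<epsilon> y t) \<le> e * \<epsilon> ^ N"
      using residual_small[OF C e] by blast
    have "vfield A f0 (scaled \<epsilon> f) s (P \<epsilon>) - (\<Sum>\<nu>\<le>N. \<epsilon> ^ \<nu> *\<^sub>R c \<nu>) =
        residual \<epsilon> y s" for \<epsilon>
    proof -
      have "(\<Sum>\<nu>\<le>N. \<epsilon> ^ \<nu> *\<^sub>R c \<nu>) = (\<Sum>\<nu>=1..N. \<epsilon> ^ \<nu> *\<^sub>R c \<nu>)"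
        by (rule sum.mono_neutral_right) (auto simp: c_def Suc_le_eq)
      also have "\<dots> = (\<Sum>\<nu>=1..N. \<epsilon> ^ \<nu> *\<^sub>R (A *v y \<nu>)) + (\<Sum>\<nu>=1..N. \<epsilon> ^ \<nu> *\<^sub>R rhs \<nu> y s)"
        by (simp add: c_def scaleR_add_right sum.distrib)
      also have "(\<Sum>\<nu>=1..N. \<epsilon> ^ \<nu> *\<^sub>R (A *v y \<nu>)) = A *v P \<epsilon>"
        by (simp add: P_def linear_sum[OF matrix_vector_mul_linear] matrix_vector_mult_scaleR o_def)
      finally show ?thesis by (simp add: vfield_def residual_def P_def)
    qed
    with \<delta>(1) \<delta>(2)[OF _ _ yC] show "\<exists>\<delta>>0. \<forall>\<epsilon>. 0 < \<epsilon> \<and> \<epsilon> < \<delta> \<longrightarrow>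
        norm (vfield A f0 (scaled \<epsilon> f) s (P \<epsilon>) - (\<Sum>\<nu>\<le>N. \<epsilon> ^ \<nu> *\<^sub>R c \<nu>)) \<le> e * \<epsilon> ^ N"
      by (intro exI[of _ \<delta>]) auto
  qed (use \<nu> N in auto)
  then show ?thesis using \<nu> by (simp add: P_def c_def)
qed

end

section \<open>Bounded measurable functions of time\<close>

definition bounded_measurable :: "(real \<Rightarrow> 'a::real_normed_vector) \<Rightarrow> bool" where
  "bounded_measurable h \<longleftrightarrow> h \<in> borel_measurable lebesgue \<and> bounded (range h)"

lemma bounded_measurableI:
  "h \<in> borel_measurable lebesgue \<Longrightarrow> (\<And>t. norm (h t) \<le> B) \<Longrightarrow> bounded_measurable h"
  unfolding bounded_measurable_def bounded_iff by blast

lemma bounded_measurable_const: "bounded_measurable (\<lambda>_. c)"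
  by (auto simp: bounded_measurable_def)

lemma bounded_measurable_add:
  fixes g h :: "real \<Rightarrow> 'a::euclidean_space"
  assumes "bounded_measurable g" "bounded_measurable h"
  shows "bounded_measurable (\<lambda>t. g t + h t)"
  using assms unfolding bounded_measurable_def
  by (auto intro: borel_measurable_add bounded_plus_comp)

lemma bounded_measurable_scaleR:
  fixes \<phi> :: "real \<Rightarrow> real" and h :: "real \<Rightarrow> 'a::euclidean_space"
  assumes "bounded_measurable \<phi>" "bounded_measurable h"
  shows "bounded_measurable (\<lambda>t. \<phi> t *\<^sub>R h t)"
proof -
  obtain B C where B: "\<And>t. norm (\<phi> t) \<le> B" and C: "\<And>t. norm (h t) \<le> C"
    using assms unfolding bounded_measurable_def bounded_iff by auto
  have "norm (\<phi> t *\<^sub>R h t) \<le> B * C" for t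
    using mult_mono[OF B C order_trans[OF norm_ge_zero B] norm_ge_zero] by simp
  moreover have "(\<lambda>t. \<phi> t *\<^sub>R h t) \<in> borel_measurable lebesgue"
    using assms unfolding bounded_measurable_def by (intro borel_measurable_scaleR) auto
  ultimately show ?thesis by (intro bounded_measurableI)
qed

lemma bounded_measurable_sum:
  fixes h :: "'i \<Rightarrow> real \<Rightarrow> 'a::euclidean_space"
  assumes "finite I" "\<And>i. i \<in> I \<Longrightarrow> bounded_measurable (h i)"
  shows "bounded_measurable (\<lambda>t. \<Sum>i\<in>I. h i t)"
  using assms
  by (induction I rule: finite_induct) (auto intro: bounded_measurable_const bounded_measurable_add)

lemma bounded_measurable_chain_factor:
  fixes \<xi> :: "nat \<Rightarrow> real \<Rightarrow> real^'n"
  assumes p: "(ks, ls) \<in> p_set s \<nu> \<gamma>" and \<xi>: "\<And>l. l \<in> set ls \<Longrightarrow> bounded_measurable (\<xi> l)"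
  shows "bounded_measurable (\<lambda>t. chain_factor s ks ls (\<lambda>l. \<xi> l t))"
proof -
  have len: "length ls = s" "length ks = length ls" using p by (auto simp: p_set_def)
  have "(\<lambda>t. \<xi> (ls ! j) t $ i) \<in> borel_measurable lebesgue" if "j < s" for i j
    using \<xi>[of "ls ! j"] that len
    by (intro measurable_compose[OF _ borel_measurable_continuous_onI[OF continuous_on_component[OF continuous_on_id]]])
       (auto simp: bounded_measurable_def)
  then have m: "(\<lambda>t. chain_factor s ks ls (\<lambda>l. \<xi> l t)) \<in> borel_measurable lebesgue"
    unfolding chain_factor_def
    by (intro borel_measurable_prod borel_measurable_divide borel_measurable_power borel_measurable_const) auto
  have "\<exists>B. \<forall>t. norm (\<xi> l t) \<le> B" if "l \<in> set ls" for l
    using \<xi>[OF that] by (auto simp: bounded_measurable_def bounded_iff)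
  then obtain B where B: "\<And>l t. l \<in> set ls \<Longrightarrow> norm (\<xi> l t) \<le> B l" by metis
  define C where "C = 1 + (\<Sum>l\<in>set ls. \<bar>B l\<bar>)"
  have C: "1 \<le> C" by (simp add: C_def sum_nonneg)
  have \<xi>C: "norm (\<xi> l t) \<le> C" if "l \<in> set ls" for l t
    using B[OF that, of t] member_le_sum[OF that, of "\<lambda>l. \<bar>B l\<bar>"] by (simp add: C_def)
  have "norm (chain_factor s ks ls (\<lambda>l. \<xi> l t)) \<le> C ^ mi_abs (sum_list ks)" for t
    using abs_chain_factor_le[of ls "\<lambda>l. \<xi> l t" C ks, OF \<xi>C C len(2)] len(1) by simp
  with m show ?thesis by (rule bounded_measurableI)
qed

lemma coeff_sum_flat:
  "coeff_sum \<nu> y c = (\<Sum>\<gamma> | mi_abs \<gamma> \<le> \<nu>. \<Sum>s\<le>\<nu>. \<Sum>p\<in>p_set s \<nu> \<gamma>. chain_factor s (fst p) (snd p) y *\<^sub>R c \<gamma>)"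
  by (simp add: coeff_sum_def chain_coeff_def scaleR_sum_left case_prod_beta)

lemma bounded_measurable_coeff_sum:
  fixes \<xi> :: "nat \<Rightarrow> real \<Rightarrow> real^'n"
  assumes "\<And>l. 1 \<le> l \<Longrightarrow> bounded_measurable (\<xi> l)" "\<And>\<gamma>. mi_abs \<gamma> \<le> \<nu> \<Longrightarrow> bounded_measurable (c \<gamma>)"
  shows "bounded_measurable (\<lambda>t. coeff_sum \<nu> (\<lambda>l. \<xi> l t) (\<lambda>\<gamma>. c \<gamma> t))"
  unfolding coeff_sum_flat
proof (intro bounded_measurable_sum bounded_measurable_scaleR finite_mi_abs_le finite_p_set)
  fix \<gamma> :: "nat^'n" and s and p :: "(nat^'n) list \<times> nat list"
  assume p: "p \<in> p_set s \<nu> \<gamma>" and \<gamma>: "\<gamma> \<in> {\<gamma>. mi_abs \<gamma> \<le> \<nu>}"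
  then have p': "(fst p, snd p) \<in> p_set s \<nu> \<gamma>" by simp
  show "bounded_measurable (\<lambda>t. chain_factor s (fst p) (snd p) (\<lambda>l. \<xi> l t))"
    by (rule bounded_measurable_chain_factor[OF p' assms(1)[OF p_set_pos[OF p']]])
  show "bounded_measurable (c \<gamma>)" using assms(2) \<gamma> by simp
qed auto

text \<open>All terms of order \<nu> have weight exactly \<nu>. This homogeneity turns statements
  about \<open>\<xi> \<nu>\<close> into statements about
  \<open>\<epsilon> ^ \<nu> *\<^sub>R \<xi> \<nu>\<close>.\<close>

lemma coeff_sum_scaled: "coeff_sum \<nu> (\<lambda>l. \<epsilon> ^ l *\<^sub>R y l) c = \<epsilon> ^ \<nu> *\<^sub>R coeff_sum \<nu> y c"
proof -
  have "chain_coeff \<nu> \<gamma> (\<lambda>l. \<epsilon> ^ l *\<^sub>R y l) = \<epsilon> ^ \<nu> * chain_coeff \<nu> \<gamma> y" for \<gamma>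
    unfolding chain_coeff_def sum_distrib_left
    by (intro sum.cong refl) (auto simp: p_set_iff chain_factor_scale)
  then show ?thesis by (simp add: coeff_sum_def scaleR_sum_right)
qed

section \<open>Solving the hierarchy of coefficient equations\<close>

locale hyperbolic_perturbation = perturbed_system A f0 f V r N
  for A :: "real^'n^'n" and f0 f V r N +
  fixes T :: "real^'n^'n" and S :: "'n set"
  assumes A: "semisimple A" "hyperbolic A" and T: "splitting_basis A T S"
begin

abbreviation "resp \<equiv> green_response A T S"

lemma integrable_green:
  assumes "bounded_measurable g"
  shows "integrable lebesgue (\<lambda>\<tau>. green A T S (t - \<tau>) *v g \<tau>)"
proof -
  obtain B where "\<And>t. norm (g t) \<le> B" using assms by (auto simp: bounded_measurable_def bounded_iff)
  then show ?thesis using green_response[OF A T] assms unfolding bounded_measurable_def by metis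
qed

lemma resp_solves:
  assumes "bounded_measurable g"
  shows "solves (\<lambda>s y. A *v y + g s) (resp g)" "bounded (range (resp g))"
proof -
  obtain B where B: "\<And>t. norm (g t) \<le> B" using assms by (auto simp: bounded_measurable_def bounded_iff)
  have g: "g \<in> borel_measurable lebesgue" using assms by (simp add: bounded_measurable_def)
  show "solves (\<lambda>s y. A *v y + g s) (resp g)" using green_response[OF A T] g B by metis
  obtain K where "\<And>t. norm (resp g t) \<le> K * B" using green_response[OF A T] g B by metis
  then show "bounded (range (resp g))" by (auto intro: boundedI)
qed

lemma resp_unique:
  assumes "bounded (range g)" "bounded (range x)" "solves (\<lambda>s y. A *v y + g s) x"
  shows "x = resp g" "bounded_measurable g" "bounded_measurable x"
proof -
  obtain B C where B: "\<And>t. norm (g t) \<le> B" and C: "\<And>t. norm (x t) \<le> C"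
    using assms by (auto simp: bounded_iff)
  show "x = resp g" using green_response[OF A T] assms(3) B C by metis
  note m = solves_bounded_measurable[OF assms(3) B C]
  show "bounded_measurable g" using m(2) assms by (simp add: bounded_measurable_def)
  have "x \<in> borel_measurable borel" by (rule borel_measurable_continuous_onI[OF m(1)])
  then have "x \<in> borel_measurable lebesgue" by (intro measurable_completion) simp
  then show "bounded_measurable x" using assms by (simp add: bounded_measurable_def)
qed

lemma resp_sum:
  assumes "finite I" "\<And>i. i \<in> I \<Longrightarrow> bounded_measurable (h i)"
  shows "resp (\<lambda>\<tau>. \<Sum>i\<in>I. h i \<tau>) t = (\<Sum>i\<in>I. resp (h i) t)"
  unfolding green_response_def linear_sum[OF matrix_vector_mul_linear] o_def
  by (rule Bochner_Integration.integral_sum) (use assms in \<open>auto intro: integrable_green\<close>)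

lemma resp_add:
  assumes "bounded_measurable g" "bounded_measurable h"
  shows "resp (\<lambda>\<tau>. g \<tau> + h \<tau>) t = resp g t + resp h t"
  unfolding green_response_def matrix_vector_right_distrib
  by (rule Bochner_Integration.integral_add) (use assms in \<open>auto intro: integrable_green\<close>)

lemma resp_scaleR: "resp (\<lambda>\<tau>. c *\<^sub>R g \<tau>) t = c *\<^sub>R resp g t"
  unfolding green_response_def matrix_vector_mult_scaleR by simp

lemma bounded_measurable_mpartial:
  assumes "mi_abs \<gamma> \<le> N"
  shows "bounded_measurable (\<lambda>t. mpartial \<gamma> (\<lambda>x. f x t) 0)"
proof -
  have l: "length (mi_list \<gamma>) \<le> r" using assms N by (simp add: length_mi_list)
  have "(\<lambda>t. pds (mi_list \<gamma>) (\<lambda>x. f x t) 0) \<in> borel_measurable lebesgue"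
    by (rule pds_measurable[OF V(1) f f_measurable l V(2)])
  moreover obtain M where "\<And>x t. x \<in> V \<Longrightarrow> norm (pds (mi_list \<gamma>) (\<lambda>x. f x t) x) \<le> M"
    using f_bounds[OF l] by blast
  ultimately show ?thesis
    using V(2) by (auto simp: bounded_measurable_def mpartial_eq_pds intro!: boundedI)
qed

lemma bounded_measurable_rhs:
  assumes \<nu>: "\<nu> \<in> {1..N}" and \<xi>: "\<And>l. 1 \<le> l \<Longrightarrow> l < \<nu> \<Longrightarrow> bounded_measurable (\<xi> l)"
  shows "bounded_measurable (\<lambda>t. rhs \<nu> (\<lambda>l. \<xi> l t) t)"
proof -
  \<comment> \<open>Measurability is available below \<nu> only. The other levels may be set to zero
    because \<open>rhs \<nu>\<close> does not see them.\<close>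
  define \<xi>' where "\<xi>' l = (if l < \<nu> then \<xi> l else (\<lambda>_. 0))" for l
  have \<xi>': "bounded_measurable (\<xi>' l)" if "1 \<le> l" for l
    using \<xi>[OF that] by (auto simp: \<xi>'_def bounded_measurable_const)
  have "rhs \<nu> (\<lambda>l. \<xi> l t) t = rhs \<nu> (\<lambda>l. \<xi>' l t) t" for t
    using \<nu> by (intro rhs_cong) (auto simp: \<xi>'_def)
  moreover have "bounded_measurable (\<lambda>t. rhs \<nu> (\<lambda>l. \<xi>' l t) t)"
    unfolding rhs_def using \<nu>
    by (intro bounded_measurable_add bounded_measurable_coeff_sum \<xi>' bounded_measurable_const
        bounded_measurable_mpartial) auto
  ultimately show ?thesis by simp
qed

text \<open>With the power coefficients identified, the formal equations become linear ones in which
  \<xi> \<nu> is driven by lower orders.\<close>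

lemma formal_expansion_iff:
  "formal_expansion A f0 f N \<xi> \<longleftrightarrow>
    (\<forall>\<nu>\<in>{1..N}. bounded (range (\<xi> \<nu>)) \<and> solves (\<lambda>s y. A *v y + rhs \<nu> (\<lambda>l. \<xi> l s) s) (\<xi> \<nu>))"
  unfolding formal_expansion_def solves_def
  using power_coeff_vfield[where y = "\<lambda>\<mu>. \<xi> \<mu> s" and s = s for s] by simp

text \<open>Lower orders determine a bounded measurable inhomogeneity, and the bounded solution for
  it is unique. Hence any two formal expansions agree in the orders up to \<open>N\<close>.\<close>

lemma formal_expansion_unfold:
  assumes \<xi>: "formal_expansion A f0 f N \<xi>"
  shows "\<nu> \<in> {1..N} \<Longrightarrow> bounded_measurable (\<xi> \<nu>) \<and> bounded_measurable (\<lambda>t. rhs \<nu> (\<lambda>l. \<xi> l t) t) \<and>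
    \<xi> \<nu> = resp (\<lambda>t. rhs \<nu> (\<lambda>l. \<xi> l t) t)"
proof (induction \<nu> rule: less_induct)
  case (less \<nu>)
  have m: "bounded_measurable (\<lambda>t. rhs \<nu> (\<lambda>l. \<xi> l t) t)"
    by (rule bounded_measurable_rhs[OF less.prems conjunct1[OF less.IH]]) (use less.prems in auto)
  have s: "bounded (range (\<xi> \<nu>))" "solves (\<lambda>s y. A *v y + rhs \<nu> (\<lambda>l. \<xi> l s) s) (\<xi> \<nu>)"
    using \<xi> less.prems unfolding formal_expansion_iff by auto
  have "bounded (range (\<lambda>t. rhs \<nu> (\<lambda>l. \<xi> l t) t))" using m by (simp add: bounded_measurable_def)
  from resp_unique[OF this s] m show ?case by simp
qed

lemma formal_expansion_exists: "\<exists>\<xi>. formal_expansion A f0 f N \<xi>"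
proof -
  have "\<exists>\<xi>. \<forall>\<nu>\<in>{1..m}. bounded_measurable (\<xi> \<nu>) \<and>
      solves (\<lambda>s y. A *v y + rhs \<nu> (\<lambda>l. \<xi> l s) s) (\<xi> \<nu>)" if "m \<le> N" for m
    using that
  proof (induction m)
    case (Suc m)
    then have "\<exists>\<xi>. \<forall>\<nu>\<in>{1..m}. bounded_measurable (\<xi> \<nu>) \<and>
        solves (\<lambda>s y. A *v y + rhs \<nu> (\<lambda>l. \<xi> l s) s) (\<xi> \<nu>)" by simp
    then obtain \<xi> where \<xi>: "\<And>\<nu>. \<nu> \<in> {1..m} \<Longrightarrow> bounded_measurable (\<xi> \<nu>)"
      "\<And>\<nu>. \<nu> \<in> {1..m} \<Longrightarrow> solves (\<lambda>s y. A *v y + rhs \<nu> (\<lambda>l. \<xi> l s) s) (\<xi> \<nu>)" by blast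
    define g where "g t = rhs (Suc m) (\<lambda>l. \<xi> l t) t" for t
    have g: "bounded_measurable g"
      unfolding g_def by (rule bounded_measurable_rhs) (use Suc.prems \<xi> in auto)
    define \<xi>' where "\<xi>' = \<xi>(Suc m := resp g)"
    \<comment> \<open>Installing the new top level disturbs no equation, including its own: by
      triangularity it occurs in none of these inhomogeneities.\<close>
    have rhs_eq: "rhs \<nu> (\<lambda>l. \<xi>' l s) s = rhs \<nu> (\<lambda>l. \<xi> l s) s" if "\<nu> \<in> {1..Suc m}" for \<nu> s
      using that by (intro rhs_cong) (auto simp: \<xi>'_def)
    have "bounded_measurable (\<xi>' \<nu>) \<and> solves (\<lambda>s y. A *v y + rhs \<nu> (\<lambda>l. \<xi>' l s) s) (\<xi>' \<nu>)"
      if \<nu>: "\<nu> \<in> {1..Suc m}" for \<nu>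
    proof (cases "\<nu> = Suc m")
      case True
      have "bounded_measurable (resp g)"
        using resp_unique(3)[OF _ resp_solves(2,1)[OF g]] g by (simp add: bounded_measurable_def)
      then show ?thesis using resp_solves(1)[OF g] unfolding rhs_eq[OF \<nu>] by (simp add: True \<xi>'_def g_def)
    next
      case False
      then show ?thesis using \<xi>[of \<nu>] \<nu> unfolding rhs_eq[OF \<nu>] by (simp add: \<xi>'_def)
    qed
    then show ?case by blast
  qed simp
  from this[OF order_refl] show ?thesis
    unfolding formal_expansion_iff by (auto simp: bounded_measurable_def)
qed

lemma mpartial_scaled:
  assumes "mi_abs \<gamma> \<le> N"
  shows "mpartial \<gamma> (\<lambda>x. \<epsilon> *\<^sub>R f x t) 0 = \<epsilon> *\<^sub>R mpartial \<gamma> (\<lambda>x. f x t) 0"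
  unfolding mpartial_eq_pds
  by (rule pds_scaled[OF V(1) f _ V(2)]) (use assms N in \<open>simp add: length_mi_list\<close>)

lemma resp_coeff_sum:
  assumes \<nu>: "1 \<le> \<nu>" and x: "\<And>l. l \<in> {1..\<nu>} \<Longrightarrow> bounded_measurable (x l)"
    and c: "\<And>\<gamma>. mi_abs \<gamma> \<le> \<nu> \<Longrightarrow> bounded_measurable (c \<gamma>)"
  shows "\<And>\<gamma> s ks ls. mi_abs \<gamma> \<le> \<nu> \<Longrightarrow> (ks, ls) \<in> p_set s \<nu> \<gamma> \<Longrightarrow>
      bounded_measurable (\<lambda>\<tau>. chain_factor s ks ls (\<lambda>l. x l \<tau>) *\<^sub>R c \<gamma> \<tau>)"
    and "bounded_measurable (\<lambda>\<tau>. coeff_sum \<nu> (\<lambda>l. x l \<tau>) (\<lambda>\<gamma>. c \<gamma> \<tau>))"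
    and "resp (\<lambda>\<tau>. coeff_sum \<nu> (\<lambda>l. x l \<tau>) (\<lambda>\<gamma>. c \<gamma> \<tau>)) t =
      (\<Sum>\<gamma> | 1 \<le> mi_abs \<gamma> \<and> mi_abs \<gamma> \<le> \<nu>. \<Sum>s=1..\<nu>. \<Sum>(ks, ls)\<in>p_set s \<nu> \<gamma>.
        LINT \<tau>|lebesgue. green A T S (t - \<tau>) *v (chain_factor s ks ls (\<lambda>l. x l \<tau>) *\<^sub>R c \<gamma> \<tau>))"
proof -
  have ls: "l \<in> {1..\<nu>}" if "(ks, ls) \<in> p_set s \<nu> \<gamma>" "l \<in> set ls" for \<gamma> :: "nat^'n" and s ks ls l
    using p_set_pos[OF that] p_set_bounds(3)[OF that(1)] that(2) by auto
  show 1: "bounded_measurable (\<lambda>\<tau>. chain_factor s ks ls (\<lambda>l. x l \<tau>) *\<^sub>R c \<gamma> \<tau>)"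
    if "mi_abs \<gamma> \<le> \<nu>" "(ks, ls) \<in> p_set s \<nu> \<gamma>" for \<gamma> s ks ls
    by (intro bounded_measurable_scaleR bounded_measurable_chain_factor[OF that(2)] x ls[OF that(2)] c that(1))
  have fin: "finite {\<gamma> :: nat^'n. 1 \<le> mi_abs \<gamma> \<and> mi_abs \<gamma> \<le> \<nu>}"
    by (rule finite_subset[OF _ finite_mi_abs_le[of \<nu>]]) auto
  have 2: "bounded_measurable (\<lambda>\<tau>. \<Sum>p\<in>p_set s \<nu> \<gamma>. chain_factor s (fst p) (snd p) (\<lambda>l. x l \<tau>) *\<^sub>R c \<gamma> \<tau>)"
    if "mi_abs \<gamma> \<le> \<nu>" for \<gamma> s
    by (intro bounded_measurable_sum finite_p_set 1[OF that]) simp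
  have 3: "bounded_measurable (\<lambda>\<tau>. \<Sum>s=1..\<nu>. \<Sum>p\<in>p_set s \<nu> \<gamma>. chain_factor s (fst p) (snd p) (\<lambda>l. x l \<tau>) *\<^sub>R c \<gamma> \<tau>)"
    if "mi_abs \<gamma> \<le> \<nu>" for \<gamma>
    by (intro bounded_measurable_sum 2[OF that]) simp
  show "bounded_measurable (\<lambda>\<tau>. coeff_sum \<nu> (\<lambda>l. x l \<tau>) (\<lambda>\<gamma>. c \<gamma> \<tau>))"
    unfolding coeff_sum_expand[OF \<nu>] case_prod_beta
    by (intro bounded_measurable_sum fin 3) simp
  have "resp (\<lambda>\<tau>. coeff_sum \<nu> (\<lambda>l. x l \<tau>) (\<lambda>\<gamma>. c \<gamma> \<tau>)) t =
      (\<Sum>\<gamma> | 1 \<le> mi_abs \<gamma> \<and> mi_abs \<gamma> \<le> \<nu>. resp (\<lambda>\<tau>. \<Sum>s=1..\<nu>. \<Sum>p\<in>p_set s \<nu> \<gamma>.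
        chain_factor s (fst p) (snd p) (\<lambda>l. x l \<tau>) *\<^sub>R c \<gamma> \<tau>) t)"
    unfolding coeff_sum_expand[OF \<nu>] case_prod_beta by (rule resp_sum[OF fin 3]) simp
  also have "\<dots> = (\<Sum>\<gamma> | 1 \<le> mi_abs \<gamma> \<and> mi_abs \<gamma> \<le> \<nu>. \<Sum>s=1..\<nu>. \<Sum>p\<in>p_set s \<nu> \<gamma>.
      resp (\<lambda>\<tau>. chain_factor s (fst p) (snd p) (\<lambda>l. x l \<tau>) *\<^sub>R c \<gamma> \<tau>) t)"
  proof (intro sum.cong refl)
    fix \<gamma> :: "nat^'n" assume "\<gamma> \<in> {\<gamma>. 1 \<le> mi_abs \<gamma> \<and> mi_abs \<gamma> \<le> \<nu>}"
    then have \<gamma>: "mi_abs \<gamma> \<le> \<nu>" by simp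
    have "resp (\<lambda>\<tau>. \<Sum>p\<in>p_set s \<nu> \<gamma>. chain_factor s (fst p) (snd p) (\<lambda>l. x l \<tau>) *\<^sub>R c \<gamma> \<tau>) t =
        (\<Sum>p\<in>p_set s \<nu> \<gamma>. resp (\<lambda>\<tau>. chain_factor s (fst p) (snd p) (\<lambda>l. x l \<tau>) *\<^sub>R c \<gamma> \<tau>) t)" for s
      by (rule resp_sum[OF finite_p_set 1[OF \<gamma>]]) simp
    then show "resp (\<lambda>\<tau>. \<Sum>s=1..\<nu>. \<Sum>p\<in>p_set s \<nu> \<gamma>. chain_factor s (fst p) (snd p) (\<lambda>l. x l \<tau>) *\<^sub>R c \<gamma> \<tau>) t =
        (\<Sum>s=1..\<nu>. \<Sum>p\<in>p_set s \<nu> \<gamma>. resp (\<lambda>\<tau>. chain_factor s (fst p) (snd p) (\<lambda>l. x l \<tau>) *\<^sub>R c \<gamma> \<tau>) t)"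
      by (subst resp_sum[OF _ 2[OF \<gamma>]]) simp_all
  qed
  finally show "resp (\<lambda>\<tau>. coeff_sum \<nu> (\<lambda>l. x l \<tau>) (\<lambda>\<gamma>. c \<gamma> \<tau>)) t =
      (\<Sum>\<gamma> | 1 \<le> mi_abs \<gamma> \<and> mi_abs \<gamma> \<le> \<nu>. \<Sum>s=1..\<nu>. \<Sum>(ks, ls)\<in>p_set s \<nu> \<gamma>.
        LINT \<tau>|lebesgue. green A T S (t - \<tau>) *v (chain_factor s ks ls (\<lambda>l. x l \<tau>) *\<^sub>R c \<gamma> \<tau>))"
    by (simp add: case_prod_beta green_response_def)
qed

lemma formal_expansion_coefficients:
  assumes \<xi>: "formal_expansion A f0 f N \<xi>"
  defines "x \<equiv> \<lambda>\<epsilon> \<nu> t. \<epsilon> ^ \<nu> *\<^sub>R \<xi> \<nu> t"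
  shows "coefficient_integrals_converge (green A T S) f0 (scaled \<epsilon> f) N (x \<epsilon>)"
    and "coefficient_formulas (green A T S) f0 (scaled \<epsilon> f) N (x \<epsilon>)"
proof -
  note \<xi>' = formal_expansion_unfold[OF \<xi>]
  have x: "bounded_measurable (x \<epsilon> l)" if "l \<in> {1..N}" for l
    unfolding x_def by (intro bounded_measurable_scaleR bounded_measurable_const conjunct1[OF \<xi>'[OF that]])
  have c1: "bounded_measurable (\<lambda>\<tau>. mpartial \<gamma> (\<lambda>y. \<epsilon> *\<^sub>R f y \<tau>) 0)" if "mi_abs \<gamma> \<le> N" for \<gamma>
    unfolding mpartial_scaled[OF that]
    by (intro bounded_measurable_scaleR bounded_measurable_const bounded_measurable_mpartial that)
  have f0': "bounded_measurable (\<lambda>\<tau>. \<epsilon> *\<^sub>R f 0 \<tau>)"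
    using c1[of 0] by (simp add: mpartial_zero_index)
  have resp_x: "x \<epsilon> \<nu> t = resp (\<lambda>\<tau>. \<epsilon> ^ \<nu> *\<^sub>R rhs \<nu> (\<lambda>l. \<xi> l \<tau>) \<tau>) t" if "\<nu> \<in> {1..N}" for \<nu> t
    unfolding resp_scaleR x_def using \<xi>'[OF that] by metis
  \<comment> \<open>Powers of \<epsilon> are distributed by homogeneity: \<open>f0\<close> terms
    have weight \<nu>, forcing terms have weight \<open>\<nu> - 1\<close> plus the one factor
    absorbed by the scaled forcing.\<close>
  have rhs: "\<epsilon> ^ \<nu> *\<^sub>R rhs \<nu> (\<lambda>l. \<xi> l \<tau>) \<tau> = coeff_sum \<nu> (\<lambda>l. x \<epsilon> l \<tau>) (\<lambda>\<gamma>. mpartial \<gamma> f0 0) +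
      coeff_sum (\<nu> - 1) (\<lambda>l. x \<epsilon> l \<tau>) (\<lambda>\<gamma>. mpartial \<gamma> (\<lambda>y. \<epsilon> *\<^sub>R f y \<tau>) 0)" if \<nu>: "\<nu> \<in> {1..N}" for \<nu> \<tau>
  proof -
    have "coeff_sum (\<nu> - 1) y (\<lambda>\<gamma>. mpartial \<gamma> (\<lambda>y. \<epsilon> *\<^sub>R f y \<tau>) 0) =
        \<epsilon> *\<^sub>R coeff_sum (\<nu> - 1) y (\<lambda>\<gamma>. mpartial \<gamma> (\<lambda>y. f y \<tau>) 0)" for y
      using \<nu> unfolding coeff_sum_def scaleR_sum_right
      by (intro sum.cong) (auto simp: mpartial_scaled)
    moreover have "\<epsilon> ^ (\<nu> - 1) * \<epsilon> = \<epsilon> ^ \<nu>" using \<nu> by (simp add: power_eq_if)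
    ultimately show ?thesis
      by (simp add: x_def coeff_sum_scaled rhs_def scaleR_add_right)
  qed
  show "coefficient_integrals_converge (green A T S) f0 (scaled \<epsilon> f) N (x \<epsilon>)"
    unfolding coefficient_integrals_converge_def
  proof ((intro conjI allI ballI impI; (elim conjE)?), goal_cases)
    case (1 t)
    show ?case by (rule integrable_green[OF f0'])
  next
    case (2 \<nu> t \<gamma> s ks ls)
    show ?case
      by (rule integrable_green[OF resp_coeff_sum(1)[where c = "\<lambda>\<gamma> _. mpartial \<gamma> f0 0", OF _ x _ 2(3,5)]])
         (use 2 in \<open>auto intro: bounded_measurable_const\<close>)
  next
    case (3 \<nu> t \<gamma> s ks ls)
    show ?case
      by (rule integrable_green[OF resp_coeff_sum(1)[where c = "\<lambda>\<gamma> \<tau>. mpartial \<gamma> (\<lambda>y. \<epsilon> *\<^sub>R f y \<tau>) 0", OF _ x c1 3(3,5)]])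
         (use 3 in auto)
  qed
  show "coefficient_formulas (green A T S) f0 (scaled \<epsilon> f) N (x \<epsilon>)"
    unfolding coefficient_formulas_def
  proof (intro conjI allI ballI, goal_cases)
    case (1 t)
    have 1: "(1::nat) \<in> {1..N}" using N by simp
    \<comment> \<open>At first order only derivatives of \<open>f0\<close> of order at most one
      occur, and these vanish; what remains is the forcing at the origin.\<close>
    have "coeff_sum 1 y (\<lambda>\<gamma>. mpartial \<gamma> f0 0) = 0" for y
      unfolding coeff_sum_def by (intro sum.neutral) (auto simp: mpartial_f0_zero)
    then have "\<epsilon> ^ 1 *\<^sub>R rhs 1 (\<lambda>l. \<xi> l \<tau>) \<tau> = \<epsilon> *\<^sub>R f 0 \<tau>" for \<tau>
      unfolding rhs[OF 1] by (simp add: mpartial_zero_index)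
    then show ?case
      unfolding resp_x[OF 1] by (simp only: green_response_def)
  next
    case \<nu>: (2 \<nu> t)
    then have \<nu>1: "\<nu> \<in> {1..N}" "1 \<le> \<nu>" "1 \<le> \<nu> - 1" by auto
    have m0: "bounded_measurable (\<lambda>\<tau>. coeff_sum \<nu> (\<lambda>l. x \<epsilon> l \<tau>) (\<lambda>\<gamma>. mpartial \<gamma> f0 0))"
      by (rule resp_coeff_sum(2)[where c = "\<lambda>\<gamma> _. mpartial \<gamma> f0 0", OF \<nu>1(2) x])
         (use \<nu> in \<open>auto intro: bounded_measurable_const\<close>)
    have m1: "bounded_measurable (\<lambda>\<tau>. coeff_sum (\<nu> - 1) (\<lambda>l. x \<epsilon> l \<tau>) (\<lambda>\<gamma>. mpartial \<gamma> (\<lambda>y. \<epsilon> *\<^sub>R f y \<tau>) 0))"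
      by (rule resp_coeff_sum(2)[where c = "\<lambda>\<gamma> \<tau>. mpartial \<gamma> (\<lambda>y. \<epsilon> *\<^sub>R f y \<tau>) 0", OF \<nu>1(3) x c1])
         (use \<nu> in auto)
    show ?case
      unfolding resp_x[OF \<nu>1(1)] rhs[OF \<nu>1(1)] resp_add[OF m0 m1]
    proof (intro arg_cong2[where f = "(+)"], goal_cases)
      case 1
      show ?case
        by (rule resp_coeff_sum(3)[where c = "\<lambda>\<gamma> _. mpartial \<gamma> f0 0", OF \<nu>1(2) x])
           (use \<nu> in \<open>auto intro: bounded_measurable_const\<close>)
    next
      case 2
      show ?case
        by (rule resp_coeff_sum(3)[where c = "\<lambda>\<gamma> \<tau>. mpartial \<gamma> (\<lambda>y. \<epsilon> *\<^sub>R f y \<tau>) 0", OF \<nu>1(3) x c1])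
           (use \<nu> in auto)
    qed
  qed
qed

end

section \<open>Approximation of the trajectory\<close>

context hyperbolic_perturbation
begin

lemma formal_expansion_bound:
  assumes \<xi>: "formal_expansion A f0 f N \<xi>"
  obtains C where "1 \<le> C" "\<And>l t. l \<in> {1..N} \<Longrightarrow> norm (\<xi> l t) \<le> C"
proof -
  have "\<exists>B. \<forall>t. norm (\<xi> l t) \<le> B" if "l \<in> {1..N}" for l
    using \<xi> that unfolding formal_expansion_iff bounded_iff by blast
  then obtain B where B: "\<And>l t. l \<in> {1..N} \<Longrightarrow> norm (\<xi> l t) \<le> B l" by metis
  show ?thesis
  proof (rule that)
    show "1 \<le> 1 + (\<Sum>l=1..N. \<bar>B l\<bar>)" by (simp add: sum_nonneg)
    show "norm (\<xi> l t) \<le> 1 + (\<Sum>l=1..N. \<bar>B l\<bar>)" if l: "l \<in> {1..N}" for l t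
      using B[OF l, of t] member_le_sum[OF l, of "\<lambda>l. \<bar>B l\<bar>"] by simp
  qed
qed

text \<open>A forcing that vanishes at the origin drives nothing at first order, and in each later
  order every term contains a factor from a lower level. Used when the sup norm of the forcing is
  zero.\<close>

lemma formal_expansion_zero:
  assumes \<xi>: "formal_expansion A f0 f N \<xi>" and f: "\<And>t. f 0 t = 0"
  shows "\<nu> \<in> {1..N} \<Longrightarrow> \<xi> \<nu> t = 0"
proof (induction \<nu> arbitrary: t rule: less_induct)
  case (less \<nu>)
  have z: "coeff_sum \<mu> (\<lambda>_. 0) c = 0" if "1 \<le> \<mu>" for \<mu> and c :: "nat^'n \<Rightarrow> real^'n"
    using coeff_sum_scaled[of \<mu> 0 "\<lambda>_. 0" c] that by (simp add: power_0_left)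
  have "rhs \<nu> (\<lambda>l. \<xi> l t) t = rhs \<nu> (\<lambda>_. 0) t" for t
    by (rule rhs_cong) (use less in auto)
  also have "rhs \<nu> (\<lambda>_. 0) t = 0" for t
    unfolding rhs_def using less.prems z[of \<nu>] z[of "\<nu> - 1"]
    by (cases "\<nu> = 1") (auto simp: mpartial_zero_index f)
  finally have "rhs \<nu> (\<lambda>l. \<xi> l t) t = 0" for t .
  then have "\<xi> \<nu> = resp (\<lambda>t. 0)" using formal_expansion_unfold[OF \<xi> less.prems] by simp
  then show ?case by (simp add: green_response_def)
qed

text \<open>For the supremum \<open>B\<close> of the error, the solution operator gives
  \<open>B \<le> K * b\<close>, and the constants are tuned so that the Lipschitz terms contribute
  at most \<open>B / 2\<close> and the residual at most half the tolerance.\<close>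

lemma approximation:
  assumes \<xi>: "formal_expansion A f0 f N \<xi>" and \<epsilon>0: "\<epsilon>0 > 0"
    and x: "\<And>\<epsilon>. \<epsilon> \<in> {0<..\<epsilon>0} \<Longrightarrow> solves (vfield A f0 (scaled \<epsilon> f)) (x \<epsilon>)"
    and small: "uniform_limit UNIV x (\<lambda>t. 0) (at_right 0)" and e: "e > 0"
  shows "\<forall>\<^sub>F \<epsilon> in at_right 0. \<forall>t. norm (x \<epsilon> t - (\<Sum>\<nu>=1..N. \<epsilon> ^ \<nu> *\<^sub>R \<xi> \<nu> t)) \<le> e * \<epsilon> ^ N"
proof -
  let ?n = "real CARD('n)"
  obtain K where K: "K > 0" "\<And>g B t. g \<in> borel_measurable lebesgue \<Longrightarrow> (\<And>t. norm (g t) \<le> B) \<Longrightarrow>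
      norm (resp g t) \<le> K * B"
    using green_response[OF A T] by metis
  obtain C where C: "1 \<le> C" "\<And>l t. l \<in> {1..N} \<Longrightarrow> norm (\<xi> l t) \<le> C"
    using formal_expansion_bound[OF \<xi>] by blast
  have r1: "1 \<le> r" using N by simp
  \<comment> \<open>A bound \<kappa> on the first partial derivatives gives \<open>f0\<close> the
    Lipschitz constant \<open>?n * \<kappa>\<close>, so that \<open>K\<close> times it is one
    quarter. It is attained near zero because these derivatives vanish at the origin.\<close>
  define \<kappa> where "\<kappa> = 1 / (4 * ?n * K)"
  have \<kappa>: "\<kappa> > 0" "K * (?n * \<kappa>) = 1 / 4" using K by (auto simp: \<kappa>_def)
  have "\<forall>\<^sub>F y in nhds 0. y \<in> V \<and> (\<forall>i. dist (pds [i] f0 y) (pds [i] f0 0) < \<kappa>)"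
  proof (intro eventually_conj eventually_all_finite)
    show "\<forall>\<^sub>F y in nhds 0. y \<in> V" using V by (rule eventually_nhds_in_open)
    fix i
    have "continuous_on V (pds [i] f0)" by (rule Ck_open_continuous[OF f0(1)]) (use r1 in simp)
    then have "isCont (pds [i] f0) 0" using V by (simp add: continuous_on_eq_continuous_at)
    then show "\<forall>\<^sub>F y in nhds 0. dist (pds [i] f0 y) (pds [i] f0 0) < \<kappa>"
      using \<kappa> unfolding isCont_def tendsto_iff by (auto simp: eventually_nhds_conv_at)
  qed
  then obtain \<rho> where \<rho>: "\<rho> > 0" "\<And>y. norm y < \<rho> \<Longrightarrow> y \<in> V" "\<And>y i. norm y < \<rho> \<Longrightarrow> norm (pds [i] f0 y) \<le> \<kappa>"
    unfolding eventually_nhds_metric by (auto simp: dist_norm f0 less_imp_le)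
  have ball: "ball 0 \<rho> \<subseteq> V" using \<rho>(2) by auto
  have "\<exists>M. \<forall>x\<in>V. \<forall>t. norm (pds [i] (\<lambda>x. f x t) x) \<le> M" for i
    by (rule f_bounds) (use r1 in simp)
  then obtain D where D: "\<And>i x t. x \<in> V \<Longrightarrow> norm (pds [i] (\<lambda>x. f x t) x) \<le> D i" by metis
  define M1 where "M1 = (\<Sum>i\<in>UNIV. \<bar>D i\<bar>)"
  have M1: "norm (pds [i] (\<lambda>x. f x t) x) \<le> M1" if "x \<in> V" for i x t
    using D[OF that, of i t] member_le_sum[of i UNIV "\<lambda>i. \<bar>D i\<bar>"] by (simp add: M1_def)
  have M1_0: "M1 \<ge> 0" by (simp add: M1_def sum_nonneg)
  obtain M2 where M2: "\<And>x t. x \<in> V \<Longrightarrow> norm (f x t) \<le> M2" using f_bounds[of "[]"] by auto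
  obtain \<delta> where \<delta>: "\<delta> > 0" "\<And>\<epsilon> y t. 0 < \<epsilon> \<Longrightarrow> \<epsilon> < \<delta> \<Longrightarrow> (\<And>l. l \<in> {1..N} \<Longrightarrow> norm (y l) \<le> C) \<Longrightarrow>
    norm (residual \<epsilon> y t) \<le> e / (2 * K) * \<epsilon> ^ N"
    using residual_small[OF C(1), of "e / (2 * K)"] e K(1) by auto
  \<comment> \<open>The fourth entry keeps the ansatz in the ball of radius \<rho>; the last one
    limits the Lipschitz term of the forcing to a further quarter.\<close>
  have "\<forall>\<^sub>F \<epsilon> in at_right 0. \<epsilon> \<in> {0<..<Min {\<epsilon>0, \<delta>, 1, \<rho> / (real N * C), 1 / (4 * K * ?n * (M1 + 1))}}"
    using \<epsilon>0 \<delta>(1) \<rho>(1) C(1) N K(1) M1_0 by (intro eventually_at_right_real) auto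
  moreover have "\<forall>\<^sub>F \<epsilon> in at_right 0. \<forall>t\<in>UNIV. dist (x \<epsilon> t) 0 < \<rho>"
    using uniform_limitD[OF small \<rho>(1)] by simp
  ultimately show ?thesis
  proof eventually_elim
    case (elim \<epsilon>)
    then have \<epsilon>: "0 < \<epsilon>" "\<epsilon> \<le> \<epsilon>0" "\<epsilon> < \<delta>" "\<epsilon> \<le> 1" "\<epsilon> < \<rho> / (real N * C)" "\<epsilon> < 1 / (4 * K * ?n * (M1 + 1))"
      by auto
    have x\<rho>: "norm (x \<epsilon> t) < \<rho>" for t using elim by simp
    define P where "P t = (\<Sum>\<nu>=1..N. \<epsilon> ^ \<nu> *\<^sub>R \<xi> \<nu> t)" for t
    have P\<rho>: "norm (P t) < \<rho>" for t
    proof -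
      have "norm (P t) \<le> real N * C * \<epsilon>"
        unfolding P_def by (rule norm_ansatz_le) (use C \<epsilon> in auto)
      also have "\<dots> < \<rho>" using \<epsilon>(5) C(1) N by (simp add: field_simps)
      finally show ?thesis .
    qed
    define y where "y t = x \<epsilon> t - P t" for t
    define g where "g t = f0 (x \<epsilon> t) + \<epsilon> *\<^sub>R f (x \<epsilon> t) t - (\<Sum>\<nu>=1..N. \<epsilon> ^ \<nu> *\<^sub>R rhs \<nu> (\<lambda>l. \<xi> l t) t)" for t
    have ys: "solves (\<lambda>s v. A *v v + g s) y"
      unfolding solves_def
    proof (intro allI impI)
      fix a b :: real assume ab: "a \<le> b"
      have "((\<lambda>s. vfield A f0 (scaled \<epsilon> f) s (x \<epsilon> s) -
          (\<Sum>\<nu>=1..N. \<epsilon> ^ \<nu> *\<^sub>R (A *v \<xi> \<nu> s + rhs \<nu> (\<lambda>l. \<xi> l s) s))) has_integral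
          (x \<epsilon> b - x \<epsilon> a) - (\<Sum>\<nu>=1..N. \<epsilon> ^ \<nu> *\<^sub>R (\<xi> \<nu> b - \<xi> \<nu> a))) {a..b}"
        using x[of \<epsilon>] \<epsilon> \<xi> ab unfolding formal_expansion_iff solves_def
        by (intro has_integral_diff has_integral_sum has_integral_cmul) auto
      moreover have "vfield A f0 (scaled \<epsilon> f) s (x \<epsilon> s) -
          (\<Sum>\<nu>=1..N. \<epsilon> ^ \<nu> *\<^sub>R (A *v \<xi> \<nu> s + rhs \<nu> (\<lambda>l. \<xi> l s) s)) = A *v y s + g s" for s
        by (simp add: vfield_def y_def g_def P_def scaleR_add_right sum.distrib matrix_vector_mult_diff_distrib
            linear_sum[OF matrix_vector_mul_linear] matrix_vector_mult_scaleR o_def)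
      moreover have "(x \<epsilon> b - x \<epsilon> a) - (\<Sum>\<nu>=1..N. \<epsilon> ^ \<nu> *\<^sub>R (\<xi> \<nu> b - \<xi> \<nu> a)) = y b - y a"
        by (simp add: y_def P_def scaleR_diff_right sum_subtractf)
      ultimately show "((\<lambda>s. A *v y s + g s) has_integral y b - y a) {a..b}" by simp
    qed
    \<comment> \<open>A crude bound is needed first: the terms in \<open>B\<close> can be absorbed
      on the left only if the supremum is finite.\<close>
    have y2\<rho>: "norm (y t) \<le> \<rho> + \<rho>" for t
      unfolding y_def using norm_triangle_ineq4[of "x \<epsilon> t" "P t"] x\<rho>[of t] P\<rho>[of t] by simp
    define B where "B = (SUP t. norm (y t))"
    have yB: "norm (y t) \<le> B" for t
      unfolding B_def by (rule cSUP_upper) (auto intro!: bdd_aboveI2 y2\<rho>)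
    define b where "b = ?n * \<kappa> * B + \<epsilon> * (?n * M1 * B) + e / (2 * K) * \<epsilon> ^ N"
    have gb: "norm (g t) \<le> b" for t
    proof -
      have "norm (f0 (x \<epsilon> t) - f0 (P t)) \<le> ?n * \<kappa> * norm (y t)"
        unfolding y_def by (rule Lipschitz_ball[OF f0(1) V(1) r1 ball]) (use \<rho>(3) x\<rho> P\<rho> in auto)
      also have "\<dots> \<le> ?n * \<kappa> * B" using \<kappa>(1) by (intro mult_left_mono yB) auto
      finally have 1: "norm (f0 (x \<epsilon> t) - f0 (P t)) \<le> ?n * \<kappa> * B" .
      have "norm (f (x \<epsilon> t) t - f (P t) t) \<le> ?n * M1 * norm (y t)"
        unfolding y_def by (rule Lipschitz_ball[OF f V(1) r1 ball]) (use M1 ball x\<rho> P\<rho> in auto)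
      also have "\<dots> \<le> ?n * M1 * B" using M1_0 by (intro mult_left_mono yB) auto
      finally have "norm (\<epsilon> *\<^sub>R (f (x \<epsilon> t) t - f (P t) t)) \<le> \<epsilon> * (?n * M1 * B)"
        using \<epsilon>(1) by simp
      note 2 = this
      have 3: "norm (residual \<epsilon> (\<lambda>l. \<xi> l t) t) \<le> e / (2 * K) * \<epsilon> ^ N"
        by (rule \<delta>(2)) (use \<epsilon> C in auto)
      have "g t = (f0 (x \<epsilon> t) - f0 (P t)) + \<epsilon> *\<^sub>R (f (x \<epsilon> t) t - f (P t) t) +
          residual \<epsilon> (\<lambda>l. \<xi> l t) t"
        by (simp add: g_def P_def residual_def scaleR_diff_right)
      then show ?thesis unfolding b_def by (simp only:) (intro norm_triangle_mono 1 2 3)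
    qed
    have bg: "bounded (range g)" using gb by (auto intro: boundedI)
    have yr: "bounded (range y)" using yB by (auto intro: boundedI)
    note u = resp_unique[OF bg yr ys]
    have "norm (y t) \<le> K * b" for t
      using K(2)[of g b t] u(1,2) gb by (simp add: bounded_measurable_def)
    then have "B \<le> K * b" unfolding B_def by (intro cSUP_least) auto
    also have "K * b = K * (?n * \<kappa>) * B + (K * ?n * (\<epsilon> * M1)) * B + e / 2 * \<epsilon> ^ N"
      using K(1) by (simp add: b_def field_simps)
    also have "\<dots> \<le> 1 / 4 * B + 1 / 4 * B + e / 2 * \<epsilon> ^ N"
    proof -
      have "B \<ge> 0" using order_trans[OF norm_ge_zero yB] .
      moreover have "K * ?n * (\<epsilon> * M1) \<le> 1 / 4"
      proof -
        have "\<epsilon> * (4 * K * ?n * (M1 + 1)) < 1"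
          using \<epsilon>(6) K(1) M1_0 by (subst (asm) pos_less_divide_eq) auto
        moreover have "\<epsilon> * (4 * K * ?n * M1) \<le> \<epsilon> * (4 * K * ?n * (M1 + 1))"
          using \<epsilon>(1) K(1) by (intro mult_left_mono) auto
        ultimately show ?thesis by (simp add: mult_ac)
      qed
      ultimately have "(K * ?n * (\<epsilon> * M1)) * B \<le> 1 / 4 * B" by (intro mult_right_mono)
      then show ?thesis unfolding \<kappa>(2) by simp
    qed
    finally have "B \<le> e * \<epsilon> ^ N" by simp
    then show ?case using yB order_trans unfolding y_def P_def by blast
  qed
qed

end

section \<open>Passage to the amplitude of the forcing\<close>

lemma abs_SUP_norm_le:
  fixes h :: "real \<Rightarrow> 'a::real_normed_vector"
  assumes "\<And>t. norm (h t) \<le> b"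
  shows "\<bar>SUP t. norm (h t)\<bar> \<le> b"
proof -
  have "norm (h 0) \<le> (SUP t. norm (h t))"
    by (rule cSUP_upper) (auto intro!: bdd_aboveI2 assms)
  moreover have "(SUP t. norm (h t)) \<le> b" by (rule cSUP_least) (auto intro: assms)
  ultimately show ?thesis using order_trans[OF norm_ge_zero] by fastforce
qed

text \<open>Converts estimates in powers of \<epsilon> into estimates in powers of the amplitude,
  which appears on the larger side.\<close>

lemma supnorm_scaled_ge:
  fixes f :: "real^'n \<Rightarrow> real \<Rightarrow> real^'n"
  assumes bdd: "bdd_above ((\<lambda>(x, t). norm (f x t)) ` (U \<times> UNIV))" and U: "U \<noteq> {}" and \<epsilon>: "0 < \<epsilon>"
  shows "\<epsilon> * supnorm U f \<le> supnorm U (scaled \<epsilon> f)"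
proof -
  obtain M where M: "\<And>x t. x \<in> U \<Longrightarrow> norm (f x t) \<le> M" using bdd by (auto simp: bdd_above_def)
  have "supnorm U f \<le> supnorm U (scaled \<epsilon> f) / \<epsilon>"
    unfolding supnorm_def[of U f]
  proof (rule cSUP_least)
    fix p assume "p \<in> U \<times> (UNIV :: real set)"
    then obtain x t where p: "p = (x, t)" "x \<in> U" by auto
    have "(case (x, t) of (x, t) \<Rightarrow> norm (\<epsilon> *\<^sub>R f x t)) \<le> supnorm U (scaled \<epsilon> f)"
      unfolding supnorm_def using p M \<epsilon>
      by (intro cSUP_upper) (auto intro!: bdd_aboveI2[where M = "\<epsilon> * M"])
    then show "(case p of (x, t) \<Rightarrow> norm (f x t)) \<le> supnorm U (scaled \<epsilon> f) / \<epsilon>"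
      using \<epsilon> p by (simp add: field_simps)
  qed (use U in auto)
  then show ?thesis using \<epsilon> by (simp add: field_simps)
qed

lemma norm_le_supnorm:
  assumes "bdd_above ((\<lambda>(x, t). norm (f x t)) ` (U \<times> UNIV))" "x \<in> U"
  shows "norm (f x t) \<le> supnorm U f"
  unfolding supnorm_def using cSUP_upper[OF _ assms(1), of "(x, t)"] assms(2) by simp

text \<open>The relation \<open>o[at 0]\<close> says nothing about the value at zero, which
  continuity supplies. The difference quotients along the axes then tend to zero, which removes the
  first partial derivatives.\<close>

lemma little_o_imp_zero:
  fixes f :: "real^'n \<Rightarrow> real^'n"
  assumes o: "(\<lambda>x. norm (f x)) \<in> o[at 0](\<lambda>x. norm x)" and cont: "isCont f 0"
    and D: "\<And>i. ((\<lambda>h. f (0 + h *\<^sub>R axis i 1)) has_vector_derivative D i) (at 0)"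
  shows "f 0 = 0" "D i = 0"
proof -
  have small: "\<forall>\<^sub>F x in at 0. norm (f x) \<le> c * norm x" if "c > 0" for c
    using landau_o.smallD[OF o that] by simp
  have "(f \<longlongrightarrow> 0) (at 0)"
  proof (rule Lim_null_comparison)
    show "\<forall>\<^sub>F x in at 0. norm (f x) \<le> 1 * norm x" by (rule small) simp
    show "((\<lambda>x::real^'n. 1 * norm x) \<longlongrightarrow> 0) (at 0)" by (auto intro!: tendsto_eq_intros)
  qed
  with cont show f0: "f 0 = 0" unfolding isCont_def using LIM_unique by blast
  have "((\<lambda>h. (1 / h) *\<^sub>R (f (0 + h *\<^sub>R axis i 1) - f (0 + 0 *\<^sub>R axis i 1))) \<longlongrightarrow> D i) (at 0)"
    by (rule has_vector_derivative_imp_quotient[OF D])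
  then have lim: "((\<lambda>h. norm ((1 / h) *\<^sub>R f (h *\<^sub>R axis i 1))) \<longlongrightarrow> norm (D i)) (at 0)"
    by (intro tendsto_norm) (simp add: f0)
  have ray: "filterlim (\<lambda>h. h *\<^sub>R axis i (1::real)) (at 0) (at (0::real))"
    by (intro filterlim_atI) (auto intro!: tendsto_eq_intros simp: eventually_at_filter axis_eq_0_iff)
  have "norm (D i) \<le> c" if "c > 0" for c
  proof (rule tendsto_upperbound[OF lim])
    have "\<forall>\<^sub>F h in at 0. norm (f (h *\<^sub>R axis i 1)) \<le> c * norm (h *\<^sub>R axis i (1::real))"
      using small[OF that] ray by (rule eventually_compose_filterlim)
    then show "\<forall>\<^sub>F h in at 0. norm ((1 / h) *\<^sub>R f (h *\<^sub>R axis i 1)) \<le> c"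
    proof (rule eventually_rev_mp, intro eventually_at_filter[THEN iffD2] always_eventually allI impI)
      fix h :: real assume "h \<noteq> 0" "norm (f (h *\<^sub>R axis i 1)) \<le> c * norm (h *\<^sub>R axis i (1::real))"
      then show "norm ((1 / h) *\<^sub>R f (h *\<^sub>R axis i 1)) \<le> c" by (simp add: field_simps)
    qed
  qed simp
  then have "norm (D i) \<le> 0" using field_le_epsilon[of "norm (D i)" 0] by simp
  then show "D i = 0" by simp
qed

theorem theorem2:
  fixes A T :: "real^'n^'n" and S :: "'n set"
    and U :: "(real^'n) set"
    and f0 :: "real^'n \<Rightarrow> real^'n" and f :: "real^'n \<Rightarrow> real \<Rightarrow> real^'n"
    and xstar :: "real \<Rightarrow> real \<Rightarrow> real^'n"
    and r N :: nat and \<epsilon>0 :: real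
  assumes U: "compact U" "0 \<in> interior U"
    and A: "semisimple A" "hyperbolic A"
    and T: "splitting_basis A T S"
    and f0: "Ck_compact r U f0" "(\<lambda>x. norm (f0 x)) \<in> o[at 0](\<lambda>x. norm x)"
    and f_bounded: "bdd_above ((\<lambda>(x, t). norm (f x t)) ` (U \<times> UNIV))"
    and f_measurable: "\<And>x. x \<in> U \<Longrightarrow> (\<lambda>t. f x t) \<in> borel_measurable lebesgue"
    and f_smooth: "\<exists>V. open V \<and> 0 \<in> V \<and> V \<subseteq> U \<and> (\<forall>t. Ck_open r V (\<lambda>x. f x t)) \<and>
          (\<forall>is. length is \<le> r \<longrightarrow> (\<exists>M. \<forall>x\<in>V. \<forall>t. norm (pds is (\<lambda>x. f x t) x) \<le> M))"
    and \<epsilon>0: "\<epsilon>0 > 0"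
    and xstar: "\<And>\<epsilon>. \<epsilon> \<in> {0<..\<epsilon>0} \<Longrightarrow> bounded_trajectory A f0 (scaled \<epsilon> f) U (xstar \<epsilon>)"
    and xstar_unique: "\<And>\<epsilon> y. \<epsilon> \<in> {0<..\<epsilon>0} \<Longrightarrow> bounded_trajectory A f0 (scaled \<epsilon> f) U y \<Longrightarrow>
          y = xstar \<epsilon>"
    and xstar_perturbs: "uniform_limit UNIV xstar (\<lambda>t. 0) (at_right 0)"
    and r: "1 \<le> r" and N: "1 \<le> N" "N \<le> r"
  shows "(\<exists>\<xi>. formal_expansion A f0 f N \<xi>) \<and>
    (\<forall>\<xi>. formal_expansion A f0 f N \<xi> \<longrightarrow>
      (\<lambda>\<epsilon>. SUP t. norm (xstar \<epsilon> t - (\<Sum>\<nu>=1..N. \<epsilon> ^ \<nu> *\<^sub>R \<xi> \<nu> t)))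
         \<in> o[at_right 0](\<lambda>\<epsilon>. supnorm U (scaled \<epsilon> f) ^ N) \<and>
      (\<forall>\<nu>\<in>{1..N}. (\<lambda>\<epsilon>. SUP t. norm (\<epsilon> ^ \<nu> *\<^sub>R \<xi> \<nu> t))
         \<in> O[at_right 0](\<lambda>\<epsilon>. supnorm U (scaled \<epsilon> f) ^ \<nu>)) \<and>
      (\<forall>\<epsilon>\<ge>0.
         coefficient_integrals_converge (green A T S) f0 (scaled \<epsilon> f) N (\<lambda>\<nu> t. \<epsilon> ^ \<nu> *\<^sub>R \<xi> \<nu> t) \<and>
         coefficient_formulas (green A T S) f0 (scaled \<epsilon> f) N (\<lambda>\<nu> t. \<epsilon> ^ \<nu> *\<^sub>R \<xi> \<nu> t)))"
proof -
  obtain V where V: "open V" "0 \<in> V" "V \<subseteq> U" and fV: "\<And>t. Ck_open r V (\<lambda>x. f x t)"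
    and fM: "\<And>is. length is \<le> r \<Longrightarrow> \<exists>M. \<forall>x\<in>V. \<forall>t. norm (pds is (\<lambda>x. f x t) x) \<le> M"
    using f_smooth by blast
  have f0V: "Ck_open r V f0"
    using f0(1) Ck_open_mono[of r "interior U" f0 r V] interior_maximal[OF V(3,1)]
    by (simp add: Ck_compact_def)
  have "continuous_on V f0" using Ck_open_continuous[OF f0V, of "[]"] by simp
  then have cont: "isCont f0 0" using V by (simp add: continuous_on_eq_continuous_at)
  have D: "((\<lambda>h. f0 (0 + h *\<^sub>R axis i 1)) has_vector_derivative pd i f0 0) (at 0)" for i
    using Ck_open_has_pd[OF f0V, of "[]" 0 i] r V by simp
  note zero = little_o_imp_zero[OF f0(2) cont D]
  interpret hyperbolic_perturbation A f0 f V r N T S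
    by unfold_locales (use V f0V zero fV fM f_measurable N A T in auto)
  have U0: "0 \<in> U" using U(2) interior_subset by blast
  have sup0: "supnorm U f \<ge> 0"
    using order_trans[OF norm_ge_zero norm_le_supnorm[OF f_bounded U0]] .
  have scaled_ge: "\<epsilon> * supnorm U f \<le> supnorm U (scaled \<epsilon> f)" if "\<epsilon> > 0" for \<epsilon>
    using supnorm_scaled_ge[OF f_bounded _ that] U0 by auto
  have pow_ge: "(\<epsilon> * supnorm U f) ^ k \<le> norm (supnorm U (scaled \<epsilon> f) ^ k)" if "\<epsilon> > 0" for \<epsilon> k
    using power_mono[OF scaled_ge[OF that], of k] that sup0 by simp
  have main: "(\<lambda>\<epsilon>. SUP t. norm (xstar \<epsilon> t - (\<Sum>\<nu>=1..N. \<epsilon> ^ \<nu> *\<^sub>R \<xi> \<nu> t)))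
         \<in> o[at_right 0](\<lambda>\<epsilon>. supnorm U (scaled \<epsilon> f) ^ N) \<and>
      (\<forall>\<nu>\<in>{1..N}. (\<lambda>\<epsilon>. SUP t. norm (\<epsilon> ^ \<nu> *\<^sub>R \<xi> \<nu> t))
         \<in> O[at_right 0](\<lambda>\<epsilon>. supnorm U (scaled \<epsilon> f) ^ \<nu>))"
    if \<xi>: "formal_expansion A f0 f N \<xi>" for \<xi>
  \<comment> \<open>With zero amplitude the comparison functions vanish, so the quantities compared
    with them must vanish as well. The zero function is then a trajectory, and uniqueness equates it
    with \<open>xstar\<close>.\<close>
  proof (cases "supnorm U f = 0")
    case True
    have f00: "f 0 t = 0" for t
      using norm_le_supnorm[OF f_bounded U0, of t] True by simp
    have \<xi>0: "\<xi> \<nu> t = 0" if "\<nu> \<in> {1..N}" for \<nu> t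
      by (rule formal_expansion_zero[OF \<xi> f00 that])
    have "xstar \<epsilon> = (\<lambda>t. 0)" if "\<epsilon> \<in> {0<..\<epsilon>0}" for \<epsilon>
    proof (rule xstar_unique[OF that, symmetric])
      show "bounded_trajectory A f0 (scaled \<epsilon> f) U (\<lambda>t. 0)"
        using U0 zero(1) f00 by (auto simp: bounded_trajectory_def solves_def vfield_def)
    qed
    then have "\<forall>\<^sub>F \<epsilon> in at_right 0. (SUP t. norm (xstar \<epsilon> t - (\<Sum>\<nu>=1..N. \<epsilon> ^ \<nu> *\<^sub>R \<xi> \<nu> t))) = 0"
      using eventually_at_right_real[OF \<epsilon>0] by (auto elim!: eventually_mono simp: \<xi>0)
    moreover have "(SUP t. norm (\<epsilon> ^ \<nu> *\<^sub>R \<xi> \<nu> t)) = 0" if "\<nu> \<in> {1..N}" for \<nu> \<epsilon>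
      by (simp add: \<xi>0[OF that])
    ultimately show ?thesis
      by (auto intro!: landau_o.smallI elim!: eventually_mono)
  next
    case False
    then have sup: "supnorm U f > 0" using sup0 by simp
    have "(\<lambda>\<epsilon>. SUP t. norm (xstar \<epsilon> t - (\<Sum>\<nu>=1..N. \<epsilon> ^ \<nu> *\<^sub>R \<xi> \<nu> t)))
         \<in> o[at_right 0](\<lambda>\<epsilon>. supnorm U (scaled \<epsilon> f) ^ N)"
    proof (rule landau_o.smallI)
      fix c :: real assume c: "c > 0"
      have sol: "solves (vfield A f0 (scaled \<epsilon> f)) (xstar \<epsilon>)" if "\<epsilon> \<in> {0<..\<epsilon>0}" for \<epsilon>
        using xstar[OF that] by (simp add: bounded_trajectory_def)
      \<comment> \<open>The tolerance is \<open>c\<close> times the \<open>N\<close>-th power of the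
        unscaled sup norm, so that together with \<open>\<epsilon> ^ N\<close> it forms the
        \<open>N\<close>-th power of a lower bound for the amplitude.\<close>
      have "\<forall>\<^sub>F \<epsilon> in at_right 0. \<forall>t. norm (xstar \<epsilon> t - (\<Sum>\<nu>=1..N. \<epsilon> ^ \<nu> *\<^sub>R \<xi> \<nu> t))
          \<le> c * supnorm U f ^ N * \<epsilon> ^ N"
        by (rule approximation[OF \<xi> \<epsilon>0 sol xstar_perturbs]) (use c sup in auto)
      moreover have "\<forall>\<^sub>F \<epsilon> in at_right 0. \<epsilon> \<in> {0<..<1::real}"
        by (rule eventually_at_right_real) simp
      ultimately show "\<forall>\<^sub>F \<epsilon> in at_right 0. norm (SUP t. norm (xstar \<epsilon> t - (\<Sum>\<nu>=1..N. \<epsilon> ^ \<nu> *\<^sub>R \<xi> \<nu> t)))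
          \<le> c * norm (supnorm U (scaled \<epsilon> f) ^ N)"
      proof eventually_elim
        case (elim \<epsilon>)
        then have "norm (SUP t. norm (xstar \<epsilon> t - (\<Sum>\<nu>=1..N. \<epsilon> ^ \<nu> *\<^sub>R \<xi> \<nu> t))) \<le> c * (\<epsilon> * supnorm U f) ^ N"
          unfolding real_norm_def by (intro abs_SUP_norm_le) (simp add: power_mult_distrib mult_ac)
        also have "\<dots> \<le> c * norm (supnorm U (scaled \<epsilon> f) ^ N)"
          using c elim by (intro mult_left_mono pow_ge) auto
        finally show ?case .
      qed
    qed
    moreover have "(\<lambda>\<epsilon>. SUP t. norm (\<epsilon> ^ \<nu> *\<^sub>R \<xi> \<nu> t)) \<in> O[at_right 0](\<lambda>\<epsilon>. supnorm U (scaled \<epsilon> f) ^ \<nu>)"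
      if \<nu>: "\<nu> \<in> {1..N}" for \<nu>
    proof -
      obtain C where C: "1 \<le> C" "\<And>l t. l \<in> {1..N} \<Longrightarrow> norm (\<xi> l t) \<le> C"
        using formal_expansion_bound[OF \<xi>] by blast
      have "\<forall>\<^sub>F \<epsilon> in at_right 0. \<epsilon> \<in> {0<..<1::real}"
        by (rule eventually_at_right_real) simp
      then have "\<forall>\<^sub>F \<epsilon> in at_right 0. norm (SUP t. norm (\<epsilon> ^ \<nu> *\<^sub>R \<xi> \<nu> t))
          \<le> C / supnorm U f ^ \<nu> * norm (supnorm U (scaled \<epsilon> f) ^ \<nu>)"
      proof eventually_elim
        case (elim \<epsilon>)
        have "norm (SUP t. norm (\<epsilon> ^ \<nu> *\<^sub>R \<xi> \<nu> t)) \<le> C / supnorm U f ^ \<nu> * (\<epsilon> * supnorm U f) ^ \<nu>"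
          unfolding real_norm_def
          by (intro abs_SUP_norm_le) (use C(2)[OF \<nu>] elim sup in \<open>simp add: power_mult_distrib mult.commute\<close>)
        also have "\<dots> \<le> C / supnorm U f ^ \<nu> * norm (supnorm U (scaled \<epsilon> f) ^ \<nu>)"
          using C(1) sup elim by (intro mult_left_mono pow_ge) auto
        finally show ?case .
      qed
      then show ?thesis by (rule landau_o.bigI[rotated]) (use C(1) sup in auto)
    qed
    ultimately show ?thesis by blast
  qed
  show ?thesis
    using formal_expansion_exists main formal_expansion_coefficients by blast
qed

end
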